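(* The condition $$\lim_{n\to\infty}\int_{\mathcal{X}}\Delta[\Phi,F_n(x;\cdot)]\,\pi\{dx\}=0$$ (asymptotic normality of $S_n/\sigma_n$ given $X_0$) holds if and only if there is a martingale approximation $(D_{nk})$ to $S_n$ for which $$\frac{1}{\sigma_n^2}\sum_{k=1}^n E(D_{nk}^2\mid\mathcal{F}_{k-1})\xrightarrow{p}1$$ and, for each $\varepsilon>0$, $$\frac{1}{\sigma_n^2}\sum_{k=1}^n E\big(D_{nk}^2\mathbf{1}_{\{|D_{nk}|\ge\varepsilon\sigma_n\}}\mid\mathcal{F}_{k-1}\big)\xrightarrow{p}0$$ as $n\to\infty$.
   Context: Let $(X_n)_{n\in\mathbb{Z}}$ be a stationary and ergodic Markov chain, on a probability space with probability $P$, with values in a state space $\mathcal{X}$. Let $\pi$ denote the marginal distribution of $X_0$; suppose there is a regular conditional distribution for $X_1$ given $X_0$, $Q(x;B)=P(X_1\in B\mid X_0=x)$. Let $g:\mathcal{X}\to\mathbb{R}$ be measurable with $E[g(X_0)]=0$ and $E[g(X_0)^2]<\infty$. Put $S_n=\sum_{i=1}^n g(X_i)$ and $\sigma_n^2=E(S_n^2)$, and assume $\sigma_n^2\to\infty$ as $n\to\infty$. Let $\mathcal{F}_j=\sigma(\ldots,X_{j-1},X_j)$. A doubly indexed sequence $D_{nj}$ ($n,j\ge1$) of random variables such that for each $n$, $D_{nj}$, $j=1,2,\ldots$, are martingale differences with respect to $(\mathcal{F}_j)$, with associated martingales $M_{nk}=D_{n1}+\cdots+D_{nk}$, is called a martingale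 approximation (to $S_n$) if $\max_{k\le n}E[(S_k-M_{nk})^2]=o(\sigma_n^2)$ as $n\to\infty$. $P^x$ denotes the regular conditional probability for $\mathcal{F}_\infty=\sigma(X_k:k\in\mathbb{Z})$ given $X_0=x$; $S_n^*=S_n/\sigma_n$; $F_n(x;z)=P^x(S_n^*\le z)$; $\Phi$ is the standard normal distribution function; $\Delta$ is the Lévy distance between distribution functions on $\mathbb{R}$. $\xrightarrow{p}$ is convergence in probability under $P$. *)

theory Defs
  imports "HOL-Probability.Probability"
begin

text \<open>
  A process is a family \<open>X :: int \<Rightarrow> 'w \<Rightarrow> 's\<close> of \<open>S\<close>-valued random variables on \<open>P\<close>.
  Sub-\<open>\<sigma>\<close>-algebras are represented by measures of which only \<^const>\<open>space\<close> and \<^const>\<open>sets\<close>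
  matter, as in \<^const>\<open>real_cond_exp\<close>.
\<close>

definition process_algebra ::
  "'w measure \<Rightarrow> 's measure \<Rightarrow> (int \<Rightarrow> 'w \<Rightarrow> 's) \<Rightarrow> int set \<Rightarrow> 'w measure" where
  "process_algebra P S X I =
     sigma (space P) (\<Union>i\<in>I. {X i -` B \<inter> space P | B. B \<in> sets S})"

abbreviation past_algebra ::
  "'w measure \<Rightarrow> 's measure \<Rightarrow> (int \<Rightarrow> 'w \<Rightarrow> 's) \<Rightarrow> int \<Rightarrow> 'w measure" where
  "past_algebra P S X j \<equiv> process_algebra P S X {..j}"

definition path_law ::
  "'w measure \<Rightarrow> 's measure \<Rightarrow> (int \<Rightarrow> 'w \<Rightarrow> 's) \<Rightarrow> (int \<Rightarrow> 's) measure" where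
  "path_law P S X = distr P (PiM UNIV (\<lambda>_. S)) (\<lambda>\<omega> n. X n \<omega>)"

definition stationary_process ::
  "'w measure \<Rightarrow> 's measure \<Rightarrow> (int \<Rightarrow> 'w \<Rightarrow> 's) \<Rightarrow> bool" where
  "stationary_process P S X \<longleftrightarrow> path_law P S (\<lambda>n. X (n + 1)) = path_law P S X"

definition ergodic_process ::
  "'w measure \<Rightarrow> 's measure \<Rightarrow> (int \<Rightarrow> 'w \<Rightarrow> 's) \<Rightarrow> bool" where
  "ergodic_process P S X \<longleftrightarrow>
     (\<forall>A\<in>sets (PiM UNIV (\<lambda>_. S)).
        {x \<in> space (PiM UNIV (\<lambda>_. S)). (\<lambda>n. x (n + 1)) \<in> A} = A \<longrightarrow>
        measure (path_law P S X) A \<in> {0, 1})"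

definition markov_process ::
  "'w measure \<Rightarrow> 's measure \<Rightarrow> (int \<Rightarrow> 'w \<Rightarrow> 's) \<Rightarrow> bool" where
  "markov_process P S X \<longleftrightarrow>
     (\<forall>n. \<forall>B\<in>sets S. AE \<omega> in P.
        real_cond_exp P (past_algebra P S X n) (indicator (X (n + 1) -` B \<inter> space P)) \<omega> =
        real_cond_exp P (vimage_algebra (space P) (X n) S)
          (indicator (X (n + 1) -` B \<inter> space P)) \<omega>)"

text \<open>
  \<open>K\<close> is a regular conditional distribution of the \<open>T\<close>-valued \<open>Z\<close> given the \<open>S\<close>-valued \<open>Y\<close>.
  For \<open>Z\<close> the identity and \<open>T\<close> a sub-\<open>\<sigma>\<close>-algebra of \<open>P\<close> this is a regular conditional
  probability on \<open>T\<close> given \<open>Y\<close>.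
\<close>

definition regular_cond_distr ::
  "'w measure \<Rightarrow> ('w \<Rightarrow> 's) \<Rightarrow> 's measure \<Rightarrow> ('w \<Rightarrow> 't) \<Rightarrow> 't measure \<Rightarrow> ('s \<Rightarrow> 't measure) \<Rightarrow> bool"
  where
  "regular_cond_distr P Y S Z T K \<longleftrightarrow>
     K \<in> S \<rightarrow>\<^sub>M prob_algebra T \<and>
     (\<forall>B\<in>sets T. AE \<omega> in P.
        measure (K (Y \<omega>)) B =
        real_cond_exp P (vimage_algebra (space P) Y S) (indicator (Z -` B \<inter> space P)) \<omega>)"

definition partial_sum ::
  "('s \<Rightarrow> real) \<Rightarrow> (int \<Rightarrow> 'w \<Rightarrow> 's) \<Rightarrow> nat \<Rightarrow> 'w \<Rightarrow> real" where
  "partial_sum g X n \<omega> = (\<Sum>i=1..n. g (X (int i) \<omega>))"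

definition sum_variance ::
  "'w measure \<Rightarrow> ('s \<Rightarrow> real) \<Rightarrow> (int \<Rightarrow> 'w \<Rightarrow> 's) \<Rightarrow> nat \<Rightarrow> real" where
  "sum_variance P g X n = (\<integral>\<omega>. (partial_sum g X n \<omega>)\<^sup>2 \<partial>P)"

abbreviation sum_sd ::
  "'w measure \<Rightarrow> ('s \<Rightarrow> real) \<Rightarrow> (int \<Rightarrow> 'w \<Rightarrow> 's) \<Rightarrow> nat \<Rightarrow> real" where
  "sum_sd P g X n \<equiv> sqrt (sum_variance P g X n)"

definition cond_cdf ::
  "'w measure \<Rightarrow> ('s \<Rightarrow> 'w measure) \<Rightarrow> ('s \<Rightarrow> real) \<Rightarrow> (int \<Rightarrow> 'w \<Rightarrow> 's) \<Rightarrow> nat \<Rightarrow> 's \<Rightarrow> real \<Rightarrow> real"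
  where
  "cond_cdf P Px g X n x z =
     measure (Px x) {\<omega> \<in> space P. partial_sum g X n \<omega> / sum_sd P g X n \<le> z}"

definition levy_dist :: "(real \<Rightarrow> real) \<Rightarrow> (real \<Rightarrow> real) \<Rightarrow> real" where
  "levy_dist F G = Inf {\<epsilon>. \<epsilon> > 0 \<and> (\<forall>x. F (x - \<epsilon>) - \<epsilon> \<le> G x \<and> G x \<le> F (x + \<epsilon>) + \<epsilon>)}"

definition conv_in_prob ::
  "'w measure \<Rightarrow> (nat \<Rightarrow> 'w \<Rightarrow> real) \<Rightarrow> ('w \<Rightarrow> real) \<Rightarrow> bool" where
  "conv_in_prob P Y Z \<longleftrightarrow>
     (\<forall>\<epsilon>>0. (\<lambda>n. measure P {\<omega> \<in> space P. \<bar>Y n \<omega> - Z \<omega>\<bar> \<ge> \<epsilon>}) \<longlonglongrightarrow> 0)"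

text \<open>The differences \<open>d\<close> start at index 1, with \<open>d 1\<close> centred given \<open>F 0\<close>; the value \<open>d 0\<close> is irrelevant.\<close>

definition martingale_differences ::
  "'w measure \<Rightarrow> (int \<Rightarrow> 'w measure) \<Rightarrow> (nat \<Rightarrow> 'w \<Rightarrow> real) \<Rightarrow> bool" where
  "martingale_differences P F d \<longleftrightarrow>
     (\<forall>j\<ge>1. d j \<in> borel_measurable (F (int j)) \<and> integrable P (d j) \<and>
        (AE \<omega> in P. real_cond_exp P (F (int j - 1)) (d j) \<omega> = 0))"

text \<open>
  The \<open>L\<^sup>2\<close> error is an \<^typ>\<open>ennreal\<close>-valued integral: the Bochner integral would be 0 when
  the squared error is not integrable.  If each \<open>partial_sum g X k\<close> is square integrable, the
  condition forces \<open>D n k\<close> to be square integrable for all \<open>n\<close> beyond some index and all \<open>1 \<le> k \<le> n\<close>, so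
  that conditional expectations of \<open>(D n k)\<^sup>2\<close> are then genuine.
\<close>

definition martingale_approximation ::
  "'w measure \<Rightarrow> 's measure \<Rightarrow> (int \<Rightarrow> 'w \<Rightarrow> 's) \<Rightarrow> ('s \<Rightarrow> real) \<Rightarrow> (nat \<Rightarrow> nat \<Rightarrow> 'w \<Rightarrow> real) \<Rightarrow> bool"
  where
  "martingale_approximation P S X g D \<longleftrightarrow>
     (\<forall>n\<ge>1. martingale_differences P (past_algebra P S X) (D n)) \<and>
     (\<lambda>n. (MAX k\<in>{..n}. \<integral>\<^sup>+\<omega>. ennreal ((partial_sum g X k \<omega> - (\<Sum>j=1..k. D n j \<omega>))\<^sup>2) \<partial>P)
            / ennreal (sum_variance P g X n)) \<longlonglongrightarrow> 0"

end

theory Submission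
  imports Defs
begin

text \<open>
  The Levy condition is equivalent to \<open>E \<bar>F\<^sub>n(X\<^sub>0; z) - \<Phi>(z)\<bar> \<longlonglongrightarrow> 0\<close> for every \<open>z\<close>.

  Suppose a martingale approximation is given. If \<open>A\<^sub>k\<close> are the normalised conditional variances
  and \<open>a\<^sub>k = min 1 A\<^sub>k\<close>, then \<open>exp (i t M\<^sub>k + t\<^sup>2 a\<^sub>k / 2)\<close> is almost a martingale, which gives
  \<open>E (h\<^sub>n (exp (i t S\<^sub>n / \<sigma>\<^sub>n) - exp (- t\<^sup>2 / 2))) \<longlonglongrightarrow> 0\<close> for all \<open>X\<^sub>0\<close>-measurable weights \<open>0 \<le> h\<^sub>n \<le> 1\<close>.
  Levy's continuity theorem, applied to the law of \<open>S\<^sub>n / \<sigma>\<^sub>n\<close> under the density proportional to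
  \<open>1 + h\<^sub>n\<close> with \<open>h\<^sub>n\<close> the indicator of \<open>F\<^sub>n(X\<^sub>0; z) > \<Phi>(z)\<close>, bounds the positive part of
  \<open>F\<^sub>n(X\<^sub>0; z) - \<Phi>(z)\<close> in mean, and the complementary indicator bounds the negative part.

  Conversely, cut \<open>{1..n}\<close> into \<open>N\<close> blocks of length \<open>m\<close>, truncate each block sum at \<open>K \<sigma>\<^sub>m\<close>, and
  let \<open>D\<^sub>n\<^sub>k\<close> be the increments of the Doob martingales of the truncated block sums. They are bounded
  by \<open>2 K \<sigma>\<^sub>m\<close>, which is small compared with \<open>\<sigma>\<^sub>n \<approx> sqrt N * \<sigma>\<^sub>m\<close> once \<open>N\<close> is much larger than
  \<open>K\<^sup>2\<close>, so Lindeberg's condition is trivial and the conditional variances differ little in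
  \<open>L\<^sup>2\<close> from the conditional block variances. By conditional normality of the block sums the latter add up
  to about \<open>N \<sigma>\<^sub>m\<^sup>2\<close>, and the error \<open>S\<^sub>k - M\<^sub>n\<^sub>k\<close> is controlled by the truncated second moment of the
  normal law. Let \<open>n\<close>, then \<open>N\<close>, then \<open>K\<close> tend to infinity, and diagonalise.
\<close>

section \<open>Square-integrable martingale differences\<close>

text \<open>Two obstacles shape the proof. In the direct half, convergence in probability does not
  control the expectations in the characteristic function estimate. The L2 approximation supplies
  what is missing: E M_n^2 is the sum of the expected conditional variances and cannot exceed
  \<sigma>_n^2 asymptotically, which upgrades the convergence to L1 by Scheffe's argument. In the
  converse half nothing is known about the growth of \<sigma>_n^2: neither \<sigma>_n^2 close to N
  \<sigma>_m^2 nor monotonicity is given. The first is read off from the construction itself, by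
  comparing S_n with its martingale; the second is replaced by \<open>v l \<le> 5 * v n + C\<close>
  for \<open>l \<le> n\<close>, which follows from negligibility of E(S_l | F_0) in L2. That
  negligibility and the smallness of the tails of S_l^2 / \<sigma>_l^2 come from the exact second
  moment: what clipping removes is at most 1 minus the clipped moment, and the latter converges to
  the normal one. Stationarity and the Markov property make the normality error of a block
  independent of its starting time, so the block estimates hold for all starting times at
  once.\<close>

definition in_L2 :: "'a measure \<Rightarrow> ('a \<Rightarrow> real) \<Rightarrow> bool" where
  "in_L2 M f \<longleftrightarrow> f \<in> borel_measurable M \<and> integrable M (\<lambda>x. (f x)\<^sup>2)"

lemma in_L2_D: assumes "in_L2 M f"
  shows "f \<in> borel_measurable M" "integrable M (\<lambda>x. (f x)\<^sup>2)"
  using assms by (auto simp: in_L2_def)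

lemma in_L2_mult:
  assumes "in_L2 M f" "in_L2 M g" shows "integrable M (\<lambda>x. f x * g x)"
proof (rule Bochner_Integration.integrable_bound)
  show "integrable M (\<lambda>x. (f x)\<^sup>2 + (g x)\<^sup>2)" using assms by (auto simp: in_L2_def)
  show "(\<lambda>x. f x * g x) \<in> borel_measurable M" using assms by (auto simp: in_L2_def)
  have "\<bar>a * b\<bar> \<le> a\<^sup>2 + b\<^sup>2" for a b :: real
  proof -
    have "0 \<le> (\<bar>a\<bar> - \<bar>b\<bar>)\<^sup>2" by simp
    then have "2 * (\<bar>a\<bar> * \<bar>b\<bar>) \<le> a\<^sup>2 + b\<^sup>2" by (simp add: power2_diff)
    moreover have "0 \<le> \<bar>a\<bar> * \<bar>b\<bar>" by simp
    ultimately show ?thesis unfolding abs_mult by linarith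
  qed
  then show "AE x in M. norm (f x * g x) \<le> norm ((f x)\<^sup>2 + (g x)\<^sup>2)" by simp
qed

lemma in_L2_cmult: "in_L2 M f \<Longrightarrow> in_L2 M (\<lambda>x. c * f x)"
  by (auto simp: in_L2_def power_mult_distrib)

lemma in_L2_add:
  assumes "in_L2 M f" "in_L2 M g" shows "in_L2 M (\<lambda>x. f x + g x)"
  using assms in_L2_mult[OF assms] by (auto simp: in_L2_def power2_sum mult.assoc)

lemma in_L2_diff:
  assumes "in_L2 M f" "in_L2 M g" shows "in_L2 M (\<lambda>x. f x - g x)"
  using in_L2_add[OF assms(1) in_L2_cmult[OF assms(2), of "-1"]] by simp

lemma in_L2_sum:
  assumes "\<And>i. i \<in> I \<Longrightarrow> in_L2 M (f i)" shows "in_L2 M (\<lambda>x. \<Sum>i\<in>I. f i x)"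
  using assms
proof (induction I rule: infinite_finite_induct)
  case (insert i I)
  then show ?case using in_L2_add[of M "f i" "\<lambda>x. \<Sum>i\<in>I. f i x"] by simp
qed (auto simp: in_L2_def)

lemma in_L2_cong_AE:
  assumes "in_L2 M f" "g \<in> borel_measurable M" "AE x in M. f x = g x"
  shows "in_L2 M g"
  using assms unfolding in_L2_def
  by (auto intro: integrable_cong_AE_imp[where g = "\<lambda>x. (f x)\<^sup>2"])

lemma in_L2_bound:
  assumes "in_L2 M g" "f \<in> borel_measurable M" "AE x in M. \<bar>f x\<bar> \<le> \<bar>g x\<bar>"
  shows "in_L2 M f"
  unfolding in_L2_def
proof
  show "integrable M (\<lambda>x. (f x)\<^sup>2)"
  proof (rule Bochner_Integration.integrable_bound[OF in_L2_D(2)[OF assms(1)]])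
    show "AE x in M. norm ((f x)\<^sup>2) \<le> norm ((g x)\<^sup>2)"
      using assms(3) by eventually_elim (simp add: abs_le_square_iff)
  qed (use assms in auto)
qed fact

lemma sum_sq_le: "(a + b)\<^sup>2 \<le> 2 * a\<^sup>2 + 2 * b\<^sup>2" for a b :: real
  using zero_le_power2[of "a - b"] by (simp add: power2_sum power2_diff)

lemma expectation_sum_sq_le:
  assumes "in_L2 M f" "in_L2 M g"
  shows "(\<integral>x. (f x + g x)\<^sup>2 \<partial>M) \<le> 2 * (\<integral>x. (f x)\<^sup>2 \<partial>M) + 2 * (\<integral>x. (g x)\<^sup>2 \<partial>M)"
proof -
  have "(\<integral>x. (f x + g x)\<^sup>2 \<partial>M) \<le> (\<integral>x. 2 * (f x)\<^sup>2 + 2 * (g x)\<^sup>2 \<partial>M)"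
    using in_L2_add[OF assms] assms by (intro integral_mono) (auto simp: in_L2_def sum_sq_le)
  also have "\<dots> = 2 * (\<integral>x. (f x)\<^sup>2 \<partial>M) + 2 * (\<integral>x. (g x)\<^sup>2 \<partial>M)"
    using assms by (simp add: in_L2_def)
  finally show ?thesis .
qed

text \<open>A leading constant \<open>1 + \<theta>\<close> instead of 2 allows two second moments to
  be compared with ratio tending to 1. It comes from expanding
  \<open>0 \<le> (\<theta> * a - b)\<^sup>2 / \<theta>\<close>.\<close>

lemma expectation_sum_sq_le':
  assumes "in_L2 M f" "in_L2 M g" "\<theta> > 0"
  shows "(\<integral>x. (f x + g x)\<^sup>2 \<partial>M) \<le> (1 + \<theta>) * (\<integral>x. (f x)\<^sup>2 \<partial>M) + (1 + 1 / \<theta>) * (\<integral>x. (g x)\<^sup>2 \<partial>M)"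
proof -
  have *: "(a + b)\<^sup>2 \<le> (1 + \<theta>) * a\<^sup>2 + (1 + 1/\<theta>) * b\<^sup>2" for a b :: real
  proof -
    have "0 \<le> (\<theta> * a - b)\<^sup>2 / \<theta>" using assms by simp
    also have "\<dots> = \<theta> * a\<^sup>2 - 2 * a * b + b\<^sup>2 / \<theta>"
      using assms(3) by (simp add: power2_diff field_simps power2_eq_square)
    finally show ?thesis by (simp add: power2_sum algebra_simps)
  qed
  have "(\<integral>x. (f x + g x)\<^sup>2 \<partial>M) \<le> (\<integral>x. (1 + \<theta>) * (f x)\<^sup>2 + (1 + 1/\<theta>) * (g x)\<^sup>2 \<partial>M)"
    using in_L2_add[OF assms(1,2)] assms by (intro integral_mono) (auto simp: in_L2_def *)
  also have "\<dots> = (1 + \<theta>) * (\<integral>x. (f x)\<^sup>2 \<partial>M) + (1 + 1/\<theta>) * (\<integral>x. (g x)\<^sup>2 \<partial>M)"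
    using assms by (simp add: in_L2_def)
  finally show ?thesis .
qed

text \<open>Cauchy-Schwarz against the constant 1. The factor \<open>card I\<close> is the price for
  summands without orthogonality, such as the conditional means of blocks.\<close>

lemma expectation_sum_sq_le_card:
  assumes "finite I" "\<And>i. i \<in> I \<Longrightarrow> in_L2 M (f i)"
  shows "(\<integral>x. (\<Sum>i\<in>I. f i x)\<^sup>2 \<partial>M) \<le> card I * (\<Sum>i\<in>I. \<integral>x. (f i x)\<^sup>2 \<partial>M)"
proof -
  have "(\<Sum>i\<in>I. f i x)\<^sup>2 \<le> real (card I) * (\<Sum>i\<in>I. (f i x)\<^sup>2)" for x
    using Cauchy_Schwarz_ineq_sum[of "\<lambda>_. 1" "\<lambda>i. f i x" I] by simp
  then have "(\<integral>x. (\<Sum>i\<in>I. f i x)\<^sup>2 \<partial>M) \<le> (\<integral>x. real (card I) * (\<Sum>i\<in>I. (f i x)\<^sup>2) \<partial>M)"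
    using assms in_L2_sum[of I M f] by (intro integral_mono) (auto simp: in_L2_def)
  also have "\<dots> = card I * (\<Sum>i\<in>I. \<integral>x. (f i x)\<^sup>2 \<partial>M)"
    using assms by (simp add: in_L2_def)
  finally show ?thesis .
qed

context prob_space begin

lemma in_L2_bounded:
  assumes "f \<in> borel_measurable M" "AE x in M. \<bar>f x\<bar> \<le> c" shows "in_L2 M f"
  unfolding in_L2_def
proof
  show "integrable M (\<lambda>x. (f x)\<^sup>2)"
  proof (rule integrable_const_bound[where B = "c\<^sup>2"])
    show "AE x in M. norm ((f x)\<^sup>2) \<le> c\<^sup>2"
      using assms(2) by eventually_elim (simp add: abs_le_square_iff[symmetric])
  qed (use assms in auto)
qed fact

lemma in_L2_const: "in_L2 M (\<lambda>_. c)" by (simp add: in_L2_def)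

lemma in_L2_integrable: assumes "in_L2 M f" shows "integrable M f"
  using in_L2_mult[OF assms in_L2_const[of 1]] by simp

lemma expectation_abs_le_sqrt:
  assumes "in_L2 M f" shows "(expectation (\<lambda>x. \<bar>f x\<bar>))\<^sup>2 \<le> expectation (\<lambda>x. (f x)\<^sup>2)"
proof -
  have "0 \<le> variance (\<lambda>x. \<bar>f x\<bar>)" by simp
  also have "\<dots> = expectation (\<lambda>x. \<bar>f x\<bar>\<^sup>2) - (expectation (\<lambda>x. \<bar>f x\<bar>))\<^sup>2"
    using assms in_L2_integrable[OF assms] by (intro variance_eq) (auto simp: in_L2_def)
  finally show ?thesis by simp
qed

lemma expectation_abs_le:
  assumes "in_L2 M f" "expectation (\<lambda>x. (f x)\<^sup>2) \<le> c\<^sup>2" "c \<ge> 0"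
  shows "expectation (\<lambda>x. \<bar>f x\<bar>) \<le> c"
  using expectation_abs_le_sqrt[OF assms(1)] assms(2,3) by (meson order_trans power2_le_imp_le)

end

text \<open>Time starts at 0, and the whole past up to time 0 is lumped into \<open>F 0\<close>.
  Throughout, a martingale difference with index \<open>k\<close> is measurable for
  \<open>F (Suc k)\<close> and centred given \<open>F k\<close>.\<close>

locale filtered_prob_space = prob_space +
  fixes F :: "nat \<Rightarrow> 'a measure"
  assumes F_subalgebra: "\<And>k. subalgebra M (F k)"
    and F_mono: "\<And>i j. i \<le> j \<Longrightarrow> sets (F i) \<subseteq> sets (F j)"
begin

abbreviation CE :: "nat \<Rightarrow> ('a \<Rightarrow> real) \<Rightarrow> 'a \<Rightarrow> real" where
  "CE k f \<equiv> real_cond_exp M (F k) f"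

lemma finite_subalgebra_F: "finite_measure_subalgebra M (F k)"
  using F_subalgebra[of k] by (simp add: finite_measure_subalgebra_def finite_measure_subalgebra_axioms_def finite_measure_axioms)

sublocale F: finite_measure_subalgebra M "F k" for k
  by (rule finite_subalgebra_F)

lemma space_F: "space (F k) = space M" using F_subalgebra[of k] by (simp add: subalgebra_def)

lemma subalgebra_F_F: "i \<le> j \<Longrightarrow> subalgebra (F j) (F i)"
  using F_mono by (auto simp: subalgebra_def space_F)

lemma measurable_F: "f \<in> measurable (F k) N \<Longrightarrow> f \<in> measurable M N"
  using measurable_from_subalg[OF F_subalgebra] by blast

lemma measurable_F_mono: "f \<in> measurable (F i) N \<Longrightarrow> i \<le> j \<Longrightarrow> f \<in> measurable (F j) N"
  using measurable_from_subalg[OF subalgebra_F_F] by blast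

lemma CE_measurable: "i \<le> j \<Longrightarrow> CE i f \<in> borel_measurable (F j)"
  by (rule measurable_F_mono[OF borel_measurable_cond_exp])

lemma CE_L2:
  assumes "in_L2 M f" shows "in_L2 M (CE k f)"
  unfolding in_L2_def
  using F.integrable_convex_cond_exp[OF in_L2_integrable[OF assms], where I=UNIV and q="\<lambda>x. x\<^sup>2"] assms
  by (auto simp: in_L2_def convex_power2)

lemma CE_L2_le:
  assumes "in_L2 M f" shows "expectation (\<lambda>x. (CE k f x)\<^sup>2) \<le> expectation (\<lambda>x. (f x)\<^sup>2)"
proof -
  have "AE x in M. (CE k f x)\<^sup>2 \<le> CE k (\<lambda>x. (f x)\<^sup>2) x"
    using F.real_cond_exp_jensens_inequality(2)[OF in_L2_integrable[OF assms], where I=UNIV and q="\<lambda>x. x\<^sup>2"] assms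
    by (auto simp: in_L2_def convex_power2)
  then have "expectation (\<lambda>x. (CE k f x)\<^sup>2) \<le> expectation (CE k (\<lambda>x. (f x)\<^sup>2))"
    using CE_L2[OF assms, of k] assms by (intro integral_mono_AE) (auto simp: in_L2_def intro: F.real_cond_exp_int)
  also have "\<dots> = expectation (\<lambda>x. (f x)\<^sup>2)" using assms by (simp add: F.real_cond_exp_int in_L2_def)
  finally show ?thesis .
qed

lemma CE_mult_expectation:
  assumes "in_L2 M f" "in_L2 M g" "f \<in> borel_measurable (F k)"
  shows "expectation (\<lambda>x. f x * CE k g x) = expectation (\<lambda>x. f x * g x)"
  by (rule F.real_cond_exp_intg(2)) (use assms in \<open>auto intro: in_L2_mult simp: in_L2_def\<close>)

text \<open>Pythagoras: \<open>CE k\<close> is the orthogonal projection onto the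
  \<open>F k\<close>-measurable functions, so \<open>f\<close> splits into the orthogonal parts
  \<open>CE k f\<close> and \<open>f - CE k f\<close>.\<close>

lemma CE_residual_L2:
  assumes "in_L2 M f"
  shows "expectation (\<lambda>x. (f x - CE k f x)\<^sup>2) = expectation (\<lambda>x. (f x)\<^sup>2) - expectation (\<lambda>x. (CE k f x)\<^sup>2)"
proof -
  note c = CE_L2[OF assms, of k]
  have "expectation (\<lambda>x. (f x - CE k f x)\<^sup>2) = expectation (\<lambda>x. (f x)\<^sup>2 - 2 * (CE k f x * f x) + (CE k f x)\<^sup>2)"
    by (intro Bochner_Integration.integral_cong) (auto simp: power2_diff)
  also have "\<dots> = expectation (\<lambda>x. (f x)\<^sup>2) - 2 * expectation (\<lambda>x. CE k f x * f x) + expectation (\<lambda>x. (CE k f x)\<^sup>2)"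
    using assms c in_L2_mult[OF c assms] by (simp add: in_L2_def)
  also have "expectation (\<lambda>x. CE k f x * f x) = expectation (\<lambda>x. CE k f x * CE k f x)"
    by (rule CE_mult_expectation[symmetric]) (use c assms in auto)
  finally show ?thesis by (simp add: power2_eq_square)
qed

lemma CE_residual_L2_le:
  assumes "in_L2 M f"
  shows "expectation (\<lambda>x. (f x - CE k f x)\<^sup>2) \<le> expectation (\<lambda>x. (f x)\<^sup>2)"
proof -
  have "0 \<le> expectation (\<lambda>x. (CE k f x)\<^sup>2)" by simp
  then show ?thesis using CE_residual_L2[OF assms, of k] by linarith
qed

lemma CE_residual_zero:
  assumes "integrable M f" "i \<le> j"
  shows "AE x in M. CE i (\<lambda>x. f x - CE j f x) x = 0"
proof -
  have "AE x in M. CE i (\<lambda>x. f x - CE j f x) x = CE i f x - CE i (CE j f) x"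
    by (rule F.real_cond_exp_diff) (use assms F.real_cond_exp_int in auto)
  moreover have "AE x in M. CE i (CE j f) x = CE i f x"
    by (rule F.real_cond_exp_nested_subalg[OF F_subalgebra subalgebra_F_F]) (use assms in auto)
  ultimately show ?thesis by eventually_elim simp
qed

lemma CE_increment_zero:
  assumes "integrable M f" "i \<le> j"
  shows "AE x in M. CE i (\<lambda>x. CE j f x - CE i f x) x = 0"
proof -
  have "AE x in M. CE i (\<lambda>x. CE j f x - CE i f x) x = CE i (CE j f) x - CE i (CE i f) x"
    by (rule F.real_cond_exp_diff) (use assms F.real_cond_exp_int in auto)
  moreover have "AE x in M. CE i (CE j f) x = CE i f x"
    by (rule F.real_cond_exp_nested_subalg[OF F_subalgebra subalgebra_F_F]) (use assms in auto)
  moreover have "AE x in M. CE i (CE i f) x = CE i f x"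
    by (rule F.real_cond_exp_F_meas) (use assms F.real_cond_exp_int in auto)
  ultimately show ?thesis by eventually_elim simp
qed

lemma orthogonal_zero:
  assumes "in_L2 M f" "in_L2 M g" "f \<in> borel_measurable (F k)" "AE x in M. CE k g x = 0"
  shows "expectation (\<lambda>x. f x * g x) = 0"
proof -
  have "expectation (\<lambda>x. f x * g x) = expectation (\<lambda>x. f x * CE k g x)"
    by (rule CE_mult_expectation[symmetric]) (use assms in auto)
  also have "\<dots> = expectation (\<lambda>x. 0)"
  proof (rule integral_cong_AE)
    show "AE x in M. f x * CE k g x = 0" using assms(4) by eventually_elim simp
  qed (use assms(1) CE_L2[OF assms(2)] in \<open>auto simp: in_L2_def\<close>)
  finally show ?thesis by simp
qed

text \<open>Every cross term pairs a partial sum known at time \<open>j\<close> with a difference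
  centred given \<open>F j\<close>. The lemma is also applied to the coarser filtration at block
  ends and to filtrations that start at a block boundary.\<close>

lemma orthogonal_sum:
  assumes "\<And>j. j < N \<Longrightarrow> in_L2 M (z j)" "\<And>j. j < N \<Longrightarrow> z j \<in> borel_measurable (F (Suc j))"
    "\<And>j. j < N \<Longrightarrow> AE x in M. CE j (z j) x = 0"
  shows "expectation (\<lambda>x. (\<Sum>j<N. z j x)\<^sup>2) = (\<Sum>j<N. expectation (\<lambda>x. (z j x)\<^sup>2))"
  using assms
proof (induction N)
  case (Suc N)
  let ?S = "\<lambda>x. \<Sum>j<N. z j x"
  have S: "in_L2 M ?S" by (rule in_L2_sum) (use Suc in auto)
  have SF: "?S \<in> borel_measurable (F N)"
    by (intro borel_measurable_sum measurable_F_mono[OF Suc.prems(2)]) auto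
  have z: "in_L2 M (z N)" using Suc by auto
  have "expectation (\<lambda>x. (\<Sum>j<Suc N. z j x)\<^sup>2) = expectation (\<lambda>x. (?S x)\<^sup>2 + (z N x)\<^sup>2 + 2 * (?S x * z N x))"
    by (intro Bochner_Integration.integral_cong) (auto simp: power2_sum)
  also have "\<dots> = expectation (\<lambda>x. (?S x)\<^sup>2) + expectation (\<lambda>x. (z N x)\<^sup>2) + 2 * expectation (\<lambda>x. ?S x * z N x)"
    using S z in_L2_mult[OF S z] by (simp add: in_L2_def)
  also have "expectation (\<lambda>x. ?S x * z N x) = 0"
    by (rule orthogonal_zero[OF S z SF]) (use Suc in auto)
  finally show ?case using Suc by simp
qed auto

end

section \<open>A weighted martingale central limit theorem\<close>

lemma bounded_mult_integrable:
  fixes H X :: "'a \<Rightarrow> complex"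
  assumes "H \<in> borel_measurable M" "\<And>x. cmod (H x) \<le> c" "integrable M X"
  shows "integrable M (\<lambda>x. H x * X x)"
    and "cmod (\<integral>x. H x * X x \<partial>M) \<le> c * (\<integral>x. cmod (X x) \<partial>M)"
proof -
  have c: "c \<ge> 0" using assms(2) norm_ge_zero order_trans by blast
  have le: "cmod (H x * X x) \<le> c * cmod (X x)" for x
    by (simp add: norm_mult mult_right_mono assms)
  show i: "integrable M (\<lambda>x. H x * X x)"
  proof (rule Bochner_Integration.integrable_bound)
    show "integrable M (\<lambda>x. c * cmod (X x))" using assms by simp
    show "AE x in M. norm (H x * X x) \<le> norm (c * cmod (X x))" using le c by simp
  qed (use assms in auto)
  have "cmod (\<integral>x. H x * X x \<partial>M) \<le> (\<integral>x. cmod (H x * X x) \<partial>M)"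
    by (rule integral_norm_bound)
  also have "\<dots> \<le> (\<integral>x. c * cmod (X x) \<partial>M)"
    using le assms i by (intro integral_mono) auto
  finally show "cmod (\<integral>x. H x * X x \<partial>M) \<le> c * (\<integral>x. cmod (X x) \<partial>M)" by simp
qed

lemma exp_minus_quadratic_bound:
  fixes u :: real assumes "u \<ge> 0" shows "\<bar>exp (-u) - 1 + u\<bar> \<le> u\<^sup>2"
proof -
  have "1 - u \<le> exp (-u)" using exp_ge_add_one_self[of "-u"] by simp
  moreover have "exp (-u) \<le> 1 - u + u\<^sup>2"
  proof -
    \<comment> \<open>The product equals \<open>1 + u^3\<close>; replacing \<open>1 + u\<close> by
      the larger \<open>exp u\<close> and dividing gives the upper bound for
      \<open>exp (-u)\<close>.\<close>
    have "1 \<le> (1 - u + u\<^sup>2) * (1 + u)" using assms by (simp add: algebra_simps power2_eq_square)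
    also have "\<dots> \<le> (1 - u + u\<^sup>2) * exp u"
    proof (rule mult_left_mono)
      have "0 \<le> (u - 1/2)\<^sup>2" by simp
      then show "0 \<le> 1 - u + u\<^sup>2" by (simp add: power2_eq_square algebra_simps)
    qed (simp add: exp_ge_add_one_self)
    finally show ?thesis by (simp add: exp_minus field_simps)
  qed
  ultimately show ?thesis by simp
qed

text \<open>Lindeberg's split. Where \<open>d\<close> is large the second-order Taylor remainder is
  bounded by a square; where it is small the remainder is a cube, and one factor
  \<open>\<bar>d\<bar>\<close> is traded for \<epsilon>.\<close>

lemma iexp_quadratic_bound:
  fixes t d \<epsilon> :: real assumes "\<epsilon> > 0"
  shows "cmod (iexp (t * d) - 1 - \<i> * of_real (t * d) + of_real (t\<^sup>2 * d\<^sup>2 / 2))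
    \<le> t\<^sup>2 * (d\<^sup>2 * indicator {y. \<epsilon> \<le> \<bar>y\<bar>} d) + \<bar>t\<bar>^3 * \<epsilon> * d\<^sup>2"
proof -
  have s: "(\<Sum>k\<le>2. (\<i> * complex_of_real (t*d))^k / fact k) = 1 + \<i> * of_real (t * d) - of_real (t\<^sup>2 * d\<^sup>2 / 2)"
    by (simp add: numeral_2_eq_2 power_mult_distrib power2_eq_square)
  have e: "iexp (t * d) - 1 - \<i> * of_real (t * d) + of_real (t\<^sup>2 * d\<^sup>2 / 2) =
      iexp (t*d) - (\<Sum>k\<le>2. (\<i> * complex_of_real (t*d))^k / fact k)"
    unfolding s by simp
  show ?thesis
  proof (cases "\<epsilon> \<le> \<bar>d\<bar>")
    case True
    have "cmod (iexp (t * d) - (\<Sum>k\<le>2. (\<i> * complex_of_real (t*d))^k / fact k)) \<le> 2 * \<bar>t * d\<bar>^2 / fact 2"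
      by (rule iexp_approx2)
    also have "\<dots> = t\<^sup>2 * d\<^sup>2" by (simp add: power_mult_distrib)
    also have "\<dots> \<le> t\<^sup>2 * d\<^sup>2 + \<bar>t\<bar>^3 * \<epsilon> * d\<^sup>2" using assms by simp
    finally show ?thesis unfolding e using True by simp
  next
    case False
    have "cmod (iexp (t * d) - (\<Sum>k\<le>2. (\<i> * complex_of_real (t*d))^k / fact k)) \<le> \<bar>t * d\<bar>^Suc 2 / fact (Suc 2)"
      by (rule iexp_approx1)
    also have "\<dots> = \<bar>t * d\<bar>^3 / 6" by (simp add: numeral_2_eq_2 numeral_3_eq_3)
    also have "\<dots> \<le> \<bar>t * d\<bar>^3" using zero_le_power[of "\<bar>t * d\<bar>" 3] by linarith
    also have "\<dots> = \<bar>t\<bar>^3 * \<bar>d\<bar>^3" by (simp add: abs_mult power_mult_distrib)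
    also have "\<bar>d\<bar>^3 = \<bar>d\<bar> * d\<^sup>2" by (simp add: power3_eq_cube power2_eq_square)
    also have "\<bar>t\<bar>^3 * (\<bar>d\<bar> * d\<^sup>2) \<le> \<bar>t\<bar>^3 * (\<epsilon> * d\<^sup>2)"
      using False by (intro mult_left_mono mult_right_mono) auto
    finally show ?thesis unfolding e using False by (simp add: mult.assoc)
  qed
qed

context filtered_prob_space begin

text \<open>Real and imaginary part of \<open>H\<close> are treated separately, so that the real
  conditional expectation can be pulled out of each.\<close>

lemma complex_orthogonal_zero:
  fixes H :: "'a \<Rightarrow> complex"
  assumes "H \<in> borel_measurable (F k)" "\<And>x. cmod (H x) \<le> c" "integrable M g" "AE x in M. CE k g x = 0"
  shows "(\<integral>x. H x * of_real (g x) \<partial>M) = 0"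
proof -
  have HM: "H \<in> borel_measurable M" using measurable_F[OF assms(1)] .
  have i: "integrable M (\<lambda>x. H x * of_real (g x))"
    by (rule bounded_mult_integrable(1)[OF HM assms(2)]) (use assms in auto)
  have z: "(\<integral>x. p x * g x \<partial>M) = 0"
    if p: "p \<in> borel_measurable (F k)" "integrable M (\<lambda>x. p x * g x)" for p :: "'a \<Rightarrow> real"
  proof -
    have "(\<integral>x. p x * g x \<partial>M) = (\<integral>x. p x * CE k g x \<partial>M)"
      by (rule F.real_cond_exp_intg(2)[symmetric]) (use assms p in auto)
    also have "\<dots> = (\<integral>x. 0 \<partial>M)"
    proof (rule integral_cong_AE)
      show "AE x in M. p x * CE k g x = 0" using assms(4) by eventually_elim simp
    qed (use measurable_F[OF p(1)] in auto)
    finally show ?thesis by simp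
  qed
  have "(\<integral>x. Re (H x) * g x \<partial>M) = 0"
    using integrable_Re[OF i] assms(1) by (intro z) (auto intro: borel_measurable_Re)
  moreover have "(\<integral>x. Im (H x) * g x \<partial>M) = 0"
    using integrable_Im[OF i] assms(1) by (intro z) auto
  ultimately show ?thesis
    using integral_Re[OF i] integral_Im[OF i] by (intro complex_eqI) auto
qed

text \<open>\<open>exp (i t d)\<close> is expanded to second order and
  \<open>exp (- t^2 v / 2)\<close> to first order. The terms \<open>d\<close> and
  \<open>d^2 - V\<close> integrate to 0 against the \<open>F k\<close>-measurable \<open>H\<close>;
  what is left are the two Taylor remainders and the loss \<open>V - v\<close> from capping the
  conditional variance. The factor \<open>t\<^sup>2 + t^4\<close> on the Lindeberg term collects one
  contribution from each remainder.\<close>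

lemma martingale_clt_step:
  fixes H :: "'a \<Rightarrow> complex" and d V v :: "'a \<Rightarrow> real"
  assumes d: "in_L2 M d" "AE x in M. CE k d x = 0"
    and V: "V \<in> borel_measurable (F k)" "AE x in M. CE k (\<lambda>x. (d x)\<^sup>2) x = V x"
    and v: "v \<in> borel_measurable (F k)" "\<And>x. 0 \<le> v x" "\<And>x. v x \<le> V x" "\<And>x. v x \<le> 1"
    and H: "H \<in> borel_measurable (F k)" "\<And>x. cmod (H x) \<le> c"
    and \<epsilon>: "\<epsilon> > 0"
  shows "cmod (\<integral>x. H x * (iexp (t * d x) - of_real (exp (- (t\<^sup>2 * v x / 2)))) \<partial>M) \<le>
    c * ((t\<^sup>2 + t^4) * expectation (\<lambda>x. (d x)\<^sup>2 * indicator {y. \<epsilon> \<le> \<bar>y\<bar>} (d x))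
       + \<bar>t\<bar>^3 * \<epsilon> * expectation (\<lambda>x. (d x)\<^sup>2) + t\<^sup>2 * expectation (\<lambda>x. V x - v x) + t^4 * \<epsilon>\<^sup>2 * expectation v)"
proof -
  have [measurable]: "d \<in> borel_measurable M" "V \<in> borel_measurable M" "v \<in> borel_measurable M" "H \<in> borel_measurable M"
    using d V v H by (auto simp: in_L2_def intro: measurable_F)
  have c0: "c \<ge> 0" using H(2) norm_ge_zero order_trans by blast
  have d2: "integrable M (\<lambda>x. (d x)\<^sup>2)" using d by (simp add: in_L2_def)
  have Vi: "integrable M V"
    by (rule integrable_cong_AE_imp[OF F.real_cond_exp_int(1)[OF d2, of k]]) (use V in auto)
  have vi: "integrable M v"
    by (rule Bochner_Integration.integrable_bound[OF Vi]) (use v order_trans[OF v(3) abs_ge_self] in auto)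
  have di: "integrable M d" by (rule in_L2_integrable[OF d(1)])
  define l where "l x = (d x)\<^sup>2 * indicator {y. \<epsilon> \<le> \<bar>y\<bar>} (d x)" for x
  have [measurable]: "l \<in> borel_measurable M" unfolding l_def by measurable
  have li: "integrable M l"
    by (rule Bochner_Integration.integrable_bound[OF d2]) (auto simp: l_def indicator_def)
  define X1 where "X1 x = iexp (t * d x) - 1 - \<i> * of_real (t * d x) + of_real (t\<^sup>2 * (d x)\<^sup>2 / 2)" for x
  define X4 where "X4 x = exp (- (t\<^sup>2 * v x / 2)) - 1 + t\<^sup>2 * v x / 2" for x
  have [measurable]: "X1 \<in> borel_measurable M" "X4 \<in> borel_measurable M" unfolding X1_def X4_def by measurable
  have X1b: "cmod (X1 x) \<le> t\<^sup>2 * l x + \<bar>t\<bar>^3 * \<epsilon> * (d x)\<^sup>2" for x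
    unfolding X1_def l_def by (rule iexp_quadratic_bound[OF \<epsilon>])
  have X1i: "integrable M X1"
  proof (rule Bochner_Integration.integrable_bound)
    show "integrable M (\<lambda>x. t\<^sup>2 * l x + \<bar>t\<bar>^3 * \<epsilon> * (d x)\<^sup>2)" using li d2 by simp
    show "AE x in M. norm (X1 x) \<le> norm (t\<^sup>2 * l x + \<bar>t\<bar>^3 * \<epsilon> * (d x)\<^sup>2)"
      using order_trans[OF X1b abs_ge_self] by simp
  qed auto
  have X4b: "\<bar>X4 x\<bar> \<le> t^4 * (v x)\<^sup>2" for x
  proof -
    have "\<bar>X4 x\<bar> \<le> (t\<^sup>2 * v x / 2)\<^sup>2"
      unfolding X4_def by (rule exp_minus_quadratic_bound) (use v in auto)
    also have "\<dots> = t^4 * (v x)\<^sup>2 / 4" by (simp add: power_mult_distrib power_divide)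
    finally show ?thesis using zero_le_mult_iff[of "t^4" "(v x)\<^sup>2"] by simp
  qed
  have v2le: "(v x)\<^sup>2 \<le> v x" for x
    using v(2,4)[of x] by (simp add: power2_eq_square mult_left_le)
  have v2i: "integrable M (\<lambda>x. (v x)\<^sup>2)"
    by (rule Bochner_Integration.integrable_bound[OF vi]) (use v2le v in auto)
  have X4i: "integrable M X4"
  proof (rule Bochner_Integration.integrable_bound)
    show "integrable M (\<lambda>x. t^4 * (v x)\<^sup>2)" using v2i by simp
  qed (use X4b in auto)
  have vV: "integrable M (\<lambda>x. v x * V x)" 
    by (rule Bochner_Integration.integrable_bound[OF Vi]) (use v in \<open>auto simp: abs_mult mult_left_le_one_le\<close>)
  have vd: "integrable M (\<lambda>x. v x * (d x)\<^sup>2)"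
    by (rule Bochner_Integration.integrable_bound[OF d2]) (use v in \<open>auto simp: abs_mult mult_left_le_one_le\<close>)
  \<comment> \<open>As \<open>v \<le> V\<close> and \<open>v\<close> is
    \<open>F k\<close>-measurable, the mean of \<open>v^2\<close> is at most that of
    \<open>v * d^2\<close>. Splitting at \<epsilon> makes this small without any uniform bound on
    \<open>V\<close>.\<close>
  have v2b: "expectation (\<lambda>x. (v x)\<^sup>2) \<le> \<epsilon>\<^sup>2 * expectation v + expectation l"
  proof -
    have "expectation (\<lambda>x. (v x)\<^sup>2) \<le> expectation (\<lambda>x. v x * V x)"
      using v2i vV v by (intro integral_mono) (auto simp: power2_eq_square mult_left_mono)
    also have "\<dots> = expectation (\<lambda>x. v x * CE k (\<lambda>x. (d x)\<^sup>2) x)"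
      by (rule integral_cong_AE) (use V in auto)
    also have "\<dots> = expectation (\<lambda>x. v x * (d x)\<^sup>2)"
      by (rule F.real_cond_exp_intg(2)) (use vd v in auto)
    also have "\<dots> \<le> expectation (\<lambda>x. \<epsilon>\<^sup>2 * v x + l x)"
    proof (intro integral_mono vd)
      show "integrable M (\<lambda>x. \<epsilon>\<^sup>2 * v x + l x)" using vi li by simp
      fix x
      show "v x * (d x)\<^sup>2 \<le> \<epsilon>\<^sup>2 * v x + l x"
      proof (cases "\<epsilon> \<le> \<bar>d x\<bar>")
        case True
        have "v x * (d x)\<^sup>2 \<le> (d x)\<^sup>2" using v by (simp add: mult_left_le_one_le)
        then show ?thesis using True v(2)[of x] by (simp add: l_def add_increasing)
      next
        case False
        then have "(d x)\<^sup>2 \<le> \<epsilon>\<^sup>2" using \<epsilon> by (simp add: abs_le_square_iff[symmetric])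
        then have "v x * (d x)\<^sup>2 \<le> v x * \<epsilon>\<^sup>2" using v by (simp add: mult_left_mono)
        then show ?thesis using False by (simp add: l_def mult.commute)
      qed
    qed
    also have "\<dots> = \<epsilon>\<^sup>2 * expectation v + expectation l" using vi li by simp
    finally show ?thesis .
  qed
  have HX: "integrable M (\<lambda>x. H x * of_real (g x))" if "integrable M g" for g
    by (rule bounded_mult_integrable(1)[OF _ H(2)]) (use that in auto)
  \<comment> \<open>An exact identity: the terms \<open>t^2 d^2 / 2\<close>,
    \<open>t^2 V / 2\<close> and \<open>t^2 v / 2\<close> inserted on the right cancel, so that each
    summand can be estimated on its own.\<close>
  have eq: "H x * (iexp (t * d x) - of_real (exp (- (t\<^sup>2 * v x / 2)))) =
     H x * X1 x + (\<i> * t) * (H x * of_real (d x)) - of_real (t\<^sup>2/2) * (H x * of_real ((d x)\<^sup>2 - V x))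
     - of_real (t\<^sup>2/2) * (H x * of_real (V x - v x)) - H x * of_real (X4 x)" for x
    by (simp add: X1_def X4_def algebra_simps)
  have z1: "(\<integral>x. H x * of_real (d x) \<partial>M) = 0"
    by (rule complex_orthogonal_zero[OF H di d(2)])
  have z2: "(\<integral>x. H x * of_real ((d x)\<^sup>2 - V x) \<partial>M) = 0"
  proof (rule complex_orthogonal_zero[OF H])
    have "AE x in M. CE k (\<lambda>x. (d x)\<^sup>2 - V x) x = CE k (\<lambda>x. (d x)\<^sup>2) x - CE k V x"
      by (rule F.real_cond_exp_diff[OF d2 Vi])
    moreover have "AE x in M. CE k V x = V x" by (rule F.real_cond_exp_F_meas[OF Vi V(1)])
    ultimately show "AE x in M. CE k (\<lambda>x. (d x)\<^sup>2 - V x) x = 0"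
      using V(2) by eventually_elim simp
  qed (use d2 Vi in auto)
  have "(\<integral>x. H x * (iexp (t * d x) - of_real (exp (- (t\<^sup>2 * v x / 2)))) \<partial>M) =
    (\<integral>x. H x * X1 x \<partial>M) - of_real (t\<^sup>2/2) * (\<integral>x. H x * of_real (V x - v x) \<partial>M) - (\<integral>x. H x * of_real (X4 x) \<partial>M)"
    unfolding eq
    using bounded_mult_integrable(1)[OF _ H(2) X1i] HX[OF X4i] HX[OF di]
      HX[OF Bochner_Integration.integrable_diff[OF d2 Vi]] HX[OF Bochner_Integration.integrable_diff[OF Vi vi]]
    by (simp del: of_real_diff of_real_divide of_real_power add: z1 z2)
  also have "cmod \<dots> \<le> cmod (\<integral>x. H x * X1 x \<partial>M) + cmod (of_real (t\<^sup>2/2) * (\<integral>x. H x * of_real (V x - v x) \<partial>M))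
      + cmod (\<integral>x. H x * of_real (X4 x) \<partial>M)"
    by (rule order_trans[OF norm_triangle_ineq4 add_right_mono[OF norm_triangle_ineq4]])
  also have "\<dots> \<le> c * (t\<^sup>2 * expectation l + \<bar>t\<bar>^3 * \<epsilon> * expectation (\<lambda>x. (d x)\<^sup>2))
      + t\<^sup>2 * (c * expectation (\<lambda>x. V x - v x)) + c * (t^4 * (\<epsilon>\<^sup>2 * expectation v + expectation l))"
  proof (intro add_mono)
    have "cmod (\<integral>x. H x * X1 x \<partial>M) \<le> c * expectation (\<lambda>x. cmod (X1 x))"
      by (rule bounded_mult_integrable(2)[OF _ H(2) X1i]) auto
    also have "\<dots> \<le> c * expectation (\<lambda>x. t\<^sup>2 * l x + \<bar>t\<bar>^3 * \<epsilon> * (d x)\<^sup>2)"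
      using X1i li d2 X1b c0 by (intro mult_left_mono integral_mono) auto
    finally show "cmod (\<integral>x. H x * X1 x \<partial>M) \<le> c * (t\<^sup>2 * expectation l + \<bar>t\<bar>^3 * \<epsilon> * expectation (\<lambda>x. (d x)\<^sup>2))"
      using li d2 by simp
    have "cmod (\<integral>x. H x * of_real (V x - v x) \<partial>M) \<le> c * expectation (\<lambda>x. cmod (of_real (V x - v x)))"
      by (rule bounded_mult_integrable(2)[OF _ H(2)]) (use Vi vi in auto)
    also have "(\<lambda>x. cmod (of_real (V x - v x))) = (\<lambda>x. V x - v x)" using v(3) by (auto simp flip: of_real_diff)
    finally have "cmod (\<integral>x. H x * of_real (V x - v x) \<partial>M) \<le> c * expectation (\<lambda>x. V x - v x)" .
    moreover have "cmod (of_real (t\<^sup>2/2)) \<le> t\<^sup>2" by (simp add: norm_divide norm_power)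
    ultimately show "cmod (of_real (t\<^sup>2/2) * (\<integral>x. H x * of_real (V x - v x) \<partial>M)) \<le> t\<^sup>2 * (c * expectation (\<lambda>x. V x - v x))"
      unfolding norm_mult by (intro mult_mono) auto
    have "cmod (\<integral>x. H x * of_real (X4 x) \<partial>M) \<le> c * expectation (\<lambda>x. cmod (of_real (X4 x)))"
      by (rule bounded_mult_integrable(2)[OF _ H(2)]) (use X4i in auto)
    also have "\<dots> \<le> c * expectation (\<lambda>x. t^4 * (v x)\<^sup>2)"
      using X4i v2i X4b c0 by (intro mult_left_mono integral_mono) auto
    also have "\<dots> \<le> c * (t^4 * (\<epsilon>\<^sup>2 * expectation v + expectation l))"
      using v2b c0 by (auto intro!: mult_left_mono)
    finally show "cmod (\<integral>x. H x * of_real (X4 x) \<partial>M) \<le> c * (t^4 * (\<epsilon>\<^sup>2 * expectation v + expectation l))" .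
  qed
  also have "\<dots> = c * ((t\<^sup>2 + t^4) * expectation l
       + \<bar>t\<bar>^3 * \<epsilon> * expectation (\<lambda>x. (d x)\<^sup>2) + t\<^sup>2 * expectation (\<lambda>x. V x - v x) + t^4 * \<epsilon>\<^sup>2 * expectation v)"
    by (simp add: algebra_simps)
  finally show ?thesis unfolding l_def .
qed

text \<open>The means of \<open>G k\<close> are nearly constant in \<open>k\<close>.
  \<open>G 0\<close> is \<open>h\<close>, and \<open>G n\<close> differs from
  \<open>exp (t^2 / 2) * h * exp (i t Z)\<close> by at most a multiple of
  \<open>\<bar>A - 1\<bar>\<close>. That comparison and the capping loss \<open>A - a n\<close> each
  contribute one \<open>t^2 * E \<bar>A - 1\<bar>\<close>, hence the factor 2. The weight
  \<open>h\<close> is known at time 0, so it can be carried along in the multiplier of every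
  step.\<close>

lemma martingale_clt_bound:
  fixes d V :: "nat \<Rightarrow> 'a \<Rightarrow> real" and h :: "'a \<Rightarrow> real"
  assumes d: "\<And>k. k < n \<Longrightarrow> in_L2 M (d k)" "\<And>k. k < n \<Longrightarrow> d k \<in> borel_measurable (F (Suc k))"
      "\<And>k. k < n \<Longrightarrow> AE x in M. CE k (d k) x = 0"
    and V: "\<And>k. k < n \<Longrightarrow> V k \<in> borel_measurable (F k)" "\<And>k x. 0 \<le> V k x"
      "\<And>k. k < n \<Longrightarrow> AE x in M. CE k (\<lambda>x. (d k x)\<^sup>2) x = V k x"
    and h: "h \<in> borel_measurable (F 0)" "\<And>x. \<bar>h x\<bar> \<le> 1"
    and \<epsilon>: "\<epsilon> > 0"
  defines "A \<equiv> \<lambda>x. \<Sum>k<n. V k x" and "Z \<equiv> \<lambda>x. \<Sum>k<n. d k x"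
    and "L \<equiv> \<Sum>k<n. expectation (\<lambda>x. (d k x)\<^sup>2 * indicator {y. \<epsilon> \<le> \<bar>y\<bar>} (d k x))"
  shows "cmod (\<integral>x. of_real (h x) * (iexp (t * Z x) - of_real (exp (- (t\<^sup>2 / 2)))) \<partial>M)
    \<le> exp (t\<^sup>2 / 2) * ((t\<^sup>2 + t^4) * L + \<bar>t\<bar>^3 * \<epsilon> * expectation A
        + 2 * t\<^sup>2 * expectation (\<lambda>x. \<bar>A x - 1\<bar>) + t^4 * \<epsilon>\<^sup>2)"
proof -
  define S where "S k x = (\<Sum>i<k. V i x)" for k x
  define Y where "Y k x = (\<Sum>i<k. d i x)" for k x
  \<comment> \<open>Capping the compensator at 1 keeps the exponentials bounded without truncating \<open>d\<close>;
    the excess \<open>S n - a n\<close> is at most \<open>\<bar>A - 1\<bar>\<close>.\<close>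
  define a where "a k x = min 1 (S k x)" for k x
  define v where "v k x = a (Suc k) x - a k x" for k x
  define c where "c = exp (t\<^sup>2 / 2)"
  define G where "G k x = of_real (h x) * (iexp (t * Y k x) * of_real (exp (t\<^sup>2 * a k x / 2)))" for k x
  have S_mono: "S k x \<le> S (Suc k) x" for k x by (simp add: S_def V)
  have v0: "0 \<le> v k x" for k x using S_mono[of k x] by (auto simp: v_def a_def)
  have vV: "v k x \<le> V k x" for k x using V(2)[of k x] by (auto simp: v_def a_def S_def)
  have S0: "0 \<le> S k x" for k x by (simp add: S_def V sum_nonneg)
  have a0: "a 0 x = 0" for x by (simp add: a_def S_def)
  have a01: "0 \<le> a k x" "a k x \<le> 1" for k x using S0[of k x] by (auto simp: a_def)
  have v1: "v k x \<le> 1" for k x using a01[of "Suc k" x] a01[of k x] by (simp add: v_def)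
  \<comment> \<open>Conditional variances are predictable: \<open>S k\<close> involves only
    \<open>V i\<close> with \<open>i < k\<close>, so it is measurable one step earlier than
    \<open>Y k\<close>.\<close>
  have SF: "S k \<in> borel_measurable (F j)" if "k \<le> Suc j" "k \<le> n" for k j
    unfolding S_def by (intro borel_measurable_sum) (use that in \<open>auto intro!: measurable_F_mono[OF V(1)]\<close>)
  have aF: "a k \<in> borel_measurable (F j)" if "k \<le> Suc j" "k \<le> n" for k j
    unfolding a_def using SF[OF that] by simp
  have YF: "Y k \<in> borel_measurable (F k)" if "k \<le> n" for k
    unfolding Y_def by (intro borel_measurable_sum) (use that in \<open>auto intro!: measurable_F_mono[OF d(2)]\<close>)
  have hF: "h \<in> borel_measurable (F k)" for k by (rule measurable_F_mono[OF h(1)]) simp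
  have [measurable]: "S k \<in> borel_measurable M" "a k \<in> borel_measurable M" "Y k \<in> borel_measurable M" if "k \<le> n" for k
    using that SF[of k k] aF[of k k] YF[of k] by (auto intro: measurable_F)
  have [measurable]: "h \<in> borel_measurable M" by (rule measurable_F[OF h(1)])
  have [measurable]: "d k \<in> borel_measurable M" if "k < n" for k using d(1)[OF that] by (simp add: in_L2_def)
  have Vi: "integrable M (V k)" if "k < n" for k
  proof (rule integrable_cong_AE_imp)
    show "integrable M (CE k (\<lambda>x. (d k x)\<^sup>2))"
      using d(1)[OF that] by (intro F.real_cond_exp_int) (auto simp: in_L2_def)
  qed (use V that in \<open>auto intro: measurable_F\<close>)
  have EV: "expectation (V k) = expectation (\<lambda>x. (d k x)\<^sup>2)" if "k < n" for k
  proof -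
    have "expectation (V k) = expectation (CE k (\<lambda>x. (d k x)\<^sup>2))"
    proof (rule integral_cong_AE)
      show "AE x in M. V k x = CE k (\<lambda>x. (d k x)\<^sup>2) x" using V(3)[OF that] by eventually_elim simp
    qed (use measurable_F[OF V(1)[OF that]] in auto)
    also have "\<dots> = expectation (\<lambda>x. (d k x)\<^sup>2)"
      using d(1)[OF that] by (intro F.real_cond_exp_int) (auto simp: in_L2_def)
    finally show ?thesis .
  qed
  have vi: "integrable M (v k)" if "k < n" for k
  proof (rule Bochner_Integration.integrable_bound[OF Vi[OF that]])
    show "v k \<in> borel_measurable M" 
      unfolding v_def using that measurable_F[OF aF[of k k]] measurable_F[OF aF[of "Suc k" k]] by auto
    show "AE x in M. norm (v k x) \<le> norm (V k x)" using v0 vV V by auto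
  qed
  have Si: "integrable M (S k)" if "k \<le> n" for k unfolding S_def using that Vi by auto
  have ai: "integrable M (a k)" if "k \<le> n" for k
    by (rule Bochner_Integration.integrable_bound[OF Si[OF that]]) (use that a01 S0 in \<open>auto simp: a_def\<close>)
  have An: "A = S n" by (simp add: A_def S_def fun_eq_iff)
  have Zn: "Z = Y n" by (simp add: Z_def Y_def fun_eq_iff)
  have Gb: "cmod (G k x) \<le> c" for k x
  proof -
    have "cmod (G k x) = \<bar>h x\<bar> * exp (t\<^sup>2 * a k x / 2)"
      unfolding G_def norm_mult by simp
    also have "\<dots> \<le> 1 * exp (t\<^sup>2 / 2)"
      using h a01[of k x] by (intro mult_mono) (auto simp: mult_left_le)
    finally show ?thesis by (simp add: c_def)
  qed
  have GM: "G k \<in> borel_measurable M" if "k \<le> n" for k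
  proof -
    have [measurable]: "Y k \<in> borel_measurable M" "a k \<in> borel_measurable M"
      using that aF[of k k] YF[of k] by (auto intro: measurable_F)
    show ?thesis unfolding G_def by measurable
  qed
  have Gi: "integrable M (G k)" if "k \<le> n" for k
    by (rule integrable_const_bound[where B=c]) (use Gb GM that in auto)
  define err where "err k = (t\<^sup>2 + t^4) * expectation (\<lambda>x. (d k x)\<^sup>2 * indicator {y. \<epsilon> \<le> \<bar>y\<bar>} (d k x))
       + \<bar>t\<bar>^3 * \<epsilon> * expectation (\<lambda>x. (d k x)\<^sup>2) + t\<^sup>2 * expectation (\<lambda>x. V k x - v k x) + t^4 * \<epsilon>\<^sup>2 * expectation (v k)" for k
  have step: "cmod ((\<integral>x. G (Suc k) x \<partial>M) - (\<integral>x. G k x \<partial>M)) \<le> c * err k" if k: "k < n" for k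
  proof -
    \<comment> \<open>The compensator is taken one step ahead, which predictability permits. Both
      \<open>G k\<close> and \<open>G (Suc k)\<close> are then \<open>H\<close> times a factor, and
      their difference has the form treated in \<open>martingale_clt_step\<close>.\<close>
    define H where "H x = of_real (h x) * (iexp (t * Y k x) * of_real (exp (t\<^sup>2 * a (Suc k) x / 2)))" for x
    have "H \<in> borel_measurable (F k)"
    proof -
      have [measurable]: "h \<in> borel_measurable (F k)" "Y k \<in> borel_measurable (F k)"
        "a (Suc k) \<in> borel_measurable (F k)"
        using hF[of k] YF[of k] aF[of "Suc k" k] k by auto
      show ?thesis unfolding H_def by measurable
    qed
    moreover have "cmod (H x) \<le> c" for x
    proof -
      have "cmod (H x) = \<bar>h x\<bar> * exp (t\<^sup>2 * a (Suc k) x / 2)"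
        unfolding H_def norm_mult by simp
      also have "\<dots> \<le> 1 * exp (t\<^sup>2 / 2)"
        using h a01[of "Suc k" x] by (intro mult_mono) (auto simp: mult_left_le)
      finally show ?thesis by (simp add: c_def)
    qed
    moreover have "v k \<in> borel_measurable (F k)"
      unfolding v_def using aF[of "Suc k" k] aF[of k k] k by auto
    ultimately have b: "cmod (\<integral>x. H x * (iexp (t * d k x) - of_real (exp (- (t\<^sup>2 * v k x / 2)))) \<partial>M) \<le> c * err k"
      unfolding err_def
      using martingale_clt_step[of "d k" k "V k" "v k" H c \<epsilon> t] d V v0 vV v1 \<epsilon> k by blast
    have "G (Suc k) x - G k x = H x * (iexp (t * d k x) - of_real (exp (- (t\<^sup>2 * v k x / 2))))" for x
    proof -
      have "exp (t\<^sup>2 * a k x / 2) = exp (t\<^sup>2 * a (Suc k) x / 2) * exp (- (t\<^sup>2 * v k x / 2))"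
        unfolding exp_add[symmetric] by (simp add: v_def algebra_simps diff_divide_distrib)
      moreover have "iexp (t * Y (Suc k) x) = iexp (t * Y k x) * iexp (t * d k x)"
        unfolding exp_add[symmetric] by (simp add: Y_def algebra_simps)
      ultimately show ?thesis by (simp add: G_def H_def algebra_simps)
    qed
    then have "(\<integral>x. G (Suc k) x \<partial>M) - (\<integral>x. G k x \<partial>M) =
        (\<integral>x. H x * (iexp (t * d k x) - of_real (exp (- (t\<^sup>2 * v k x / 2)))) \<partial>M)"
      using Gi k by (subst Bochner_Integration.integral_diff[symmetric]) auto
    then show ?thesis using b by simp
  qed
  have "cmod ((\<integral>x. G n x \<partial>M) - (\<integral>x. G 0 x \<partial>M)) \<le> (\<Sum>k<n. c * err k)"
  proof -
    have "(\<integral>x. G n x \<partial>M) - (\<integral>x. G 0 x \<partial>M) = (\<Sum>k<n. (\<integral>x. G (Suc k) x \<partial>M) - (\<integral>x. G k x \<partial>M))"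
      by (rule sum_lessThan_telescope[symmetric])
    then show ?thesis using step by (auto intro!: sum_norm_le)
  qed
  also have "(\<Sum>k<n. c * err k) = c * ((t\<^sup>2 + t^4) * L + \<bar>t\<bar>^3 * \<epsilon> * (\<Sum>k<n. expectation (V k))
      + t\<^sup>2 * (\<Sum>k<n. expectation (\<lambda>x. V k x - v k x)) + t^4 * \<epsilon>\<^sup>2 * (\<Sum>k<n. expectation (v k)))"
    unfolding err_def L_def by (simp add: sum.distrib sum_distrib_left EV distrib_left mult.assoc)
  also have "(\<Sum>k<n. expectation (V k)) = expectation A"
    unfolding A_def using Vi by simp
  also have "(\<Sum>k<n. expectation (v k)) = expectation (a n)"
  proof -
    have "(\<Sum>k<n. expectation (v k)) = expectation (\<lambda>x. \<Sum>k<n. v k x)" using vi by simp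
    also have "(\<lambda>x. \<Sum>k<n. v k x) = (\<lambda>x. a n x - a 0 x)"
      unfolding v_def by (subst sum_lessThan_telescope) simp
    finally show ?thesis by (simp add: a0)
  qed
  also have "(\<Sum>k<n. expectation (\<lambda>x. V k x - v k x)) = expectation (\<lambda>x. A x - a n x)"
  proof -
    have "(\<Sum>k<n. expectation (\<lambda>x. V k x - v k x)) = expectation (\<lambda>x. \<Sum>k<n. V k x - v k x)" using vi Vi by simp
    also have "(\<lambda>x. \<Sum>k<n. V k x - v k x) = (\<lambda>x. A x - (a n x - a 0 x))"
    proof
      fix x show "(\<Sum>k<n. V k x - v k x) = A x - (a n x - a 0 x)"
        using sum_lessThan_telescope[of "\<lambda>k. a k x" n] by (simp add: A_def v_def sum_subtractf)
    qed
    finally show ?thesis by (simp add: a0)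
  qed
  finally have main: "cmod ((\<integral>x. G n x \<partial>M) - (\<integral>x. G 0 x \<partial>M)) \<le> c * ((t\<^sup>2 + t^4) * L + \<bar>t\<bar>^3 * \<epsilon> * expectation A
      + t\<^sup>2 * expectation (\<lambda>x. A x - a n x) + t^4 * \<epsilon>\<^sup>2 * expectation (a n))" .
  have i1: "integrable M (\<lambda>x. \<bar>A x - 1\<bar>)" unfolding An using Si[of n] by simp
  have Ea: "expectation (\<lambda>x. A x - a n x) \<le> expectation (\<lambda>x. \<bar>A x - 1\<bar>)"
    using Si[of n] ai[of n] i1 by (intro integral_mono) (auto simp: An a_def)
  have Ea1: "expectation (a n) \<le> 1"
    using integral_mono[OF ai[of n] integrable_const[of 1]] a01 by (simp add: prob_space)
  define R where "R x = G n x - of_real c * (of_real (h x) * iexp (t * Z x))" for x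
  have Rb: "cmod (R x) \<le> c * (t\<^sup>2 * \<bar>A x - 1\<bar>)" for x
  proof -
    have "R x = of_real (h x) * (iexp (t * Z x) * of_real (exp (t\<^sup>2 * a n x / 2) - c))"
      by (simp add: R_def G_def Zn algebra_simps)
    then have "cmod (R x) = \<bar>h x\<bar> * \<bar>exp (t\<^sup>2 * a n x / 2) - c\<bar>"
      by (simp add: norm_mult del: of_real_diff)
    also have "\<dots> \<le> 1 * \<bar>exp (t\<^sup>2 * a n x / 2) - c\<bar>" using h by (intro mult_right_mono) auto
    also have "\<dots> \<le> c * (t\<^sup>2 / 2 * (1 - a n x))"
    proof -
      define u where "u = t\<^sup>2 / 2 * (1 - a n x)"
      have u: "u \<ge> 0" using a01 by (simp add: u_def)
      have e: "exp (t\<^sup>2 * a n x / 2) = c * exp (- u)"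
        unfolding c_def u_def exp_add[symmetric] by (simp add: algebra_simps diff_divide_distrib)
      have "1 - u \<le> exp (-u)" using exp_ge_add_one_self[of "-u"] by simp
      moreover have "exp (-u) \<le> 1" using u by simp
      ultimately have "\<bar>exp (-u) - 1\<bar> \<le> u" by simp
      moreover have "exp (t\<^sup>2 * a n x / 2) - c = c * (exp (-u) - 1)" unfolding e by (simp add: algebra_simps)
      moreover have "c > 0" by (simp add: c_def)
      ultimately show ?thesis unfolding u_def[symmetric] by (simp add: abs_mult)
    qed
    also have "\<dots> \<le> c * (t\<^sup>2 * \<bar>A x - 1\<bar>)"
    proof (intro mult_left_mono mult_mono)
      show "1 - a n x \<le> \<bar>A x - 1\<bar>" by (auto simp: a_def An)
    qed (auto simp: c_def a01)
    finally show ?thesis .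
  qed
  have hZ: "integrable M (\<lambda>x. of_real (h x) * iexp (t * Z x))"
    unfolding Zn by (rule integrable_const_bound[where B=1]) (use h in \<open>auto simp: norm_mult\<close>)
  have hi: "integrable M h" by (rule integrable_const_bound[where B=1]) (use h in auto)
  have Ri: "integrable M R" unfolding R_def using Gi[of n] hZ by simp
  have ER: "cmod (\<integral>x. R x \<partial>M) \<le> c * (t\<^sup>2 * expectation (\<lambda>x. \<bar>A x - 1\<bar>))"
  proof -
    have "cmod (\<integral>x. R x \<partial>M) \<le> expectation (\<lambda>x. cmod (R x))" by (rule integral_norm_bound)
    also have "\<dots> \<le> expectation (\<lambda>x. c * (t\<^sup>2 * \<bar>A x - 1\<bar>))"
      using Ri i1 Rb by (intro integral_mono) auto
    finally show ?thesis by simp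
  qed
  define e where "e = (\<integral>x. of_real (h x) * (iexp (t * Z x) - of_real (exp (- (t\<^sup>2 / 2)))) \<partial>M)"
  have e1: "e = (\<integral>x. of_real (h x) * iexp (t * Z x) \<partial>M) - of_real (exp (- (t\<^sup>2 / 2))) * (\<integral>x. of_real (h x) \<partial>M)"
    unfolding e_def right_diff_distrib using hZ hi by (simp add: mult.commute)
  have e2: "(\<integral>x. G 0 x \<partial>M) = (\<integral>x. of_real (h x) \<partial>M)" by (simp add: G_def Y_def a_def S_def)
  have e3: "(\<integral>x. R x \<partial>M) = (\<integral>x. G n x \<partial>M) - of_real c * (\<integral>x. of_real (h x) * iexp (t * Z x) \<partial>M)"
    unfolding R_def using Gi[of n] hZ by simp
  have e4: "of_real c * of_real (exp (- (t\<^sup>2 / 2))) = (1 :: complex)"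
    unfolding c_def by (simp add: exp_minus flip: of_real_mult)
  have "of_real c * e = of_real c * (\<integral>x. of_real (h x) * iexp (t * Z x) \<partial>M)
      - (of_real c * of_real (exp (- (t\<^sup>2 / 2)))) * (\<integral>x. of_real (h x) \<partial>M)"
    unfolding e1 right_diff_distrib mult.assoc ..
  then have "of_real c * e = ((\<integral>x. G n x \<partial>M) - (\<integral>x. G 0 x \<partial>M)) - (\<integral>x. R x \<partial>M)"
    unfolding e4 e2 e3 by simp
  then have "cmod (of_real c * e) \<le> cmod ((\<integral>x. G n x \<partial>M) - (\<integral>x. G 0 x \<partial>M)) + cmod (\<integral>x. R x \<partial>M)"
    by (metis norm_triangle_ineq4)
  \<comment> \<open>Multiplying by \<open>c = exp (t^2 / 2) \<ge> 1\<close> only increases the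
    modulus.\<close>
  moreover have "cmod e \<le> cmod (of_real c * e)"
    by (simp add: norm_mult c_def mult_right_le_one_le mult_le_cancel_right1)
  ultimately have "cmod e \<le> c * ((t\<^sup>2 + t^4) * L + \<bar>t\<bar>^3 * \<epsilon> * expectation A
      + t\<^sup>2 * expectation (\<lambda>x. A x - a n x) + t^4 * \<epsilon>\<^sup>2 * expectation (a n)) + c * (t\<^sup>2 * expectation (\<lambda>x. \<bar>A x - 1\<bar>))"
    using main ER by linarith
  also have "\<dots> \<le> c * ((t\<^sup>2 + t^4) * L + \<bar>t\<bar>^3 * \<epsilon> * expectation A
      + t\<^sup>2 * expectation (\<lambda>x. \<bar>A x - 1\<bar>) + t^4 * \<epsilon>\<^sup>2 * 1) + c * (t\<^sup>2 * expectation (\<lambda>x. \<bar>A x - 1\<bar>))"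
    using Ea Ea1 \<epsilon> by (intro add_mono mult_left_mono) (auto simp: c_def)
  also have "\<dots> = c * ((t\<^sup>2 + t^4) * L + \<bar>t\<bar>^3 * \<epsilon> * expectation A
        + 2 * t\<^sup>2 * expectation (\<lambda>x. \<bar>A x - 1\<bar>) + t^4 * \<epsilon>\<^sup>2)"
    by (simp add: algebra_simps)
  finally show ?thesis unfolding e_def c_def .
qed

end

section \<open>Martingales from truncated blocks\<close>

text \<open>An abstract terminal value \<open>\<psi> j\<close> for the block from
  \<open>j * m\<close> to \<open>Suc j * m\<close>: known at the block end and uniformly bounded. It
  will be the clipped block sum.\<close>

locale block_martingale = filtered_prob_space +
  fixes m N :: nat and \<psi> :: "nat \<Rightarrow> 'a \<Rightarrow> real" and R :: real
  assumes m_pos: "m > 0"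
    and \<psi>_meas: "\<And>j. \<psi> j \<in> borel_measurable (F (Suc j * m))"
    and \<psi>_bound: "\<And>j x. \<bar>\<psi> j x\<bar> \<le> R"
begin

text \<open>The increment of index \<open>k\<close> leads from \<open>F k\<close> to \<open>F (Suc k)\<close>.\<close>

definition md :: "nat \<Rightarrow> 'a \<Rightarrow> real" where
  "md k x = (if k < N * m then CE (Suc k) (\<psi> (k div m)) x - CE k (\<psi> (k div m)) x else 0)"

text \<open>Total increment over block \<open>j\<close>. Using the conditional expectation at the
  block end in place of \<open>\<psi> j\<close> itself makes \<open>sum_md\<close> hold at every
  point; \<open>bm_AE\<close> returns to \<open>\<psi> j\<close> up to a null set.\<close>

definition bm :: "nat \<Rightarrow> 'a \<Rightarrow> real" where
  "bm j x = CE (Suc j * m) (\<psi> j) x - CE (j * m) (\<psi> j) x"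

lemma R_nonneg: "0 \<le> R" using \<psi>_bound[of 0 undefined] by linarith

lemma \<psi>_M [measurable]: "\<psi> j \<in> borel_measurable M" using measurable_F[OF \<psi>_meas] .

lemma \<psi>_L2: "in_L2 M (\<psi> j)" by (rule in_L2_bounded[where c=R]) (use \<psi>_bound in auto)

lemma \<psi>_integrable: "integrable M (\<psi> j)" by (rule in_L2_integrable[OF \<psi>_L2])

lemma CE_\<psi>_bound: "AE x in M. \<bar>CE k (\<psi> j) x\<bar> \<le> R"
proof -
  have "AE x in M. CE k (\<psi> j) x \<le> R"
    by (rule F.real_cond_exp_le_c[OF \<psi>_integrable]) (use \<psi>_bound abs_le_D1 in blast)
  moreover have "AE x in M. CE k (\<psi> j) x \<ge> - R"
  proof (rule F.real_cond_exp_ge_c[OF \<psi>_integrable])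
    have "- R \<le> \<psi> j x" for x using \<psi>_bound[of j x] by linarith
    then show "AE x in M. - R \<le> \<psi> j x" by simp
  qed
  ultimately show ?thesis by eventually_elim linarith
qed

lemma md_F: "md k \<in> borel_measurable (F (Suc k))"
  unfolding md_def[abs_def] using CE_measurable[of k "Suc k"] CE_measurable[of "Suc k" "Suc k"] by simp

lemma md_M [measurable]: "md k \<in> borel_measurable M" using measurable_F[OF md_F] .

lemma md_L2: "in_L2 M (md k)"
  using in_L2_diff[OF CE_L2[OF \<psi>_L2] CE_L2[OF \<psi>_L2]] in_L2_const by (cases "k < N * m") (auto simp: md_def[abs_def])

lemma md_zero: "AE x in M. CE k (md k) x = 0"
proof (cases "k < N * m")
  case True
  then have "md k = (\<lambda>x. CE (Suc k) (\<psi> (k div m)) x - CE k (\<psi> (k div m)) x)" by (auto simp: md_def)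
  then show ?thesis using CE_increment_zero[OF \<psi>_integrable, of k "Suc k"] by simp
next
  case False
  then have "md k = (\<lambda>x. 0)" by (auto simp: md_def)
  then show ?thesis using F.real_cond_exp_F_meas[of "\<lambda>_. 0" k] by simp
qed

lemma md_bound: "AE x in M. \<bar>md k x\<bar> \<le> 2 * R"
  using CE_\<psi>_bound[of k "k div m"] CE_\<psi>_bound[of "Suc k" "k div m"]
  by eventually_elim (use R_nonneg in \<open>auto simp: md_def\<close>)

lemma bm_F: "bm j \<in> borel_measurable (F (Suc j * m))"
  unfolding bm_def[abs_def] using CE_measurable[of "j * m" "Suc j * m"] CE_measurable[of "Suc j * m" "Suc j * m"] by simp

lemma bm_M [measurable]: "bm j \<in> borel_measurable M" using measurable_F[OF bm_F] .

lemma bm_L2: "in_L2 M (bm j)"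
  unfolding bm_def[abs_def] by (rule in_L2_diff[OF CE_L2[OF \<psi>_L2] CE_L2[OF \<psi>_L2]])

lemma bm_zero: "AE x in M. CE (j * m) (bm j) x = 0"
  unfolding bm_def[abs_def] by (rule CE_increment_zero[OF \<psi>_integrable]) simp

lemma bm_bound: "AE x in M. \<bar>bm j x\<bar> \<le> 2 * R"
  using CE_\<psi>_bound[of "j * m" j] CE_\<psi>_bound[of "Suc j * m" j]
  by eventually_elim (auto simp: bm_def)

lemma bm_AE: "AE x in M. bm j x = \<psi> j x - CE (j * m) (\<psi> j) x"
  using F.real_cond_exp_F_meas[OF \<psi>_integrable \<psi>_meas, of j] by eventually_elim (simp add: bm_def)

lemma div_block: "i < m \<Longrightarrow> (j * m + i) div m = j"
  using m_pos by (metis add.commute div_eq_0_iff div_mult_self3 add_0 less_numeral_extra(3) mult.commute)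

lemma md_block:
  assumes "j < N" "i < m"
  shows "md (j * m + i) x = CE (j * m + Suc i) (\<psi> j) x - CE (j * m + i) (\<psi> j) x"
proof -
  have "j * m + i < Suc j * m" using assms by simp
  also have "\<dots> \<le> N * m" using assms by (intro mult_right_mono) auto
  finally show ?thesis by (simp add: md_def div_block[OF assms(2)])
qed

lemma sum_md_block:
  assumes "j < N" "i \<le> m"
  shows "(\<Sum>k<i. md (j * m + k) x) = CE (j * m + i) (\<psi> j) x - CE (j * m) (\<psi> j) x"
  using assms(2)
proof (induction i)
  case (Suc i)
  then show ?case using md_block[OF assms(1), of i x] by simp
qed simp

lemma sum_blocks: "sum f {..<j * m} = (\<Sum>j'<j. \<Sum>i<m. f (j' * m + i))" for f :: "nat \<Rightarrow> real"
proof -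
  have "sum f {..<j * m} = (\<Sum>j'<j. sum f {j' * m..<j' * m + m})" by (rule sum.nat_group[symmetric])
  also have "\<dots> = (\<Sum>j'<j. \<Sum>i<m. f (j' * m + i))"
  proof (rule sum.cong[OF refl])
    fix j' show "sum f {j' * m..<j' * m + m} = (\<Sum>i<m. f (j' * m + i))"
      by (subst sum.atLeastLessThan_shift_0) (simp add: atLeast0LessThan)
  qed
  finally show ?thesis .
qed

lemma sum_md:
  assumes "j \<le> N" shows "(\<Sum>k<j * m. md k x) = (\<Sum>j'<j. bm j' x)"
  unfolding sum_blocks
proof (rule sum.cong[OF refl])
  fix j' assume "j' \<in> {..<j}"
  then show "(\<Sum>i<m. md (j' * m + i) x) = bm j' x"
    using sum_md_block[of j' m x] assms by (simp add: bm_def add.commute)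
qed

interpretation G: filtered_prob_space M "\<lambda>j. F (j * m)"
  by unfold_locales (use F_subalgebra F_mono in auto)

text \<open>Both sides are the second moment of the same final martingale value, computed once with
  the fine filtration and once with the filtration at block ends.\<close>

lemma sum_md_sq: "(\<Sum>k<N * m. expectation (\<lambda>x. (md k x)\<^sup>2)) = (\<Sum>j<N. expectation (\<lambda>x. (bm j x)\<^sup>2))"
proof -
  have "(\<Sum>k<N * m. expectation (\<lambda>x. (md k x)\<^sup>2)) = expectation (\<lambda>x. (\<Sum>k<N * m. md k x)\<^sup>2)"
    by (rule orthogonal_sum[symmetric]) (use md_L2 md_F md_zero in auto)
  also have "\<dots> = expectation (\<lambda>x. (\<Sum>j<N. bm j x)\<^sup>2)" by (simp add: sum_md)
  also have "\<dots> = (\<Sum>j<N. expectation (\<lambda>x. (bm j x)\<^sup>2))"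
    by (rule G.orthogonal_sum) (use bm_L2 bm_F bm_zero in auto)
  finally show ?thesis .
qed

text \<open>Both sums compensate the same quantity, the sum of the \<open>(bm j)^2\<close>, once in
  unit steps and once in block steps. Their difference is thus a difference of two sums of
  martingale differences, whose second moments add up. Boundedness turns fourth moments into
  \<open>R\<^sup>2\<close> times second moments. For \<open>R = K * sqrt (v m)\<close> the bound is
  of order \<open>K\<^sup>2 / N\<close> relative to the square of \<open>N * v m\<close>, so many
  blocks beat a fixed clipping level.\<close>

lemma conditional_variance_blocks:
  "in_L2 M (\<lambda>x. (\<Sum>k<N * m. CE k (\<lambda>x. (md k x)\<^sup>2) x) - (\<Sum>j<N. CE (j * m) (\<lambda>x. (bm j x)\<^sup>2) x))" (is "in_L2 M ?T")
  "expectation (\<lambda>x. ((\<Sum>k<N * m. CE k (\<lambda>x. (md k x)\<^sup>2) x) - (\<Sum>j<N. CE (j * m) (\<lambda>x. (bm j x)\<^sup>2) x))\<^sup>2)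
    \<le> 80 * R\<^sup>2 * (\<Sum>j<N. expectation (\<lambda>x. (bm j x)\<^sup>2))"
proof -
  \<comment> \<open>\<open>p k\<close> is the value which the block martingale has reached before
    step \<open>k\<close>; it is \<open>F k\<close>-measurable and bounded by
    \<open>2 * R\<close>.\<close>
  define p where "p k x = CE k (\<psi> (k div m)) x - CE (k div m * m) (\<psi> (k div m)) x" for k x
  define y where "y k x = (md k x)\<^sup>2 + 2 * (p k x * md k x)" for k x
  have pF: "p k \<in> borel_measurable (F k)" for k
    unfolding p_def[abs_def] using CE_measurable[of k k] CE_measurable[of "k div m * m" k] by simp
  have [measurable]: "p k \<in> borel_measurable M" for k using measurable_F[OF pF] .
  have pb: "AE x in M. \<bar>p k x\<bar> \<le> 2 * R" for k
    using CE_\<psi>_bound[of k "k div m"] CE_\<psi>_bound[of "k div m * m" "k div m"]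
    by eventually_elim (auto simp: p_def)
  have yF: "y k \<in> borel_measurable (F (Suc k))" for k
    unfolding y_def[abs_def] using md_F[of k] measurable_F_mono[OF pF, of k "Suc k"] by simp
  have yM [measurable]: "y k \<in> borel_measurable M" for k using measurable_F[OF yF] .
  \<comment> \<open>\<open>\<bar>md k\<bar> \<le> 2 * R\<close> and
    \<open>2 * \<bar>p k\<bar> \<le> 4 * R\<close> give the 6, and its square is the 36 below. With
    \<open>(2 * R)\<^sup>2\<close> from the blocks the final constant is
    \<open>2 * 36 + 2 * 4 = 80\<close>.\<close>
  have yb: "AE x in M. \<bar>y k x\<bar> \<le> 6 * R * \<bar>md k x\<bar>" for k
    using pb[of k] md_bound[of k]
  proof eventually_elim
    case (elim x)
    have "\<bar>y k x\<bar> = \<bar>md k x\<bar> * \<bar>md k x + 2 * p k x\<bar>" unfolding abs_mult[symmetric] by (simp add: y_def power2_eq_square algebra_simps)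
    also have "\<dots> \<le> \<bar>md k x\<bar> * (6 * R)" using elim by (intro mult_left_mono) auto
    finally show ?case by (simp add: mult.commute)
  qed
  have yL2: "in_L2 M (y k)" for k
    by (rule in_L2_bound[OF in_L2_cmult[OF md_L2, of "6 * R" k]])
       (use yb R_nonneg in \<open>auto simp: abs_mult\<close>)
  have y2: "expectation (\<lambda>x. (y k x)\<^sup>2) \<le> 36 * R\<^sup>2 * expectation (\<lambda>x. (md k x)\<^sup>2)" for k
  proof -
    have "expectation (\<lambda>x. (y k x)\<^sup>2) \<le> expectation (\<lambda>x. 36 * R\<^sup>2 * (md k x)\<^sup>2)"
    proof (rule integral_mono_AE)
      show "AE x in M. (y k x)\<^sup>2 \<le> 36 * R\<^sup>2 * (md k x)\<^sup>2"
        using yb[of k]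
      proof eventually_elim
        case (elim x)
        then have "\<bar>y k x\<bar>\<^sup>2 \<le> (6 * R * \<bar>md k x\<bar>)\<^sup>2" by (intro power_mono) auto
        then show ?case by (simp add: power_mult_distrib)
      qed
    qed (use yL2[of k] md_L2[of k] in \<open>auto simp: in_L2_def\<close>)
    then show ?thesis by simp
  qed
  have pd: "in_L2 M (p k)" for k by (rule in_L2_bounded[OF _ pb]) simp
  have d2: "integrable M (\<lambda>x. (md k x)\<^sup>2)" for k using md_L2 by (simp add: in_L2_def)
  have CEy: "AE x in M. CE k (y k) x = CE k (\<lambda>x. (md k x)\<^sup>2) x" for k
  proof -
    have i: "integrable M (\<lambda>x. p k x * md k x)" by (rule in_L2_mult[OF pd md_L2])
    have "AE x in M. CE k (\<lambda>x. (md k x)\<^sup>2 + 2 * (p k x * md k x)) x = CE k (\<lambda>x. (md k x)\<^sup>2) x + CE k (\<lambda>x. 2 * (p k x * md k x)) x"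
      by (rule F.real_cond_exp_add) (use i d2 in auto)
    moreover have "AE x in M. CE k (\<lambda>x. 2 * (p k x * md k x)) x = 2 * CE k (\<lambda>x. p k x * md k x) x"
      by (rule F.real_cond_exp_cmult[OF i])
    moreover have "AE x in M. CE k (\<lambda>x. p k x * md k x) x = p k x * CE k (md k) x"
      by (rule F.real_cond_exp_mult[OF pF _ i]) simp
    ultimately show ?thesis unfolding y_def[abs_def] using md_zero[of k] by eventually_elim simp
  qed
  \<comment> \<open>Each \<open>y k\<close> is an increment of the squared block martingale, so the \<open>y k\<close> telescope to
    \<open>(bm j)\<^sup>2\<close> while their conditional expectations are the conditional variances.\<close>
  define \<zeta> where "\<zeta> k x = y k x - CE k (y k) x" for k x
  have \<zeta>L2: "in_L2 M (\<zeta> k)" for k unfolding \<zeta>_def[abs_def] by (rule in_L2_diff[OF yL2 CE_L2[OF yL2]])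
  have \<zeta>2: "expectation (\<lambda>x. (\<Sum>k<N * m. \<zeta> k x)\<^sup>2) = (\<Sum>k<N * m. expectation (\<lambda>x. (\<zeta> k x)\<^sup>2))"
  proof (rule orthogonal_sum[OF \<zeta>L2])
    show "\<zeta> j \<in> borel_measurable (F (Suc j))" for j
      unfolding \<zeta>_def[abs_def] using yF CE_measurable[of j "Suc j"] by simp
    show "AE x in M. CE j (\<zeta> j) x = 0" for j
      unfolding \<zeta>_def[abs_def] by (rule CE_residual_zero[OF in_L2_integrable[OF yL2]]) simp
  qed
  define b2 where "b2 j x = (bm j x)\<^sup>2" for j x
  have b2L2: "in_L2 M (b2 j)" for j
  proof (rule in_L2_bounded)
    show "AE x in M. \<bar>b2 j x\<bar> \<le> (2 * R)\<^sup>2"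
      using bm_bound[of j]
    proof eventually_elim
      case (elim x)
      then have "\<bar>bm j x\<bar>\<^sup>2 \<le> (2 * R)\<^sup>2" by (intro power_mono) auto
      then show ?case by (simp add: b2_def)
    qed
  qed (simp add: b2_def[abs_def])
  define \<xi> where "\<xi> j x = b2 j x - CE (j * m) (b2 j) x" for j x
  have \<xi>L2: "in_L2 M (\<xi> j)" for j unfolding \<xi>_def[abs_def] by (rule in_L2_diff[OF b2L2 CE_L2[OF b2L2]])
  have \<xi>2: "expectation (\<lambda>x. (\<Sum>j<N. \<xi> j x)\<^sup>2) = (\<Sum>j<N. expectation (\<lambda>x. (\<xi> j x)\<^sup>2))"
  proof (rule G.orthogonal_sum[OF \<xi>L2])
    show "\<xi> j \<in> borel_measurable (F (Suc j * m))" for j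
      unfolding \<xi>_def[abs_def] b2_def[abs_def] using bm_F CE_measurable[of "j * m" "Suc j * m"] by simp
    show "AE x in M. CE (j * m) (\<xi> j) x = 0" for j
      unfolding \<xi>_def[abs_def] by (rule CE_residual_zero[OF in_L2_integrable[OF b2L2]]) simp
  qed
  have tel: "(\<Sum>k<N * m. y k x) = (\<Sum>j<N. b2 j x)" for x
    unfolding sum_blocks
  proof (intro sum.cong refl)
    fix j assume "j \<in> {..<N}"
    then have j: "j < N" by simp
    define q where "q i = (CE (j * m + i) (\<psi> j) x - CE (j * m) (\<psi> j) x)\<^sup>2" for i
    have "y (j * m + i) x = q (Suc i) - q i" if "i < m" for i
    proof -
      have p: "p (j * m + i) x = CE (j * m + i) (\<psi> j) x - CE (j * m) (\<psi> j) x"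
        unfolding p_def div_block[OF that] ..
      show ?thesis
        unfolding y_def p q_def md_block[OF j that] by (simp add: power2_eq_square algebra_simps)
    qed
    then have "(\<Sum>i<m. y (j * m + i) x) = (\<Sum>i<m. q (Suc i) - q i)" by simp
    also have "\<dots> = b2 j x" unfolding sum_lessThan_telescope by (simp add: q_def b2_def bm_def add.commute)
    finally show "(\<Sum>i<m. y (j * m + i) x) = b2 j x" .
  qed
  \<comment> \<open>The sums of \<open>\<zeta>\<close> and of \<open>\<xi>\<close> both contain the
    sum of the \<open>b2 j\<close>; it cancels here and leaves the difference of the two
    compensators.\<close>
  let ?U = "\<lambda>x. - (\<Sum>k<N * m. \<zeta> k x) + (\<Sum>j<N. \<xi> j x)"
  have TU: "AE x in M. ?U x = ?T x"
  proof -
    have "AE x in M. \<forall>k<N*m. CE k (y k) x = CE k (\<lambda>x. (md k x)\<^sup>2) x"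
      using CEy by (simp add: AE_all_countable)
    then show ?thesis
    proof eventually_elim
      case (elim x)
      have "(\<Sum>k<N * m. \<zeta> k x) = (\<Sum>j<N. b2 j x) - (\<Sum>k<N * m. CE k (\<lambda>x. (md k x)\<^sup>2) x)"
        unfolding \<zeta>_def sum_subtractf tel using elim by simp
      moreover have "(\<Sum>j<N. \<xi> j x) = (\<Sum>j<N. b2 j x) - (\<Sum>j<N. CE (j * m) (b2 j) x)"
        unfolding \<xi>_def sum_subtractf ..
      ultimately show ?case unfolding b2_def[abs_def] by simp
    qed
  qed
  have s\<zeta>: "in_L2 M (\<lambda>x. - (\<Sum>k<N * m. \<zeta> k x))"
    using in_L2_cmult[OF in_L2_sum[where I = "{..<N * m}", OF \<zeta>L2], of "-1"] by simp
  have s\<xi>: "in_L2 M (\<lambda>x. \<Sum>j<N. \<xi> j x)" by (rule in_L2_sum[OF \<xi>L2])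
  show T2: "in_L2 M ?T"
    by (rule in_L2_cong_AE[OF in_L2_add[OF s\<zeta> s\<xi>] _ TU]) simp
  have "expectation (\<lambda>x. (?T x)\<^sup>2) = expectation (\<lambda>x. (?U x)\<^sup>2)"
  proof (rule integral_cong_AE)
    show "AE x in M. (?T x)\<^sup>2 = (?U x)\<^sup>2" using TU by eventually_elim simp
  qed (use T2 in_L2_add[OF s\<zeta> s\<xi>] in \<open>auto simp: in_L2_def\<close>)
  also have "\<dots> \<le> 2 * expectation (\<lambda>x. (- (\<Sum>k<N * m. \<zeta> k x))\<^sup>2) + 2 * expectation (\<lambda>x. (\<Sum>j<N. \<xi> j x)\<^sup>2)"
    by (rule expectation_sum_sq_le[OF s\<zeta> s\<xi>])
  also have "\<dots> = 2 * (\<Sum>k<N * m. expectation (\<lambda>x. (\<zeta> k x)\<^sup>2)) + 2 * (\<Sum>j<N. expectation (\<lambda>x. (\<xi> j x)\<^sup>2))"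
    by (simp add: \<zeta>2 \<xi>2)
  also have "\<dots> \<le> 2 * (\<Sum>k<N * m. 36 * R\<^sup>2 * expectation (\<lambda>x. (md k x)\<^sup>2)) + 2 * (\<Sum>j<N. 4 * R\<^sup>2 * expectation (\<lambda>x. (bm j x)\<^sup>2))"
  proof (intro add_mono mult_left_mono sum_mono)
    fix k
    have "expectation (\<lambda>x. (\<zeta> k x)\<^sup>2) \<le> expectation (\<lambda>x. (y k x)\<^sup>2)"
      unfolding \<zeta>_def by (rule CE_residual_L2_le[OF yL2])
    then show "expectation (\<lambda>x. (\<zeta> k x)\<^sup>2) \<le> 36 * R\<^sup>2 * expectation (\<lambda>x. (md k x)\<^sup>2)"
      using y2[of k] by linarith
  next
    fix j
    have "expectation (\<lambda>x. (\<xi> j x)\<^sup>2) \<le> expectation (\<lambda>x. (b2 j x)\<^sup>2)"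
      unfolding \<xi>_def by (rule CE_residual_L2_le[OF b2L2])
    also have "\<dots> \<le> expectation (\<lambda>x. 4 * R\<^sup>2 * (bm j x)\<^sup>2)"
    proof (rule integral_mono_AE)
      show "AE x in M. (b2 j x)\<^sup>2 \<le> 4 * R\<^sup>2 * (bm j x)\<^sup>2"
        using bm_bound[of j]
      proof eventually_elim
        case (elim x)
        then have "\<bar>bm j x\<bar>\<^sup>2 \<le> (2 * R)\<^sup>2" by (intro power_mono) auto
        then have "(bm j x)\<^sup>2 * (bm j x)\<^sup>2 \<le> (2 * R)\<^sup>2 * (bm j x)\<^sup>2" by (intro mult_right_mono) auto
        then show ?case by (simp add: b2_def power_mult_distrib power2_eq_square)
      qed
    qed (use b2L2[of j] bm_L2[of j] in \<open>auto simp: in_L2_def\<close>)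
    finally show "expectation (\<lambda>x. (\<xi> j x)\<^sup>2) \<le> 4 * R\<^sup>2 * expectation (\<lambda>x. (bm j x)\<^sup>2)" by simp
  qed auto
  also have "\<dots> = 72 * R\<^sup>2 * (\<Sum>k<N * m. expectation (\<lambda>x. (md k x)\<^sup>2)) + 8 * R\<^sup>2 * (\<Sum>j<N. expectation (\<lambda>x. (bm j x)\<^sup>2))"
    by (simp add: sum_distrib_left mult.assoc)
  also have "\<dots> = 80 * R\<^sup>2 * (\<Sum>j<N. expectation (\<lambda>x. (bm j x)\<^sup>2))"
    by (simp add: sum_md_sq)
  finally show "expectation (\<lambda>x. (?T x)\<^sup>2) \<le> \<dots>" .
qed

end

text \<open>Values beyond \<open>K\<close> are pushed to the boundary and not to 0. This keeps the
  function continuous, monotone and odd, which the approximation by half-lines and the vanishing of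
  its normal mean rely on.\<close>

definition clip :: "real \<Rightarrow> real \<Rightarrow> real" where
  "clip K s = max (- K) (min K s)"

lemma clip_measurable [measurable]: "clip K \<in> borel_measurable borel"
  unfolding clip_def[abs_def] by measurable

lemma abs_clip_le: "K \<ge> 0 \<Longrightarrow> \<bar>clip K s\<bar> \<le> K" by (auto simp: clip_def)

lemma clip_sq_le: "K \<ge> 0 \<Longrightarrow> (clip K s)\<^sup>2 \<le> s\<^sup>2"
  by (rule abs_le_square_iff[THEN iffD1]) (auto simp: clip_def)

text \<open>\<open>clip K s\<close> and the remainder \<open>s - clip K s\<close> have the same
  sign, so the cross term in the square of their sum is nonnegative. Tails are thereby controlled
  through second moments alone.\<close>

lemma clip_residual: "K \<ge> 0 \<Longrightarrow> (s - clip K s)\<^sup>2 \<le> s\<^sup>2 - (clip K s)\<^sup>2"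
proof -
  assume "K \<ge> 0"
  then have "0 \<le> clip K s * (s - clip K s)"
    by (auto simp: clip_def max_def min_def zero_le_mult_iff)
  then show ?thesis by (simp add: power2_eq_square algebra_simps)
qed

section \<open>Window sums, their variances and the block construction\<close>

locale partial_sums = filtered_prob_space +
  fixes Y :: "nat \<Rightarrow> 'a \<Rightarrow> real" and v :: "nat \<Rightarrow> real"
  assumes Y_F: "\<And>i. Y i \<in> borel_measurable (F (Suc i))"
    and Y_L2: "\<And>i. in_L2 M (Y i)"
    and sum_variance: "\<And>s l. expectation (\<lambda>x. (\<Sum>i<l. Y (s + i) x)\<^sup>2) = v l"
begin

text \<open>All windows of length \<open>l\<close> have second moment \<open>v l\<close>, whatever
  their start \<open>s\<close>; this is the form in which stationarity enters here.
  \<open>W s l\<close> is later conditioned on \<open>F s\<close>.\<close>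

definition W :: "nat \<Rightarrow> nat \<Rightarrow> 'a \<Rightarrow> real" where
  "W s l x = (\<Sum>i<l. Y (s + i) x)"

lemma W_L2: "in_L2 M (W s l)" unfolding W_def[abs_def] by (rule in_L2_sum[OF Y_L2])

lemma W_F: "W s l \<in> borel_measurable (F (s + l))"
  unfolding W_def[abs_def] by (intro borel_measurable_sum) (auto intro: measurable_F_mono[OF Y_F])

lemma W_M [measurable]: "W s l \<in> borel_measurable M" using measurable_F[OF W_F] .

lemma W_var: "expectation (\<lambda>x. (W s l x)\<^sup>2) = v l" unfolding W_def by (rule sum_variance)

lemma W_add: "W s (k + l) x = W s k x + W (s + k) l x"
  unfolding W_def sum.nat_group
  by (simp add: lessThan_atLeast0 sum.atLeastLessThan_concat[of 0 k "k + l", symmetric]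
      sum.atLeastLessThan_shift_0[of _ k "k + l"] add.assoc)

lemma W_blocks: "W 0 (j * m) x = (\<Sum>j'<j. W (j' * m) m x)"
  by (induction j) (simp_all add: W_add add.commute[of m], simp add: W_def)

lemma v_nonneg: "v l \<ge> 0" 
proof -
  have "0 \<le> expectation (\<lambda>x. (W 0 l x)\<^sup>2)" by simp
  then show ?thesis by (simp only: W_var)
qed

text \<open>Removing from the second window its conditional mean leaves a part orthogonal to the
  first window. Hence \<open>v l\<close> is at most the second moment of \<open>W 0 (l + b)\<close>
  minus that conditional mean.\<close>

lemma v_le_v_add:
  "v l \<le> 2 * v (l + b) + 2 * expectation (\<lambda>x. (CE l (W l b) x)\<^sup>2)"
proof -
  let ?p = "CE l (W l b)"
  have p: "in_L2 M ?p" by (rule CE_L2[OF W_L2])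
  let ?q = "\<lambda>x. W l b x - ?p x"
  have q: "in_L2 M ?q" by (rule in_L2_diff[OF W_L2 p])
  have q0: "AE x in M. CE l ?q x = 0" by (rule CE_residual_zero[OF in_L2_integrable[OF W_L2]]) simp
  have "expectation (\<lambda>x. W 0 l x * ?q x) = 0"
    by (rule orthogonal_zero[OF W_L2 q _ q0]) (use W_F[of 0 l] in simp)
  then have "v l + expectation (\<lambda>x. (?q x)\<^sup>2) = expectation (\<lambda>x. (W 0 l x)\<^sup>2) + expectation (\<lambda>x. (?q x)\<^sup>2) + 2 * expectation (\<lambda>x. W 0 l x * ?q x)"
    by (simp add: W_var)
  also have "\<dots> = expectation (\<lambda>x. (W 0 l x)\<^sup>2 + (?q x)\<^sup>2 + 2 * (W 0 l x * ?q x))"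
    using W_L2[of 0 l] q in_L2_mult[OF W_L2 q, of 0 l] by (simp add: in_L2_def)
  also have "\<dots> = expectation (\<lambda>x. (W 0 (l + b) x + - 1 * ?p x)\<^sup>2)"
    unfolding W_add[of 0 l b] add_0
    by (rule Bochner_Integration.integral_cong) (auto simp: power2_eq_square algebra_simps)
  also have "\<dots> \<le> 2 * expectation (\<lambda>x. (W 0 (l + b) x)\<^sup>2) + 2 * expectation (\<lambda>x. (- 1 * ?p x)\<^sup>2)"
    by (rule expectation_sum_sq_le[OF W_L2 in_L2_cmult[OF p]])
  finally have "v l + expectation (\<lambda>x. (?q x)\<^sup>2) \<le> 2 * v (l + b) + 2 * expectation (\<lambda>x. (?p x)\<^sup>2)"
    by (simp add: W_var)
  moreover have "0 \<le> expectation (\<lambda>x. (?q x)\<^sup>2)" by simp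
  ultimately show ?thesis by linarith
qed

lemma v_tail: "v b \<le> 2 * v (l + b) + 2 * v l"
proof -
  have "v b = expectation (\<lambda>x. (W 0 (l + b) x + - 1 * W 0 l x)\<^sup>2)"
    unfolding W_add[of 0 l b] add_0 by (simp add: W_var)
  also have "\<dots> \<le> 2 * expectation (\<lambda>x. (W 0 (l + b) x)\<^sup>2) + 2 * expectation (\<lambda>x. (- 1 * W 0 l x)\<^sup>2)"
    by (rule expectation_sum_sq_le[OF W_L2 in_L2_cmult[OF W_L2]])
  finally show ?thesis by (simp add: W_var)
qed

text \<open>The variances need not increase, yet the error inside a block involves
  \<open>v i\<close> for all \<open>i \<le> m\<close>. Negligible conditional means give
  monotonicity up to a factor and an additive constant, which is harmless once \<open>v\<close>
  diverges.\<close>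

lemma v_almost_mono:
  assumes "\<And>\<delta>. \<delta> > 0 \<Longrightarrow> \<forall>\<^sub>F l in sequentially. \<forall>s. expectation (\<lambda>x. (CE s (W s l) x)\<^sup>2) \<le> \<delta> * v l"
  obtains C where "\<And>l n. l \<le> n \<Longrightarrow> v l \<le> 5 * v n + C"
proof -
  \<comment> \<open>With 1/8, \<open>v_le_v_add\<close> and \<open>v_tail\<close> combine to
    \<open>v l \<le> 2 * v n + 1/4 * (2 * v n + 2 * v l)\<close>; absorbing half of
    \<open>v l\<close> on the left yields the factor 5.\<close>
  obtain l0 where l0: "\<And>l s. l \<ge> l0 \<Longrightarrow> expectation (\<lambda>x. (CE s (W s l) x)\<^sup>2) \<le> 1/8 * v l"
    using assms[of "1/8"] by (auto simp: eventually_sequentially)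
  \<comment> \<open>The sum over \<open>b < l0\<close> covers the finitely many short gaps
    \<open>n - l\<close>, about which the eventual bound says nothing.\<close>
  have "v l \<le> 5 * v n + 2 * (\<Sum>b<l0. v b)" if "l \<le> n" for l n
  proof (cases "n - l \<ge> l0")
    case True
    have "0 \<le> (\<Sum>b<l0. v b)" by (simp add: sum_nonneg v_nonneg)
    then show ?thesis
      using l0[OF True, of l] v_le_v_add[of l "n - l"] v_tail[of "n - l" l] that by simp
  next
    case False
    then have "v (n - l) \<le> (\<Sum>b<l0. v b)" by (intro member_le_sum) (auto simp: v_nonneg)
    moreover have "expectation (\<lambda>x. (CE l (W l (n - l)) x)\<^sup>2) \<le> v (n - l)"
      using CE_L2_le[OF W_L2, of l l "n - l"] by (simp add: W_var)
    ultimately show ?thesis using v_le_v_add[of l "n - l"] v_nonneg[of n] that by simp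
  qed
  then show thesis by (rule that)
qed

text \<open>Here \<open>c\<close> stands for the normal second moment of \<open>clip K\<close>, and
  \<open>e\<close> for all deviations from normality. The error consists of clipped-off tails, which
  are orthogonal across blocks and cost \<open>1 - c + e\<close> per block, and of conditional block
  means, which are not: by Cauchy-Schwarz \<open>N\<close> of them cost
  \<open>N\<^sup>2 * e * v m\<close>, so \<open>e\<close> has to be small compared with
  \<open>1 / N\<close>. Times inside a block and the incomplete last block add a few multiples of
  \<open>v m\<close>, a fraction of order \<open>1 / N\<close> of the total. This explains
  \<open>b1\<close>. Condition \<open>b2\<close> makes the increments small and brings the two kinds
  of conditional variance together.\<close>

lemma block_approximation:
  assumes m: "m > 0" and N: "N > 0" and n: "n = N * m + r" "r \<le> m"
    and vm: "v m > 0" and K: "K > 0" and c: "0 \<le> c" "c \<le> 1" and e: "e \<ge> 0"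
  defines "\<psi> \<equiv> \<lambda>s x. sqrt (v m) * clip K (W s m x / sqrt (v m))"
  assumes a1: "\<And>s. expectation (\<lambda>x. \<bar>CE s (\<lambda>x. (\<psi> s x)\<^sup>2) x - c * v m\<bar>) \<le> e * v m"
    and a2: "\<And>s. expectation (\<lambda>x. (CE s (\<psi> s) x)\<^sup>2) \<le> e * v m"
    and a3: "\<And>s. expectation (\<lambda>x. (W s m x - \<psi> s x)\<^sup>2) \<le> (1 - c + e) * v m"
    and a4: "\<And>s. expectation (\<lambda>x. (CE s (W s m) x)\<^sup>2) \<le> e * v m"
    and a5: "\<And>i. i \<le> m \<Longrightarrow> v i \<le> 6 * v m"
    and \<theta>: "0 < \<theta>" "\<theta> \<le> 1/10"
    and b1: "6 * (1 - c) + 12 * N * e + 21 / N \<le> \<theta>\<^sup>2"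
    and b2: "80 * K\<^sup>2 \<le> (\<theta>\<^sup>2)\<^sup>2 * N"
  obtains d where "\<And>k. d k \<in> borel_measurable (F (Suc k))" "\<And>k. in_L2 M (d k)"
    "\<And>k. AE x in M. CE k (d k) x = 0" "\<And>k. AE x in M. \<bar>d k x\<bar> \<le> \<theta>\<^sup>2 * sqrt (v n)"
    "\<And>k. k \<le> n \<Longrightarrow> expectation (\<lambda>x. (W 0 k x - (\<Sum>i<k. d i x))\<^sup>2) \<le> 2 * \<theta>\<^sup>2 * v n"
    "expectation (\<lambda>x. \<bar>(\<Sum>k<n. CE k (\<lambda>x. (d k x)\<^sup>2) x) - v n\<bar>) \<le> 14 * \<theta> * v n"
proof -
  define \<tau> where "\<tau> = sqrt (v m)"
  have \<tau>: "\<tau> > 0" "\<tau>\<^sup>2 = v m" using vm by (auto simp: \<tau>_def)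
  interpret B: block_martingale M F m N "\<lambda>j. \<psi> (j * m)" "K * \<tau>"
  proof
    show "\<psi> (j * m) \<in> borel_measurable (F (Suc j * m))" for j
      unfolding \<psi>_def using W_F[of "j * m" m] by (simp add: add.commute)
    show "\<bar>\<psi> (j * m) x\<bar> \<le> K * \<tau>" for j x
      using abs_clip_le[of K] K \<tau> by (simp add: \<psi>_def \<tau>_def[symmetric] abs_mult mult.commute)
  qed fact
  interpret G: filtered_prob_space M "\<lambda>j. F (j * m)"
    by unfold_locales (use F_subalgebra F_mono in auto)
  \<comment> \<open>\<open>T\<close> stands in for \<open>v n\<close> until the two are shown to be
    close in \<open>vn\<close>.\<close>
  define T where "T = N * v m"
  have T: "T > 0" using N vm by (simp add: T_def)
  have \<psi>2: "expectation (\<lambda>x. (\<psi> (j * m) x)\<^sup>2) \<le> v m" for j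
  proof -
    have "expectation (\<lambda>x. (\<psi> (j * m) x)\<^sup>2) \<le> expectation (\<lambda>x. (W (j * m) m x)\<^sup>2)"
    proof (rule integral_mono)
      fix x
      have "(\<psi> (j * m) x)\<^sup>2 \<le> \<tau>\<^sup>2 * (W (j * m) m x / \<tau>)\<^sup>2"
        unfolding \<psi>_def \<tau>_def[symmetric] power_mult_distrib using K by (intro mult_left_mono clip_sq_le) auto
      then show "(\<psi> (j * m) x)\<^sup>2 \<le> (W (j * m) m x)\<^sup>2" using \<tau> vm by (simp add: power_divide)
    qed (use B.\<psi>_L2 W_L2 in \<open>auto simp: in_L2_def\<close>)
    then show ?thesis by (simp add: W_var)
  qed
  have bmE: "expectation (\<lambda>x. (B.bm j x)\<^sup>2) = expectation (\<lambda>x. (\<psi> (j * m) x)\<^sup>2) - expectation (\<lambda>x. (CE (j * m) (\<psi> (j * m)) x)\<^sup>2)" for j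
  proof -
    have "expectation (\<lambda>x. (B.bm j x)\<^sup>2) = expectation (\<lambda>x. (\<psi> (j * m) x - CE (j * m) (\<psi> (j * m)) x)\<^sup>2)"
    proof (rule integral_cong_AE)
      show "AE x in M. (B.bm j x)\<^sup>2 = (\<psi> (j * m) x - CE (j * m) (\<psi> (j * m)) x)\<^sup>2"
        using B.bm_AE[of j] by eventually_elim simp
    qed auto
    then show ?thesis by (simp add: CE_residual_L2[OF B.\<psi>_L2])
  qed
  have bm_le: "expectation (\<lambda>x. (B.bm j x)\<^sup>2) \<le> v m" for j
  proof -
    have "0 \<le> expectation (\<lambda>x. (CE (j * m) (\<psi> (j * m)) x)\<^sup>2)" by simp
    then show ?thesis using bmE[of j] \<psi>2[of j] by linarith
  qed
  have \<psi>sq: "integrable M (\<lambda>x. (\<psi> (j * m) x)\<^sup>2)" for j using B.\<psi>_L2 by (simp add: in_L2_def)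
  have bm_near: "\<bar>expectation (\<lambda>x. (B.bm j x)\<^sup>2) - v m\<bar> \<le> (1 - c + 2 * e) * v m" for j
  proof -
    have "\<bar>expectation (\<lambda>x. (\<psi> (j * m) x)\<^sup>2) - c * v m\<bar> = \<bar>expectation (\<lambda>x. CE (j * m) (\<lambda>x. (\<psi> (j * m) x)\<^sup>2) x - c * v m)\<bar>"
      using F.real_cond_exp_int[OF \<psi>sq] by (simp add: prob_space)
    also have "\<dots> \<le> expectation (\<lambda>x. \<bar>CE (j * m) (\<lambda>x. (\<psi> (j * m) x)\<^sup>2) x - c * v m\<bar>)"
      using integral_norm_bound[of M "\<lambda>x. CE (j * m) (\<lambda>x. (\<psi> (j * m) x)\<^sup>2) x - c * v m"] by simp
    also have "\<dots> \<le> e * v m" by (rule a1)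
    finally have "\<bar>expectation (\<lambda>x. (\<psi> (j * m) x)\<^sup>2) - c * v m\<bar> \<le> e * v m" .
    moreover have "0 \<le> expectation (\<lambda>x. (CE (j * m) (\<psi> (j * m)) x)\<^sup>2)" by simp
    ultimately show ?thesis using bmE[of j] a2[of "j * m"] bm_le[of j] by (simp add: algebra_simps)
  qed
  have sum_near: "\<bar>(\<Sum>j<N. expectation (\<lambda>x. (B.bm j x)\<^sup>2)) - T\<bar> \<le> (1 - c + 2 * e) * T"
  proof -
    have "\<bar>(\<Sum>j<N. expectation (\<lambda>x. (B.bm j x)\<^sup>2)) - T\<bar> = \<bar>\<Sum>j<N. expectation (\<lambda>x. (B.bm j x)\<^sup>2) - v m\<bar>"
      by (simp add: sum_subtractf T_def)
    also have "\<dots> \<le> (\<Sum>j<N. (1 - c + 2 * e) * v m)"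
      using bm_near by (intro order_trans[OF sum_abs] sum_mono)
    finally show ?thesis by (simp add: T_def mult_ac)
  qed
  have sum_le: "(\<Sum>j<N. expectation (\<lambda>x. (B.bm j x)\<^sup>2)) \<le> T"
    using sum_mono[of "{..<N}" "\<lambda>j. expectation (\<lambda>x. (B.bm j x)\<^sup>2)" "\<lambda>_. v m"] bm_le by (simp add: T_def)
  \<comment> \<open>Given the block start, the variance of the clipped sum is its conditional second
    moment minus its squared conditional mean. By \<open>a1\<close> and \<open>a2\<close> these are
    close to \<open>c * v m\<close> and to 0.\<close>
  have CV: "expectation (\<lambda>x. \<bar>CE (j * m) (\<lambda>x. (B.bm j x)\<^sup>2) x - v m\<bar>) \<le> (1 - c + 2 * e) * v m"
    and CVi: "integrable M (\<lambda>x. CE (j * m) (\<lambda>x. (B.bm j x)\<^sup>2) x - v m)" for j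
  proof -
    let ?f = "\<psi> (j * m)" and ?k = "j * m"
    let ?p = "CE ?k ?f"
    have p2: "in_L2 M ?p" by (rule CE_L2[OF B.\<psi>_L2])
    have bm2: "integrable M (\<lambda>x. (B.bm j x)\<^sup>2)" using B.bm_L2 by (simp add: in_L2_def)
    have pf: "integrable M (\<lambda>x. ?p x * ?f x)" by (rule in_L2_mult[OF p2 B.\<psi>_L2])
    have pp: "integrable M (\<lambda>x. (?p x)\<^sup>2)" using p2 by (simp add: in_L2_def)
    have "AE x in M. CE ?k (\<lambda>x. (B.bm j x)\<^sup>2) x = CE ?k (\<lambda>x. (?f x)\<^sup>2 + ((?p x)\<^sup>2 - 2 * (?p x * ?f x))) x"
    proof (rule F.real_cond_exp_cong)
      show "AE x in M. (B.bm j x)\<^sup>2 = (?f x)\<^sup>2 + ((?p x)\<^sup>2 - 2 * (?p x * ?f x))"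
        using B.bm_AE[of j] by eventually_elim (simp add: power2_diff)
    qed auto
    moreover have "AE x in M. CE ?k (\<lambda>x. (?f x)\<^sup>2 + ((?p x)\<^sup>2 - 2 * (?p x * ?f x))) x
        = CE ?k (\<lambda>x. (?f x)\<^sup>2) x + CE ?k (\<lambda>x. (?p x)\<^sup>2 - 2 * (?p x * ?f x)) x"
      by (rule F.real_cond_exp_add) (use pf pp \<psi>sq in auto)
    moreover have "AE x in M. CE ?k (\<lambda>x. (?p x)\<^sup>2 - 2 * (?p x * ?f x)) x
        = CE ?k (\<lambda>x. (?p x)\<^sup>2) x - CE ?k (\<lambda>x. 2 * (?p x * ?f x)) x"
      by (rule F.real_cond_exp_diff) (use pf pp in auto)
    moreover have "AE x in M. CE ?k (\<lambda>x. (?p x)\<^sup>2) x = (?p x)\<^sup>2"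
      by (rule F.real_cond_exp_F_meas[OF pp]) simp
    moreover have "AE x in M. CE ?k (\<lambda>x. 2 * (?p x * ?f x)) x = 2 * CE ?k (\<lambda>x. ?p x * ?f x) x"
      by (rule F.real_cond_exp_cmult[OF pf])
    moreover have "AE x in M. CE ?k (\<lambda>x. ?p x * ?f x) x = ?p x * ?p x"
      by (rule F.real_cond_exp_mult[OF _ _ pf]) auto
    ultimately have ae: "AE x in M. CE ?k (\<lambda>x. (B.bm j x)\<^sup>2) x = CE ?k (\<lambda>x. (?f x)\<^sup>2) x - (?p x)\<^sup>2"
      by eventually_elim (simp add: power2_eq_square)
    show CVi: "integrable M (\<lambda>x. CE (j * m) (\<lambda>x. (B.bm j x)\<^sup>2) x - v m)"
      using F.real_cond_exp_int(1)[OF bm2] by simp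
    have fi: "integrable M (\<lambda>x. \<bar>CE ?k (\<lambda>x. (?f x)\<^sup>2) x - c * v m\<bar>)"
      using F.real_cond_exp_int(1)[OF \<psi>sq] by simp
    have "expectation (\<lambda>x. \<bar>CE ?k (\<lambda>x. (B.bm j x)\<^sup>2) x - v m\<bar>) \<le>
        expectation (\<lambda>x. \<bar>CE ?k (\<lambda>x. (?f x)\<^sup>2) x - c * v m\<bar> + (?p x)\<^sup>2 + (1 - c) * v m)"
    proof (rule integral_mono_AE)
      show "AE x in M. \<bar>CE ?k (\<lambda>x. (B.bm j x)\<^sup>2) x - v m\<bar> \<le>
        \<bar>CE ?k (\<lambda>x. (?f x)\<^sup>2) x - c * v m\<bar> + (?p x)\<^sup>2 + (1 - c) * v m"
        using ae
      proof eventually_elim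
        case (elim x)
        have "0 \<le> (?p x)\<^sup>2" "0 \<le> (1 - c) * v m" "(1 - c) * v m = v m - c * v m"
          using c vm by (auto simp: left_diff_distrib)
        then show ?case unfolding elim by linarith
      qed
    qed (use fi pp CVi in auto)
    also have "\<dots> = expectation (\<lambda>x. \<bar>CE ?k (\<lambda>x. (?f x)\<^sup>2) x - c * v m\<bar>) + expectation (\<lambda>x. (?p x)\<^sup>2) + (1 - c) * v m"
      using fi pp by (simp add: prob_space)
    also have "\<dots> \<le> e * v m + e * v m + (1 - c) * v m"
      by (intro add_mono a1 a2 order_refl)
    finally show "expectation (\<lambda>x. \<bar>CE ?k (\<lambda>x. (B.bm j x)\<^sup>2) x - v m\<bar>) \<le> (1 - c + 2 * e) * v m"
      by (simp add: algebra_simps)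
  qed
  let ?V = "\<lambda>x. \<Sum>k<N * m. CE k (\<lambda>x. (B.md k x)\<^sup>2) x"
  let ?U = "\<lambda>x. \<Sum>j<N. CE (j * m) (\<lambda>x. (B.bm j x)\<^sup>2) x"
  have md2: "integrable M (\<lambda>x. (B.md k x)\<^sup>2)" for k using B.md_L2 by (simp add: in_L2_def)
  have VU: "expectation (\<lambda>x. \<bar>?V x - ?U x\<bar>) \<le> \<theta>\<^sup>2 * T"
  proof (rule expectation_abs_le[OF B.conditional_variance_blocks(1)])
    have "expectation (\<lambda>x. (?V x - ?U x)\<^sup>2) \<le> 80 * (K * \<tau>)\<^sup>2 * (\<Sum>j<N. expectation (\<lambda>x. (B.bm j x)\<^sup>2))"
      by (rule B.conditional_variance_blocks(2))
    also have "\<dots> \<le> 80 * (K * \<tau>)\<^sup>2 * T" using sum_le by (intro mult_left_mono) auto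
    also have "\<dots> = (80 * K\<^sup>2) * (v m * T)" by (simp add: power_mult_distrib \<tau>)
    also have "\<dots> \<le> ((\<theta>\<^sup>2)\<^sup>2 * N) * (v m * T)" using b2 T vm by (intro mult_right_mono) auto
    also have "\<dots> = (\<theta>\<^sup>2 * T)\<^sup>2" by (simp add: T_def power2_eq_square)
    finally show "expectation (\<lambda>x. (?V x - ?U x)\<^sup>2) \<le> (\<theta>\<^sup>2 * T)\<^sup>2" .
  qed (use T in simp)
  have UT: "expectation (\<lambda>x. \<bar>?U x - T\<bar>) \<le> (1 - c + 2 * e) * T"
  proof -
    have "expectation (\<lambda>x. \<bar>?U x - T\<bar>) \<le> expectation (\<lambda>x. \<Sum>j<N. \<bar>CE (j * m) (\<lambda>x. (B.bm j x)\<^sup>2) x - v m\<bar>)"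
    proof (rule integral_mono)
      fix x
      have "?U x - T = (\<Sum>j<N. CE (j * m) (\<lambda>x. (B.bm j x)\<^sup>2) x - v m)" by (simp add: sum_subtractf T_def)
      then show "\<bar>?U x - T\<bar> \<le> (\<Sum>j<N. \<bar>CE (j * m) (\<lambda>x. (B.bm j x)\<^sup>2) x - v m\<bar>)" by (simp add: sum_abs)
    next
      have "integrable M (\<lambda>x. CE (j * m) (\<lambda>x. (B.bm j x)\<^sup>2) x)" for j
        using B.bm_L2 by (intro F.real_cond_exp_int) (simp add: in_L2_def)
      then show "integrable M (\<lambda>x. \<bar>?U x - T\<bar>)" by simp
    qed (use CVi in auto)
    also have "\<dots> = (\<Sum>j<N. expectation (\<lambda>x. \<bar>CE (j * m) (\<lambda>x. (B.bm j x)\<^sup>2) x - v m\<bar>))"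
      using CVi by simp
    also have "\<dots> \<le> (\<Sum>j<N. (1 - c + 2 * e) * v m)" by (intro sum_mono CV)
    finally show ?thesis by (simp add: T_def mult_ac)
  qed
  define R where "R k x = W 0 k x - (\<Sum>i<k. B.md i x)" for k x
  have RL2: "in_L2 M (R k)" for k
    unfolding R_def[abs_def] by (rule in_L2_diff[OF W_L2 in_L2_sum[OF B.md_L2]])
  have Rblock: "expectation (\<lambda>x. (R (j * m) x)\<^sup>2) \<le> (2 * (1 - c + e) + 2 * N * e) * T" if j: "j \<le> N" for j
  proof -
    \<comment> \<open>\<open>u\<close> is the centred clipped-off tail of a block and
      \<open>w\<close> the conditional mean of the whole block; up to a null set the block sum
      differs from its martingale part \<open>bm\<close> by their sum.\<close>
    define u where "u j x = (W (j * m) m x - \<psi> (j * m) x) - CE (j * m) (\<lambda>x. W (j * m) m x - \<psi> (j * m) x) x" for j x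
    define w where "w j = CE (j * m) (W (j * m) m)" for j
    have res: "in_L2 M (\<lambda>x. W (j * m) m x - \<psi> (j * m) x)" for j by (rule in_L2_diff[OF W_L2 B.\<psi>_L2])
    have u: "in_L2 M (u j)" for j unfolding u_def[abs_def] by (rule in_L2_diff[OF res CE_L2[OF res]])
    have w: "in_L2 M (w j)" for j unfolding w_def by (rule CE_L2[OF W_L2])
    have "AE x in M. W (j * m) m x - B.bm j x = u j x + w j x" for j
    proof -
      have "AE x in M. CE (j * m) (\<lambda>x. W (j * m) m x - \<psi> (j * m) x) x = w j x - CE (j * m) (\<psi> (j * m)) x"
        unfolding w_def by (rule F.real_cond_exp_diff) (use in_L2_integrable[OF W_L2] B.\<psi>_integrable in auto)
      then show ?thesis using B.bm_AE[of j] by eventually_elim (simp add: u_def)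
    qed
    then have "AE x in M. \<forall>j. W (j * m) m x - B.bm j x = u j x + w j x" by (simp add: AE_all_countable)
    then have ae: "AE x in M. R (j * m) x = (\<Sum>i<j. u i x) + (\<Sum>i<j. w i x)"
    proof eventually_elim
      case (elim x)
      have "R (j * m) x = (\<Sum>i<j. W (i * m) m x - B.bm i x)"
        by (simp add: R_def W_blocks B.sum_md[OF j] sum_subtractf)
      then show ?case using elim by (simp add: sum.distrib)
    qed
    have "expectation (\<lambda>x. (R (j * m) x)\<^sup>2) = expectation (\<lambda>x. ((\<Sum>i<j. u i x) + (\<Sum>i<j. w i x))\<^sup>2)"
    proof (rule integral_cong_AE)
      show "AE x in M. (R (j * m) x)\<^sup>2 = ((\<Sum>i<j. u i x) + (\<Sum>i<j. w i x))\<^sup>2"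
        using ae by eventually_elim simp
    qed (use RL2[of "j * m"] in_L2_add[OF in_L2_sum[of "{..<j}" M u, OF u] in_L2_sum[of "{..<j}" M w, OF w]]
        in \<open>auto simp: in_L2_def\<close>)
    also have "\<dots> \<le> 2 * expectation (\<lambda>x. (\<Sum>i<j. u i x)\<^sup>2) + 2 * expectation (\<lambda>x. (\<Sum>i<j. w i x)\<^sup>2)"
      by (rule expectation_sum_sq_le) (use u w in \<open>auto intro: in_L2_sum\<close>)
    also have "expectation (\<lambda>x. (\<Sum>i<j. u i x)\<^sup>2) = (\<Sum>i<j. expectation (\<lambda>x. (u i x)\<^sup>2))"
    proof (rule G.orthogonal_sum[OF u])
      show "u i \<in> borel_measurable (F (Suc i * m))" for i
      proof -
        have "W (i * m) m \<in> borel_measurable (F (Suc i * m))"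
          using W_F[of "i * m" m] by (simp add: add.commute)
        then show ?thesis
          unfolding u_def[abs_def] using B.\<psi>_meas CE_measurable[of "i * m" "Suc i * m"] by simp
      qed
      show "AE x in M. CE (i * m) (u i) x = 0" for i
        unfolding u_def[abs_def] by (rule CE_residual_zero[OF in_L2_integrable[OF res]]) simp
    qed
    also have "\<dots> \<le> (\<Sum>i<j. (1 - c + e) * v m)"
    proof (rule sum_mono)
      fix i
      have "expectation (\<lambda>x. (u i x)\<^sup>2) \<le> expectation (\<lambda>x. (W (i * m) m x - \<psi> (i * m) x)\<^sup>2)"
        unfolding u_def by (rule CE_residual_L2_le[OF res])
      then show "expectation (\<lambda>x. (u i x)\<^sup>2) \<le> (1 - c + e) * v m" using a3[of "i * m"] by linarith
    qed
    also have "\<dots> \<le> (1 - c + e) * T"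
      using mult_right_mono[of "real j" "real N" "(1 - c + e) * v m"] j c e vm by (simp add: T_def mult_ac)
    \<comment> \<open>The \<open>w i\<close> are not centred given the past, so they are bounded
      with the factor \<open>card\<close>.\<close>
    also have "expectation (\<lambda>x. (\<Sum>i<j. w i x)\<^sup>2) \<le> card {..<j} * (\<Sum>i<j. expectation (\<lambda>x. (w i x)\<^sup>2))"
      by (rule expectation_sum_sq_le_card) (use w in auto)
    also have "\<dots> \<le> card {..<j} * (\<Sum>i<j. e * v m)"
      unfolding w_def using a4 by (intro mult_left_mono sum_mono) auto
    also have "\<dots> = j * j * (e * v m)" by simp
    also have "\<dots> \<le> N * N * (e * v m)"
    proof (rule mult_right_mono)
      show "real (j * j) \<le> real (N * N)" using j by (simp only: of_nat_le_iff mult_le_mono)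
    qed (use e vm in simp)
    also have "\<dots> = N * e * T" by (simp add: T_def)
    finally show ?thesis by (simp add: algebra_simps)
  qed
  \<comment> \<open>Three terms, hence a factor 3, contribute at a general time: the error at the
    last block boundary, the window since then (at most \<open>6 * v m\<close>) and the martingale
    since then (at most \<open>v m\<close>). So 6 is \<open>3 * 2\<close> and 21 is
    \<open>3 * 7\<close>; the 12 absorbs \<open>6 * e\<close> by means of
    \<open>N \<ge> 1\<close>.\<close>
  define \<kappa> where "\<kappa> = 6 * (1 - c) + 12 * N * e + 21 / N"
  have Rall: "expectation (\<lambda>x. (R k x)\<^sup>2) \<le> \<kappa> * T" if k: "k \<le> n" for k
  proof -
    \<comment> \<open>\<open>j = N\<close> is allowed and covers the incomplete last block, where
      the martingale no longer moves.\<close>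
    obtain j i where ji: "k = j * m + i" "j \<le> N" "i \<le> m"
    proof (cases "k \<le> N * m")
      case True
      then have "k div m \<le> N" using m by (metis div_le_mono nonzero_mult_div_cancel_right not_gr_zero)
      then show thesis using that[of "k div m" "k mod m"] m by (simp add: less_imp_le)
    next
      case False
      then show thesis using that[of N "k - N * m"] n k by simp
    qed
    define q where "q x = (\<Sum>l<i. B.md (j * m + l) x)" for x
    have q: "in_L2 M q" unfolding q_def[abs_def] by (rule in_L2_sum[OF B.md_L2])
    have q2: "expectation (\<lambda>x. (q x)\<^sup>2) \<le> v m"
    proof (cases "j < N")
      case True
      have "expectation (\<lambda>x. (q x)\<^sup>2) = (\<Sum>l<i. expectation (\<lambda>x. (B.md (j * m + l) x)\<^sup>2))"
      proof -
        interpret H: filtered_prob_space M "\<lambda>l. F (j * m + l)"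
          by unfold_locales (use F_subalgebra F_mono in auto)
        show ?thesis unfolding q_def
          by (rule H.orthogonal_sum) (use B.md_L2 B.md_F B.md_zero in auto)
      qed
      also have "\<dots> \<le> (\<Sum>l<m. expectation (\<lambda>x. (B.md (j * m + l) x)\<^sup>2))"
        using ji by (intro sum_mono2) auto
      also have "\<dots> = expectation (\<lambda>x. (\<Sum>l<m. B.md (j * m + l) x)\<^sup>2)"
      proof -
        interpret H: filtered_prob_space M "\<lambda>l. F (j * m + l)"
          by unfold_locales (use F_subalgebra F_mono in auto)
        show ?thesis
          by (rule H.orthogonal_sum[symmetric]) (use B.md_L2 B.md_F B.md_zero in auto)
      qed
      also have "\<dots> = expectation (\<lambda>x. (B.bm j x)\<^sup>2)"
        using B.sum_md_block[OF True order_refl] by (simp add: B.bm_def[abs_def] add.commute)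
      finally show ?thesis using bm_le[of j] by linarith
    next
      case False
      then have "q x = 0" for x using ji by (simp add: q_def B.md_def)
      then show ?thesis by (simp add: v_nonneg)
    qed
    \<comment> \<open>The case distinction over three indices casts the decomposition as a sum, to
      which \<open>expectation_sum_sq_le_card\<close> applies.\<close>
    have Rk: "R k x = (\<Sum>l<3. (if l = (0::nat) then R (j * m) x else if l = 1 then W (j * m) i x else - 1 * q x))" for x
    proof -
      have "(\<Sum>l<j * m + i. B.md l x) = (\<Sum>l<j * m. B.md l x) + q x"
        unfolding q_def by (induction i) auto
      then show ?thesis by (simp add: R_def ji(1) W_add numeral_3_eq_3)
    qed
    have "expectation (\<lambda>x. (R k x)\<^sup>2) \<le> card {..<3::nat} * (\<Sum>l<3. expectation (\<lambda>x. (if l = (0::nat) then R (j * m) x else if l = 1 then W (j * m) i x else - 1 * q x)\<^sup>2))"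
      unfolding Rk
    proof (rule expectation_sum_sq_le_card)
      fix l :: nat
      show "in_L2 M (\<lambda>x. if l = 0 then R (j * m) x else if l = 1 then W (j * m) i x else - 1 * q x)"
        using RL2 W_L2 in_L2_cmult[OF q, of "- 1"] by (cases "l = 0"; cases "l = 1") auto
    qed simp
    also have "\<dots> = 3 * (expectation (\<lambda>x. (R (j * m) x)\<^sup>2) + v i + expectation (\<lambda>x. (q x)\<^sup>2))"
      by (simp add: numeral_3_eq_3 W_var)
    also have "\<dots> \<le> 3 * ((2 * (1 - c + e) + 2 * N * e) * T + 6 * v m + v m)"
      by (intro mult_left_mono add_mono Rblock a5 q2 ji) auto
    also have "\<dots> = 6 * (1 - c) * T + (6 * e + 6 * N * e) * T + 21 * v m" by (simp add: algebra_simps)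
    also have "\<dots> \<le> 6 * (1 - c) * T + 12 * N * e * T + 21 / N * T"
    proof (intro add_mono order_refl mult_right_mono)
      have "e * 1 \<le> e * N" using N e by (intro mult_left_mono) auto
      then show "6 * e + 6 * N * e \<le> 12 * N * e" by (simp add: algebra_simps)
      show "21 * v m \<le> 21 / N * T" using N by (simp add: T_def)
    qed (use T in auto)
    finally show ?thesis by (simp add: \<kappa>_def algebra_simps)
  qed
  have \<kappa>: "0 \<le> \<kappa>" "\<kappa> \<le> \<theta>\<^sup>2" using b1 c e by (auto simp: \<kappa>_def)
  have ce: "1 - c + 2 * e \<le> \<theta>\<^sup>2"
  proof -
    define y z where "y = e * real N" and "z = 21 / real N"
    have "6 * (1 - c) + 12 * y + z \<le> \<theta>\<^sup>2" using b1 by (simp add: y_def z_def mult_ac)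
    moreover have "e * 1 \<le> e * N" using N e by (intro mult_left_mono) auto
    then have "e \<le> y" by (simp add: y_def)
    moreover have "0 \<le> z" by (simp add: z_def)
    ultimately show ?thesis using c e by simp
  qed
  have \<theta>2: "\<theta>\<^sup>2 \<le> \<theta> / 10" using \<theta> by (simp add: power2_eq_square)
  have Mn: "expectation (\<lambda>x. (\<Sum>i<n. B.md i x)\<^sup>2) = (\<Sum>j<N. expectation (\<lambda>x. (B.bm j x)\<^sup>2))"
  proof -
    have "(\<Sum>i<n. B.md i x) = (\<Sum>i<N * m. B.md i x)" for x
      by (rule sum.mono_neutral_right) (auto simp: n B.md_def)
    then have "expectation (\<lambda>x. (\<Sum>i<n. B.md i x)\<^sup>2) = expectation (\<lambda>x. (\<Sum>i<N * m. B.md i x)\<^sup>2)" by simp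
    also have "\<dots> = (\<Sum>i<N * m. expectation (\<lambda>x. (B.md i x)\<^sup>2))"
      by (rule orthogonal_sum) (use B.md_L2 B.md_F B.md_zero in auto)
    finally show ?thesis by (simp add: B.sum_md_sq)
  qed
  \<comment> \<open>\<open>v n\<close> is the second moment of \<open>W 0 n\<close>, and
    \<open>T\<close> is nearly that of the martingale. The inequality with parameter \<theta> is
    applied in both directions. An error of \<theta>^2 times the factor
    \<open>1 + 1 / \<theta>\<close> is of order \<theta>, which is why \<open>b1\<close> asks for
    smallness \<theta>^2 while the conditional variances are only matched to order \<theta>.\<close>
  have vn: "\<bar>v n - T\<bar> \<le> 5 * \<theta> * T"
  proof -
    let ?Z = "\<lambda>x. \<Sum>i<n. B.md i x"
    have Z: "in_L2 M ?Z" by (rule in_L2_sum[OF B.md_L2])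
    have kT: "(1 + 1 / \<theta>) * expectation (\<lambda>x. (R n x)\<^sup>2) \<le> 2 * \<theta> * T"
    proof -
      have "(1 + 1 / \<theta>) * expectation (\<lambda>x. (R n x)\<^sup>2) \<le> (1 + 1 / \<theta>) * (\<theta>\<^sup>2 * T)"
        using Rall[of n] \<kappa> T \<theta> by (intro mult_left_mono) (auto intro: order_trans mult_right_mono)
      also have "\<dots> = (\<theta>\<^sup>2 + \<theta>) * T" using \<theta> by (simp add: field_simps power2_eq_square)
      also have "\<dots> \<le> 2 * \<theta> * T" using \<theta>2 \<theta> T by (intro mult_right_mono) auto
      finally show ?thesis .
    qed
    have Es: "\<bar>expectation (\<lambda>x. (?Z x)\<^sup>2) - T\<bar> \<le> \<theta>\<^sup>2 * T"
      unfolding Mn using sum_near ce T by (meson less_imp_le mult_right_mono order_trans)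
    have "v n = expectation (\<lambda>x. (?Z x + R n x)\<^sup>2)" by (simp add: R_def W_var)
    also have "\<dots> \<le> (1 + \<theta>) * expectation (\<lambda>x. (?Z x)\<^sup>2) + (1 + 1 / \<theta>) * expectation (\<lambda>x. (R n x)\<^sup>2)"
      by (rule expectation_sum_sq_le'[OF Z RL2 \<theta>(1)])
    also have "\<dots> \<le> (1 + \<theta>) * ((1 + \<theta>\<^sup>2) * T) + 2 * \<theta> * T"
      using Es kT \<theta> by (intro add_mono mult_left_mono) (auto simp: algebra_simps)
    also have "\<dots> \<le> (1 + 5 * \<theta>) * T"
    proof -
      have "\<theta> * \<theta>\<^sup>2 \<le> 1 * (\<theta> / 10)" using \<theta>2 \<theta> by (intro mult_mono) auto
      moreover have "(1 + \<theta>) * (1 + \<theta>\<^sup>2) + 2 * \<theta> = 1 + 3 * \<theta> + \<theta>\<^sup>2 + \<theta> * \<theta>\<^sup>2"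
        by (simp add: algebra_simps)
      ultimately have "(1 + \<theta>) * (1 + \<theta>\<^sup>2) + 2 * \<theta> \<le> 1 + 5 * \<theta>" using \<theta>2 \<theta> by linarith
      then show ?thesis using mult_right_mono[of "(1 + \<theta>) * (1 + \<theta>\<^sup>2) + 2 * \<theta>" "1 + 5 * \<theta>" T] T
        by (simp add: algebra_simps)
    qed
    finally have up: "v n \<le> (1 + 5 * \<theta>) * T" .
    have "expectation (\<lambda>x. (?Z x)\<^sup>2) = expectation (\<lambda>x. (W 0 n x + - 1 * R n x)\<^sup>2)" by (simp add: R_def)
    also have "\<dots> \<le> (1 + \<theta>) * expectation (\<lambda>x. (W 0 n x)\<^sup>2) + (1 + 1 / \<theta>) * expectation (\<lambda>x. (- 1 * R n x)\<^sup>2)"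
      by (rule expectation_sum_sq_le'[OF W_L2 in_L2_cmult[OF RL2] \<theta>(1)])
    also have "\<dots> \<le> (1 + \<theta>) * v n + 2 * \<theta> * T" using kT by (simp add: W_var)
    finally have "(1 - \<theta>\<^sup>2 - 2 * \<theta>) * T \<le> (1 + \<theta>) * v n" using Es by (simp add: algebra_simps)
    moreover have "(1 + \<theta>) * ((1 - 5 * \<theta>) * T) \<le> (1 - \<theta>\<^sup>2 - 2 * \<theta>) * T"
    proof -
      have "(1 + \<theta>) * (1 - 5 * \<theta>) \<le> 1 - \<theta>\<^sup>2 - 2 * \<theta>"
        using \<theta>2 \<theta> by (simp add: algebra_simps power2_eq_square)
      from mult_right_mono[OF this] show ?thesis using T by (simp add: mult.assoc)
    qed
    ultimately have "(1 + \<theta>) * ((1 - 5 * \<theta>) * T) \<le> (1 + \<theta>) * v n" by linarith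
    then have "(1 - 5 * \<theta>) * T \<le> v n" using \<theta> by simp
    then show ?thesis using up by (simp add: abs_le_iff algebra_simps)
  qed
  have T2: "T \<le> 2 * v n"
  proof -
    have "5 * \<theta> * T \<le> 1/2 * T" using \<theta> T by (intro mult_right_mono) auto
    then show ?thesis using vn by linarith
  qed
  have vn0: "v n > 0" using T2 T by linarith
  show thesis
  proof (rule that[of B.md])
    show "AE x in M. \<bar>B.md k x\<bar> \<le> \<theta>\<^sup>2 * sqrt (v n)" for k
    proof -
      have "(2 * (K * \<tau>))\<^sup>2 = 4 * K\<^sup>2 * v m" by (simp add: power_mult_distrib \<tau>)
      also have "\<dots> \<le> (\<theta>\<^sup>2)\<^sup>2 * N / 20 * v m" using b2 vm by (intro mult_right_mono) auto
      also have "\<dots> = (\<theta>\<^sup>2)\<^sup>2 * (T / 20)" by (simp add: T_def)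
      also have "\<dots> \<le> (\<theta>\<^sup>2)\<^sup>2 * v n" using T2 vn0 by (intro mult_left_mono) auto
      also have "\<dots> = (\<theta>\<^sup>2 * sqrt (v n))\<^sup>2" using vn0 by (simp add: power_mult_distrib)
      finally have "2 * (K * \<tau>) \<le> \<theta>\<^sup>2 * sqrt (v n)"
        by (rule power2_le_imp_le) (use vn0 in auto)
      with B.md_bound[of k] show ?thesis by (auto elim!: eventually_mono)
    qed
    show "expectation (\<lambda>x. (W 0 k x - (\<Sum>i<k. B.md i x))\<^sup>2) \<le> 2 * \<theta>\<^sup>2 * v n" if "k \<le> n" for k
    proof -
      have "expectation (\<lambda>x. (R k x)\<^sup>2) \<le> \<kappa> * T" by (rule Rall[OF that])
      also have "\<dots> \<le> \<theta>\<^sup>2 * (2 * v n)" using \<kappa> T T2 by (intro mult_mono) auto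
      finally show ?thesis by (simp add: R_def)
    qed
    \<comment> \<open>The martingale has no increments after time \<open>N * m\<close>, so extending
      the sum to \<open>n\<close> adds nothing.\<close>
    have "AE x in M. \<forall>k\<ge>N * m. CE k (\<lambda>x. (B.md k x)\<^sup>2) x = 0"
    proof -
      have "AE x in M. k \<ge> N * m \<longrightarrow> CE k (\<lambda>x. (B.md k x)\<^sup>2) x = 0" for k
        using F.real_cond_exp_F_meas[of "\<lambda>_. 0" k] by (cases "k \<ge> N * m") (auto simp: B.md_def[abs_def])
      then show ?thesis by (simp add: AE_all_countable)
    qed
    then have Veq: "AE x in M. (\<Sum>k<n. CE k (\<lambda>x. (B.md k x)\<^sup>2) x) = ?V x"
    proof eventually_elim
      case (elim x)
      show ?case by (rule sum.mono_neutral_right) (use elim in \<open>auto simp: n\<close>)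
    qed
    have Vi: "integrable M (CE k (\<lambda>x. (B.md k x)\<^sup>2))" for k by (rule F.real_cond_exp_int[OF md2])
    have Ui: "integrable M (\<lambda>x. CE (j * m) (\<lambda>x. (B.bm j x)\<^sup>2) x)" for j
      using B.bm_L2 by (intro F.real_cond_exp_int) (simp add: in_L2_def)
    have "expectation (\<lambda>x. \<bar>(\<Sum>k<n. CE k (\<lambda>x. (B.md k x)\<^sup>2) x) - v n\<bar>) \<le>
        expectation (\<lambda>x. \<bar>?V x - ?U x\<bar> + \<bar>?U x - T\<bar> + \<bar>v n - T\<bar>)"
    proof (rule integral_mono_AE)
      show "AE x in M. \<bar>(\<Sum>k<n. CE k (\<lambda>x. (B.md k x)\<^sup>2) x) - v n\<bar> \<le> \<bar>?V x - ?U x\<bar> + \<bar>?U x - T\<bar> + \<bar>v n - T\<bar>"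
        using Veq by eventually_elim linarith
    qed (use Vi Ui in auto)
    also have "\<dots> = expectation (\<lambda>x. \<bar>?V x - ?U x\<bar>) + expectation (\<lambda>x. \<bar>?U x - T\<bar>) + \<bar>v n - T\<bar>"
      using Vi Ui by (simp add: prob_space)
    also have "\<dots> \<le> \<theta>\<^sup>2 * T + \<theta>\<^sup>2 * T + 5 * \<theta> * T"
      using UT ce T by (intro add_mono VU vn) (meson less_imp_le mult_right_mono order_trans)
    also have "\<dots> \<le> 7 * \<theta> * T"
      using mult_right_mono[of "\<theta>\<^sup>2 + \<theta>\<^sup>2 + 5 * \<theta>" "7 * \<theta>" T] \<theta>2 \<theta> T by (simp add: algebra_simps)
    also have "\<dots> \<le> 7 * \<theta> * (2 * v n)" using T2 \<theta> by (intro mult_left_mono) auto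
    finally show "expectation (\<lambda>x. \<bar>(\<Sum>k<n. CE k (\<lambda>x. (B.md k x)\<^sup>2) x) - v n\<bar>) \<le> 14 * \<theta> * v n" by simp
  qed (use B.md_F B.md_L2 B.md_zero in auto)
qed

end

section \<open>Conditional asymptotic normality of partial sums\<close>

lemma open_upset_cases:
  fixes U :: "real set"
  assumes "open U" "\<And>x y. x \<in> U \<Longrightarrow> x \<le> y \<Longrightarrow> y \<in> U"
  shows "U = {} \<or> U = UNIV \<or> (\<exists>z. U = {z<..})"
proof (cases "U = {} \<or> U = UNIV")
  case False
  then obtain u w where uw: "u \<in> U" "w \<notin> U" by blast
  have bdd: "bdd_below U"
  proof (rule bdd_belowI)
    fix x assume "x \<in> U" then show "w \<le> x" using assms(2)[of x w] uw by force
  qed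
  have "U = {Inf U<..}"
  proof (intro equalityI subsetI)
    fix x assume x: "x \<in> U"
    obtain e where e: "e > 0" "ball x e \<subseteq> U" using assms(1) x open_contains_ball by blast
    then have "x - e/2 \<in> U" by (auto simp: dist_real_def subset_iff)
    then have "Inf U \<le> x - e/2" by (rule cInf_lower[OF _ bdd])
    then show "x \<in> {Inf U<..}" using e by simp
  next
    fix x assume "x \<in> {Inf U<..}"
    then obtain y where "y \<in> U" "y < x" using cInf_lessD[of U x] uw by auto
    then show "x \<in> U" using assms(2)[of y x] by simp
  qed
  then show ?thesis by blast
qed blast

text \<open>The number of \<open>i < p\<close> with \<open>i / p < y\<close> is the ceiling of
  \<open>p * y\<close>.\<close>

lemma layer_cake_approximation:
  fixes y :: real
  assumes "0 \<le> y" "y \<le> 1" "p > 0"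
  shows "\<bar>y - (1 / p) * (\<Sum>i<p. indicator {real i / p<..} y)\<bar> \<le> 1 / p"
proof -
  have "{i. i < p \<and> real i / p < y} = {..<nat \<lceil>p * y\<rceil>}"
  proof (intro equalityI subsetI)
    fix i assume "i \<in> {i. i < p \<and> real i / p < y}"
    then have "real i < p * y" using assms by (simp add: field_simps)
    then show "i \<in> {..<nat \<lceil>p * y\<rceil>}" by (simp add: zless_nat_eq_int_zless less_ceiling_iff)
  next
    fix i assume "i \<in> {..<nat \<lceil>p * y\<rceil>}"
    then have *: "real i < p * y" by (simp add: zless_nat_eq_int_zless less_ceiling_iff)
    also have "\<dots> \<le> real p * 1" using assms by (intro mult_left_mono) auto
    finally show "i \<in> {i. i < p \<and> real i / p < y}" using * assms by (simp add: field_simps)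
  qed
  moreover have "(\<Sum>i<p. indicator {real i / p<..} y) = real (card {i. i < p \<and> real i / p < y})"
    by (simp add: indicator_def sum.If_cases Int_def lessThan_def)
  ultimately have "(\<Sum>i<p. indicator {real i / p<..} y) = real (nat \<lceil>p * y\<rceil>)" by simp
  moreover have "real (nat \<lceil>p * y\<rceil>) \<ge> p * y" by (rule real_nat_ceiling_ge)
  moreover have "real (nat \<lceil>p * y\<rceil>) \<le> p * y + 1"
    using assms of_int_ceiling_le_add_one[of "p * y"] by (simp add: of_nat_nat)
  ultimately have "\<bar>p * y - (\<Sum>i<p. indicator {real i / p<..} y)\<bar> \<le> 1" by linarith
  then have "\<bar>p * y - (\<Sum>i<p. indicator {real i / p<..} y)\<bar> / p \<le> 1 / p" by (rule divide_right_mono) simp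
  moreover have "y - (1 / p) * (\<Sum>i<p. indicator {real i / p<..} y) = (p * y - (\<Sum>i<p. indicator {real i / p<..} y)) / p"
    using assms by (simp add: diff_divide_distrib)
  ultimately show ?thesis by simp
qed

section \<open>Moments of the clipped standard normal law\<close>

interpretation std_normal: real_distribution std_normal_distribution
  by (rule real_dist_normal_dist)

lemma std_normal_second_moment:
  "(\<integral>x. x\<^sup>2 \<partial>std_normal_distribution) = 1" "integrable std_normal_distribution (\<lambda>x. x\<^sup>2)"
  using std_normal_distribution_even_moments[of 1] by simp_all

lemma clip_minus: "K \<ge> 0 \<Longrightarrow> clip K (- x) = - clip K x"
  by (auto simp: clip_def max_def min_def)

lemma integral_clip_std_normal:
  assumes "K \<ge> 0" shows "(\<integral>x. clip K x \<partial>std_normal_distribution) = 0"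
proof -
  have eq: "(\<integral>x. clip K x \<partial>std_normal_distribution) = (\<integral>x. std_normal_density x * clip K x \<partial>lborel)"
    by (subst integral_density) (auto simp: normal_density_nonneg)
  also have "\<dots> = (\<integral>x. std_normal_density (- x) * clip K (- x) \<partial>lborel)"
    using lborel_integral_real_affine[of "- 1" "\<lambda>x. std_normal_density x * clip K x" 0] by simp
  also have "\<dots> = (\<integral>x. - (std_normal_density x * clip K x) \<partial>lborel)"
    using assms by (simp add: normal_density_def clip_minus)
  also have "\<dots> = - (\<integral>x. clip K x \<partial>std_normal_distribution)" unfolding eq by simp
  finally show ?thesis by simp
qed

lemma clip_sq_integral:
  assumes "K \<ge> 0"
  shows "0 \<le> (\<integral>x. (clip K x)\<^sup>2 \<partial>std_normal_distribution)" "(\<integral>x. (clip K x)\<^sup>2 \<partial>std_normal_distribution) \<le> 1"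
proof -
  have "(\<integral>x. (clip K x)\<^sup>2 \<partial>std_normal_distribution) \<le> (\<integral>x. x\<^sup>2 \<partial>std_normal_distribution)"
    by (rule integral_mono'[OF std_normal_second_moment(2) clip_sq_le[OF assms]]) simp
  then show "(\<integral>x. (clip K x)\<^sup>2 \<partial>std_normal_distribution) \<le> 1" by (simp add: std_normal_second_moment)
qed simp

lemma clip_sq_integral_tendsto:
  "(\<lambda>k. \<integral>x. (clip (real k) x)\<^sup>2 \<partial>std_normal_distribution) \<longlonglongrightarrow> 1"
proof -
  have "(\<lambda>k. \<integral>x. (clip (real k) x)\<^sup>2 \<partial>std_normal_distribution) \<longlonglongrightarrow> (\<integral>x. x\<^sup>2 \<partial>std_normal_distribution)"
  proof (rule integral_dominated_convergence[OF _ _ std_normal_second_moment(2)])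
    show "AE x in std_normal_distribution. (\<lambda>k. (clip (real k) x)\<^sup>2) \<longlonglongrightarrow> x\<^sup>2"
    proof (rule AE_I2)
      fix x :: real
      have "\<forall>\<^sub>F k in sequentially. (clip (real k) x)\<^sup>2 = x\<^sup>2"
        using eventually_ge_at_top[of "nat \<lceil>\<bar>x\<bar>\<rceil>"]
      proof eventually_elim
        case (elim k)
        then have "\<bar>x\<bar> \<le> k" by linarith
        then have "clip k x = x" by (auto simp: clip_def)
        then show ?case by simp
      qed
      then show "(\<lambda>k. (clip (real k) x)\<^sup>2) \<longlonglongrightarrow> x\<^sup>2" by (rule tendsto_eventually)
    qed
  qed (auto simp: clip_sq_le)
  then show ?thesis by (simp add: std_normal_second_moment)
qed

section \<open>From conditional distribution functions to clipped test functions\<close>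

locale normal_partial_sums = partial_sums +
  assumes v_lim: "filterlim v at_top sequentially"
    and normal: "\<And>z \<epsilon>. \<epsilon> > 0 \<Longrightarrow> \<forall>\<^sub>F l in sequentially. \<forall>s.
      expectation (\<lambda>x. \<bar>CE s (\<lambda>x. indicator {..z} (W s l x / sqrt (v l))) x - cdf std_normal_distribution z\<bar>) \<le> \<epsilon>"
begin

text \<open>The hypothesis \<open>normal\<close> puts the half-lines into this class of test
  functions. Closure under linear combinations and uniform limits then carries the convergence to
  \<open>clip K\<close> and its square, the functions the block construction needs.\<close>

definition cond_normal :: "(real \<Rightarrow> real) \<Rightarrow> bool" where
  "cond_normal g \<longleftrightarrow> g \<in> borel_measurable borel \<and> (\<exists>B. \<forall>s. \<bar>g s\<bar> \<le> B) \<and>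
    (\<forall>\<epsilon>>0. \<forall>\<^sub>F l in sequentially. \<forall>s.
      expectation (\<lambda>x. \<bar>CE s (\<lambda>x. g (W s l x / sqrt (v l))) x - (\<integral>y. g y \<partial>std_normal_distribution)\<bar>) \<le> \<epsilon>)"

lemma bounded_integrable:
  fixes g :: "real \<Rightarrow> real"
  assumes "g \<in> borel_measurable borel" "\<And>s. \<bar>g s\<bar> \<le> B"
  shows "integrable M (\<lambda>x. g (W s l x / r))" "integrable std_normal_distribution g"
    "integrable M (CE s (\<lambda>x. g (W s l x / r)))"
proof -
  show *: "integrable M (\<lambda>x. g (W s l x / r))"
    by (rule integrable_const_bound[where B = B]) (use assms in \<open>auto intro: measurable_compose[OF _ assms(1)]\<close>)
  show "integrable M (CE s (\<lambda>x. g (W s l x / r)))" by (rule F.real_cond_exp_int[OF *])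
  show "integrable std_normal_distribution g"
    by (rule std_normal.integrable_const_bound[where B = B]) (use assms in auto)
qed

lemma cond_normal_linear:
  assumes "cond_normal g" "cond_normal h" shows "cond_normal (\<lambda>s. a * g s + b * h s)"
  unfolding cond_normal_def
proof (intro conjI allI impI)
  obtain B C where B: "\<And>s. \<bar>g s\<bar> \<le> B" and C: "\<And>s. \<bar>h s\<bar> \<le> C" using assms by (auto simp: cond_normal_def)
  have [measurable]: "g \<in> borel_measurable borel" "h \<in> borel_measurable borel" using assms by (auto simp: cond_normal_def)
  show "(\<lambda>s. a * g s + b * h s) \<in> borel_measurable borel" by measurable
  have "\<bar>a * g s + b * h s\<bar> \<le> \<bar>a\<bar> * B + \<bar>b\<bar> * C" for s
    by (rule order_trans[OF abs_triangle_ineq]) (auto simp: abs_mult intro!: add_mono mult_left_mono B C)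
  then show "\<exists>B. \<forall>s. \<bar>a * g s + b * h s\<bar> \<le> B" by blast
  fix \<epsilon> :: real assume \<epsilon>: "\<epsilon> > 0"
  \<comment> \<open>The summand 1 keeps the denominator positive when both coefficients
    vanish.\<close>
  define \<delta> where "\<delta> = \<epsilon> / (\<bar>a\<bar> + \<bar>b\<bar> + 1)"
  have \<delta>: "\<delta> > 0" using \<epsilon> by (simp add: \<delta>_def)
  note gi = bounded_integrable[of g, OF _ B] and hi = bounded_integrable[of h, OF _ C]
  have "\<forall>\<^sub>F l in sequentially. \<forall>s. expectation (\<lambda>x. \<bar>CE s (\<lambda>x. g (W s l x / sqrt (v l))) x - (\<integral>y. g y \<partial>std_normal_distribution)\<bar>) \<le> \<delta>"
    "\<forall>\<^sub>F l in sequentially. \<forall>s. expectation (\<lambda>x. \<bar>CE s (\<lambda>x. h (W s l x / sqrt (v l))) x - (\<integral>y. h y \<partial>std_normal_distribution)\<bar>) \<le> \<delta>"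
    using assms \<delta> by (auto simp: cond_normal_def)
  then show "\<forall>\<^sub>F l in sequentially. \<forall>s. expectation (\<lambda>x. \<bar>CE s (\<lambda>x. a * g (W s l x / sqrt (v l)) + b * h (W s l x / sqrt (v l))) x - (\<integral>y. a * g y + b * h y \<partial>std_normal_distribution)\<bar>) \<le> \<epsilon>"
  proof eventually_elim
    case (elim l)
    show ?case
    proof
      fix s
      let ?g = "\<lambda>x. g (W s l x / sqrt (v l))" and ?h = "\<lambda>x. h (W s l x / sqrt (v l))"
      let ?Eg = "\<integral>y. g y \<partial>std_normal_distribution" and ?Eh = "\<integral>y. h y \<partial>std_normal_distribution"
      have "AE x in M. CE s (\<lambda>x. a * ?g x + b * ?h x) x = CE s (\<lambda>x. a * ?g x) x + CE s (\<lambda>x. b * ?h x) x"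
        by (rule F.real_cond_exp_add) (use gi(1) hi(1) in auto)
      moreover have "AE x in M. CE s (\<lambda>x. a * ?g x) x = a * CE s ?g x" by (rule F.real_cond_exp_cmult[OF gi(1)]) simp
      moreover have "AE x in M. CE s (\<lambda>x. b * ?h x) x = b * CE s ?h x" by (rule F.real_cond_exp_cmult[OF hi(1)]) simp
      ultimately have ae: "AE x in M. CE s (\<lambda>x. a * ?g x + b * ?h x) x = a * CE s ?g x + b * CE s ?h x"
        by eventually_elim simp
      have ii: "(\<integral>y. a * g y + b * h y \<partial>std_normal_distribution) = a * ?Eg + b * ?Eh"
        using gi(2) hi(2) by simp
      have "expectation (\<lambda>x. \<bar>CE s (\<lambda>x. a * ?g x + b * ?h x) x - (\<integral>y. a * g y + b * h y \<partial>std_normal_distribution)\<bar>)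
        \<le> expectation (\<lambda>x. \<bar>a\<bar> * \<bar>CE s ?g x - ?Eg\<bar> + \<bar>b\<bar> * \<bar>CE s ?h x - ?Eh\<bar>)"
      proof (rule integral_mono_AE)
        show "AE x in M. \<bar>CE s (\<lambda>x. a * ?g x + b * ?h x) x - (\<integral>y. a * g y + b * h y \<partial>std_normal_distribution)\<bar>
          \<le> \<bar>a\<bar> * \<bar>CE s ?g x - ?Eg\<bar> + \<bar>b\<bar> * \<bar>CE s ?h x - ?Eh\<bar>"
          using ae
        proof eventually_elim
          case (elim x)
          have "CE s (\<lambda>x. a * ?g x + b * ?h x) x - (\<integral>y. a * g y + b * h y \<partial>std_normal_distribution) =
            a * (CE s ?g x - ?Eg) + b * (CE s ?h x - ?Eh)"
            unfolding elim ii by (simp add: algebra_simps)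
          then show ?case by (simp add: abs_mult[symmetric] abs_triangle_ineq)
        qed
        have "integrable M (CE s (\<lambda>x. a * ?g x + b * ?h x))"
          by (rule F.real_cond_exp_int) (use gi(1) hi(1) in auto)
        then show "integrable M (\<lambda>x. \<bar>CE s (\<lambda>x. a * ?g x + b * ?h x) x - (\<integral>y. a * g y + b * h y \<partial>std_normal_distribution)\<bar>)" by simp
      qed (use gi(3) hi(3) in auto)
      also have "\<dots> = \<bar>a\<bar> * expectation (\<lambda>x. \<bar>CE s ?g x - ?Eg\<bar>) + \<bar>b\<bar> * expectation (\<lambda>x. \<bar>CE s ?h x - ?Eh\<bar>)"
        using gi(3) hi(3) by simp
      also have "\<dots> \<le> \<bar>a\<bar> * \<delta> + \<bar>b\<bar> * \<delta>" using elim by (intro add_mono mult_left_mono) auto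
      also have "\<dots> = (\<bar>a\<bar> + \<bar>b\<bar>) * \<delta>" by (simp add: algebra_simps)
      also have "\<dots> \<le> (\<bar>a\<bar> + \<bar>b\<bar> + 1) * \<delta>" using \<delta> by (intro mult_right_mono) auto
      also have "\<dots> = \<epsilon>" unfolding \<delta>_def by simp
      finally show "expectation (\<lambda>x. \<bar>CE s (\<lambda>x. a * ?g x + b * ?h x) x - (\<integral>y. a * g y + b * h y \<partial>std_normal_distribution)\<bar>) \<le> \<epsilon>" .
    qed
  qed
qed

lemma cond_normal_const: "cond_normal (\<lambda>_. c)"
  unfolding cond_normal_def
proof (intro conjI allI impI)
  fix \<epsilon> :: real assume \<epsilon>: "\<epsilon> > 0"
  have "expectation (\<lambda>x. \<bar>CE s (\<lambda>x. c) x - (\<integral>y. c \<partial>std_normal_distribution)\<bar>) = 0" for s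
  proof -
    have "AE x in M. CE s (\<lambda>x. c) x = c" by (rule F.real_cond_exp_F_meas) auto
    then have "expectation (\<lambda>x. \<bar>CE s (\<lambda>x. c) x - c\<bar>) = expectation (\<lambda>x. 0)"
      by (intro integral_cong_AE) auto
    then show ?thesis using std_normal.prob_space by simp
  qed
  then show "\<forall>\<^sub>F l in sequentially. \<forall>s. expectation (\<lambda>x. \<bar>CE s (\<lambda>x. c) x - (\<integral>y. c \<partial>std_normal_distribution)\<bar>) \<le> \<epsilon>"
    using \<epsilon> by simp
qed auto

lemma cond_normal_sum:
  assumes "\<And>i. i \<in> I \<Longrightarrow> cond_normal (g i)" shows "cond_normal (\<lambda>s. \<Sum>i\<in>I. g i s)"
  using assms
proof (induction I rule: infinite_finite_induct)
  case (insert i I)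
  then show ?case using cond_normal_linear[of "g i" "\<lambda>s. \<Sum>i\<in>I. g i s" 1 1] by simp
qed (auto intro: cond_normal_const)

lemma cond_normal_atMost: "cond_normal (indicator {..z})"
  unfolding cond_normal_def
proof (intro conjI allI impI)
  have "(\<integral>y. indicator {..z} y \<partial>std_normal_distribution) = cdf std_normal_distribution z"
    by (simp add: cdf_def)
  then show "\<epsilon> > 0 \<Longrightarrow> \<forall>\<^sub>F l in sequentially. \<forall>s. expectation (\<lambda>x. \<bar>CE s (\<lambda>x. indicator {..z} (W s l x / sqrt (v l))) x - (\<integral>y. indicator {..z} y \<partial>std_normal_distribution)\<bar>) \<le> \<epsilon>" for \<epsilon> :: real
    using normal[of \<epsilon> z] by simp
  show "\<exists>B. \<forall>s. \<bar>indicator {..z} s\<bar> \<le> (B::real)" by (intro exI[of _ 1]) (simp add: indicator_def)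
qed auto

lemma cond_normal_upset:
  assumes "open U" "\<And>x y. x \<in> U \<Longrightarrow> x \<le> y \<Longrightarrow> y \<in> U" shows "cond_normal (indicator U)"
proof -
  consider (1) "U = {}" | (2) "U = UNIV" | (3) z where "U = {z<..}"
  proof -
    have "U = {} \<or> U = UNIV \<or> (\<exists>z. U = {z<..})" by (rule open_upset_cases) (use assms in blast)+
    then show ?thesis using that by blast
  qed
  then show ?thesis
  proof cases
    case 1
    have "indicator U = (\<lambda>_. 0 :: real)" by (auto simp: 1 fun_eq_iff)
    then show ?thesis using cond_normal_const[of 0] by simp
  next
    case 2
    have "indicator U = (\<lambda>_. 1 :: real)" by (auto simp: 2 fun_eq_iff)
    then show ?thesis using cond_normal_const[of 1] by simp
  next
    case (3 z)
    have "(\<lambda>s. 1 * 1 + (- 1) * indicator {..z} s :: real) = indicator U"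
      unfolding 3 by (auto simp: indicator_def fun_eq_iff)
    then show ?thesis using cond_normal_linear[OF cond_normal_const[of 1] cond_normal_atMost[of z], of 1 "-1"] by simp
  qed
qed

text \<open>A uniform error of \<open>\<epsilon> / 3\<close> survives both the conditional
  expectation and the normal integral; the remaining third is left for the convergence of
  \<open>h\<close>.\<close>

lemma cond_normal_uniform_limit:
  assumes [measurable]: "g \<in> borel_measurable borel"
    and approx: "\<And>\<epsilon>. \<epsilon> > 0 \<Longrightarrow> \<exists>h. cond_normal h \<and> (\<forall>s. \<bar>g s - h s\<bar> \<le> \<epsilon>)"
  shows "cond_normal g"
  unfolding cond_normal_def
proof (intro conjI allI impI)
  obtain h where h: "cond_normal h" "\<And>s. \<bar>g s - h s\<bar> \<le> 1" using approx[of 1] by auto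
  obtain B where "\<And>s. \<bar>h s\<bar> \<le> B" using h by (auto simp: cond_normal_def)
  then have gB: "\<bar>g s\<bar> \<le> B + 1" for s using h(2)[of s] abs_triangle_ineq2[of "g s" "h s"] by (smt (verit))
  then show "\<exists>B. \<forall>s. \<bar>g s\<bar> \<le> B" by blast
  note gi = bounded_integrable[of g, OF _ gB]
  fix \<epsilon> :: real assume \<epsilon>: "\<epsilon> > 0"
  obtain h where h: "cond_normal h" "\<And>s. \<bar>g s - h s\<bar> \<le> \<epsilon> / 3" using approx[of "\<epsilon> / 3"] \<epsilon> by auto
  have [measurable]: "h \<in> borel_measurable borel" using h by (auto simp: cond_normal_def)
  obtain C where C: "\<And>s. \<bar>h s\<bar> \<le> C" using h by (auto simp: cond_normal_def)
  note hi = bounded_integrable[of h, OF _ C]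
  have "\<forall>\<^sub>F l in sequentially. \<forall>s. expectation (\<lambda>x. \<bar>CE s (\<lambda>x. h (W s l x / sqrt (v l))) x - (\<integral>y. h y \<partial>std_normal_distribution)\<bar>) \<le> \<epsilon> / 3"
    by (rule h(1)[unfolded cond_normal_def, THEN conjunct2, THEN conjunct2, rule_format]) (use \<epsilon> in simp)
  then show "\<forall>\<^sub>F l in sequentially. \<forall>s. expectation (\<lambda>x. \<bar>CE s (\<lambda>x. g (W s l x / sqrt (v l))) x - (\<integral>y. g y \<partial>std_normal_distribution)\<bar>) \<le> \<epsilon>"
  proof eventually_elim
    case (elim l)
    show ?case
    proof
      fix s
      let ?g = "\<lambda>x. g (W s l x / sqrt (v l))" and ?h = "\<lambda>x. h (W s l x / sqrt (v l))"
      let ?Eg = "\<integral>y. g y \<partial>std_normal_distribution" and ?Eh = "\<integral>y. h y \<partial>std_normal_distribution"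
      have "\<bar>?Eg - ?Eh\<bar> = \<bar>\<integral>y. g y - h y \<partial>std_normal_distribution\<bar>" using gi(2) hi(2) by simp
      also have "\<dots> \<le> (\<integral>y. \<bar>g y - h y\<bar> \<partial>std_normal_distribution)"
        using integral_norm_bound[of std_normal_distribution "\<lambda>y. g y - h y"] by simp
      also have "\<dots> \<le> (\<integral>y. \<epsilon> / 3 \<partial>std_normal_distribution)"
        using gi(2) hi(2) h(2) by (intro integral_mono) auto
      also have "\<dots> = \<epsilon> / 3" using std_normal.prob_space by simp
      finally have E: "\<bar>?Eg - ?Eh\<bar> \<le> \<epsilon> / 3" .
      have d: "AE x in M. CE s (\<lambda>x. ?g x - ?h x) x = CE s ?g x - CE s ?h x"
        by (rule F.real_cond_exp_diff) (use gi(1) hi(1) in auto)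
      have gh: "integrable M (\<lambda>x. ?g x - ?h x)" using gi(1) hi(1) by simp
      have up: "AE x in M. CE s (\<lambda>x. ?g x - ?h x) x \<le> \<epsilon> / 3"
        by (rule F.real_cond_exp_le_c[OF gh]) (use h(2) abs_le_D1 in blast)
      have lo: "AE x in M. CE s (\<lambda>x. ?g x - ?h x) x \<ge> - (\<epsilon> / 3)"
      proof (rule F.real_cond_exp_ge_c[OF gh])
        have "- (\<epsilon> / 3) \<le> ?g x - ?h x" for x using h(2)[of "W s l x / sqrt (v l)"] by linarith
        then show "AE x in M. - (\<epsilon> / 3) \<le> ?g x - ?h x" by simp
      qed
      have "expectation (\<lambda>x. \<bar>CE s ?g x - ?Eg\<bar>) \<le> expectation (\<lambda>x. \<bar>CE s ?h x - ?Eh\<bar> + 2 * \<epsilon> / 3)"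
      proof (rule integral_mono_AE)
        show "AE x in M. \<bar>CE s ?g x - ?Eg\<bar> \<le> \<bar>CE s ?h x - ?Eh\<bar> + 2 * \<epsilon> / 3"
          using d up lo by eventually_elim (use E in linarith)
      qed (use gi(3) hi(3) in auto)
      also have "\<dots> = expectation (\<lambda>x. \<bar>CE s ?h x - ?Eh\<bar>) + 2 * \<epsilon> / 3"
        using hi(3) by (simp add: prob_space)
      also have "\<dots> \<le> \<epsilon> / 3 + 2 * \<epsilon> / 3" using spec[OF elim, of s] by linarith
      finally show "expectation (\<lambda>x. \<bar>CE s ?g x - ?Eg\<bar>) \<le> \<epsilon>" by simp
    qed
  qed
qed fact

text \<open>Superlevel sets of a continuous increasing function are open and upward closed, hence
  empty, the line or a half-line. Averaging \<open>p\<close> of their indicators approximates the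
  function within \<open>1 / p\<close>.\<close>

lemma cond_normal_mono:
  assumes f: "continuous_on UNIV f" "mono f" "\<And>s. 0 \<le> f s" "\<And>s. f s \<le> 1"
  shows "cond_normal f"
proof (rule cond_normal_uniform_limit)
  show "f \<in> borel_measurable borel" by (rule borel_measurable_continuous_onI[OF f(1)])
  fix \<epsilon> :: real assume "\<epsilon> > 0"
  then obtain p :: nat where p: "p > 0" "1 / p < \<epsilon>" by (metis nat_approx_posE divide_inverse mult_1 of_nat_Suc zero_less_Suc)
  \<comment> \<open>The summand \<open>0 * 0\<close> gives the expression the shape
    \<open>a * g s + b * h s\<close> of \<open>cond_normal_linear\<close>.\<close>
  let ?h = "\<lambda>s. (1 / p) * (\<Sum>i<p. indicator {s. real i / p < f s} s) + 0 * 0"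
  have "cond_normal ?h"
  proof (intro cond_normal_linear cond_normal_sum cond_normal_const cond_normal_upset)
    show "open {s. real i / p < f s}" for i
      using f(1) by (intro open_Collect_less) (auto simp: continuous_on_const)
    show "x \<in> {s. real i / p < f s} \<Longrightarrow> x \<le> y \<Longrightarrow> y \<in> {s. real i / p < f s}" for x y i
      using monoD[OF f(2), of x y] by simp
  qed
  moreover have "\<bar>f s - ?h s\<bar> \<le> \<epsilon>" for s
  proof -
    have "\<bar>f s - ?h s\<bar> \<le> 1 / p"
      using layer_cake_approximation[OF f(3,4) p(1), of s] by (simp add: indicator_def)
    then show ?thesis using p by linarith
  qed
  ultimately show "\<exists>h. cond_normal h \<and> (\<forall>s. \<bar>f s - h s\<bar> \<le> \<epsilon>)" by blast
qed

lemma cond_normal_clip: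
  assumes "K > 0" shows "cond_normal (clip K)"
proof -
  let ?f = "\<lambda>s. max 0 (min 1 ((s + K) / (2 * K)))"
  have e: "2 * K * ?f s + - K * 1 = clip K s" for s
  proof -
    consider "s \<le> - K" | "- K < s" "s < K" | "K \<le> s" by linarith
    then show ?thesis
    proof cases
      case 1
      then have "(s + K) / (2 * K) \<le> 0" using assms by (simp add: field_simps)
      then show ?thesis using 1 assms by (simp add: clip_def)
    next
      case 2
      then have "?f s = (s + K) / (2 * K)" using assms by (simp add: field_simps)
      then show ?thesis using 2 assms by (simp add: clip_def)
    next
      case 3
      then have "1 \<le> (s + K) / (2 * K)" using assms by (simp add: field_simps)
      then show ?thesis using 3 assms by (simp add: clip_def)
    qed
  qed
  have "cond_normal ?f"
  proof (rule cond_normal_mono)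
    show "continuous_on UNIV ?f" by (intro continuous_intros) (use assms in auto)
    show "mono ?f" by (intro monoI max.mono min.mono divide_right_mono order_refl) (use assms in auto)
  qed auto
  from cond_normal_linear[OF this cond_normal_const[of 1], of "2 * K" "- K"]
  show ?thesis unfolding e .
qed

text \<open>The square is not monotone, but it is \<open>K\<^sup>2\<close> times the sum of an
  increasing function \<open>?f s\<close> and its mirror image \<open>?f (- s)\<close>. Writing the
  mirror image as 1 minus an increasing function reduces the claim to the monotone case.\<close>

lemma cond_normal_clip_sq:
  assumes "K > 0" shows "cond_normal (\<lambda>s. (clip K s)\<^sup>2)"
proof -
  let ?f = "\<lambda>s. (max 0 (min 1 (s / K)))\<^sup>2"
  have m: "?f x \<le> ?f y" if "x \<le> y" for x y
    by (intro power_mono max.mono min.mono divide_right_mono order_refl) (use assms that in auto)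
  have b: "0 \<le> ?f s" "?f s \<le> 1" for s by (auto intro!: power_le_one)
  have 1: "cond_normal ?f"
  proof (rule cond_normal_mono[OF _ _ b])
    show "continuous_on UNIV ?f" by (intro continuous_intros) (use assms in auto)
    show "mono ?f" by (rule monoI[OF m])
  qed
  have 2: "cond_normal (\<lambda>s. 1 - ?f (- s))"
  proof (rule cond_normal_mono)
    show "continuous_on UNIV (\<lambda>s. 1 - ?f (- s))" by (intro continuous_intros) (use assms in auto)
    show "mono (\<lambda>s. 1 - ?f (- s))"
    proof (rule monoI)
      fix x y :: real assume "x \<le> y"
      then show "1 - ?f (- x) \<le> 1 - ?f (- y)" using m[of "- y" "- x"] by simp
    qed
    show "0 \<le> 1 - ?f (- s)" "1 - ?f (- s) \<le> 1" for s using b[of "- s"] by linarith+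
  qed
  have 3: "cond_normal (\<lambda>s. 1 * ?f s + (- 1) * (1 - ?f (- s)))" by (rule cond_normal_linear[OF 1 2])
  have e: "K\<^sup>2 * (1 * ?f s + (- 1) * (1 - ?f (- s))) + K\<^sup>2 * 1 = (clip K s)\<^sup>2" for s
  proof -
    consider "s \<le> - K" | "- K < s" "s \<le> 0" | "0 < s" "s < K" | "K \<le> s" by linarith
    then show ?thesis
    proof cases
      case 1
      then have *: "max 0 (min 1 (s / K)) = 0" "max 0 (min 1 (- s / K)) = 1" "clip K s = - K"
        using assms by (auto simp: clip_def field_simps)
      show ?thesis unfolding * by simp
    next
      case 2
      then have *: "max 0 (min 1 (s / K)) = 0" "max 0 (min 1 (- s / K)) = - s / K" "clip K s = s"
        using assms by (auto simp: clip_def field_simps)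
      show ?thesis unfolding * using assms by (simp add: power_divide field_simps)
    next
      case 3
      then have *: "max 0 (min 1 (s / K)) = s / K" "max 0 (min 1 (- s / K)) = 0" "clip K s = s"
        using assms by (auto simp: clip_def field_simps)
      show ?thesis unfolding * using assms by (simp add: power_divide field_simps)
    next
      case 4
      then have *: "max 0 (min 1 (s / K)) = 1" "max 0 (min 1 (- s / K)) = 0" "clip K s = K"
        using assms by (auto simp: clip_def field_simps)
      show ?thesis unfolding * by simp
    qed
  qed
  from cond_normal_linear[OF 3 cond_normal_const[of 1], of "K\<^sup>2" "K\<^sup>2"]
  show ?thesis unfolding e .
qed

lemma v_pos: "\<forall>\<^sub>F l in sequentially. v l > 0"
  using v_lim by (simp add: filterlim_at_top_dense)

text \<open>The bounds rest on three different facts: convergence for the square of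
  \<open>clip\<close>; the vanishing normal mean of \<open>clip\<close>, where the bound
  \<open>K\<close> on the conditional mean reduces its square to a first moment (hence the accuracy
  \<open>e / K\<close>); and \<open>clip_residual\<close>, which compares the tail with
  \<open>v l\<close> minus the clipped second moment because the full second moment is exactly
  \<open>v l\<close>.\<close>

lemma clip_block_estimates:
  assumes K: "K > 0" and e: "e > 0"
  defines "c \<equiv> \<integral>x. (clip K x)\<^sup>2 \<partial>std_normal_distribution"
    and "\<psi> \<equiv> \<lambda>l s x. sqrt (v l) * clip K (W s l x / sqrt (v l))"
  shows "\<forall>\<^sub>F l in sequentially. \<forall>s.
    expectation (\<lambda>x. \<bar>CE s (\<lambda>x. (\<psi> l s x)\<^sup>2) x - c * v l\<bar>) \<le> e * v l \<and>
    expectation (\<lambda>x. (CE s (\<psi> l s) x)\<^sup>2) \<le> e * v l \<and>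
    expectation (\<lambda>x. (W s l x - \<psi> l s x)\<^sup>2) \<le> (1 - c + e) * v l"
proof -
  have "\<forall>\<^sub>F l in sequentially. \<forall>s.
      expectation (\<lambda>x. \<bar>CE s (\<lambda>x. (clip K (W s l x / sqrt (v l)))\<^sup>2) x - c\<bar>) \<le> e"
    using cond_normal_clip_sq[OF K] e by (simp add: cond_normal_def c_def)
  moreover have "\<forall>\<^sub>F l in sequentially. \<forall>s.
      expectation (\<lambda>x. \<bar>CE s (\<lambda>x. clip K (W s l x / sqrt (v l))) x - (\<integral>y. clip K y \<partial>std_normal_distribution)\<bar>) \<le> e / K"
    by (rule cond_normal_clip[OF K, unfolded cond_normal_def, THEN conjunct2, THEN conjunct2, rule_format])
       (use e K in simp)
  ultimately show ?thesis
    using v_pos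
  proof eventually_elim
    case (elim l)
    define r where "r = sqrt (v l)"
    have r: "r > 0" "r\<^sup>2 = v l" using elim by (auto simp: r_def)
    show ?case
    proof
      fix s
      define f where "f x = clip K (W s l x / r)" for x
      have [measurable]: "f \<in> borel_measurable M" unfolding f_def[abs_def] by measurable
      have fb: "\<bar>f x\<bar> \<le> K" for x unfolding f_def using K by (intro abs_clip_le) simp
      have fL2: "in_L2 M f" by (rule in_L2_bounded[where c = K]) (use fb in auto)
      have fi: "integrable M f" by (rule in_L2_integrable[OF fL2])
      have f2i: "integrable M (\<lambda>x. (f x)\<^sup>2)" using fL2 by (simp add: in_L2_def)
      have \<psi>: "\<psi> l s = (\<lambda>x. r * f x)" by (simp add: \<psi>_def f_def r_def fun_eq_iff)
      have E2: "expectation (\<lambda>x. \<bar>CE s (\<lambda>x. (f x)\<^sup>2) x - c\<bar>) \<le> e"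
        using elim by (simp add: f_def r_def)
      have E1: "expectation (\<lambda>x. \<bar>CE s f x\<bar>) \<le> e / K"
        using spec[OF elim(2), of s] integral_clip_std_normal[of K] K by (simp add: f_def[abs_def] r_def)
      have 1: "expectation (\<lambda>x. \<bar>CE s (\<lambda>x. (r * f x)\<^sup>2) x - c * v l\<bar>) \<le> e * v l"
      proof -
        have "AE x in M. CE s (\<lambda>x. v l * (f x)\<^sup>2) x = v l * CE s (\<lambda>x. (f x)\<^sup>2) x"
          by (rule F.real_cond_exp_cmult[OF f2i])
        then have "expectation (\<lambda>x. \<bar>CE s (\<lambda>x. (r * f x)\<^sup>2) x - c * v l\<bar>) = expectation (\<lambda>x. v l * \<bar>CE s (\<lambda>x. (f x)\<^sup>2) x - c\<bar>)"
        proof (intro integral_cong_AE)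
          assume *: "AE x in M. CE s (\<lambda>x. v l * (f x)\<^sup>2) x = v l * CE s (\<lambda>x. (f x)\<^sup>2) x"
          show "AE x in M. \<bar>CE s (\<lambda>x. (r * f x)\<^sup>2) x - c * v l\<bar> = v l * \<bar>CE s (\<lambda>x. (f x)\<^sup>2) x - c\<bar>"
            using *
          proof eventually_elim
            case (elim x)
            have "v l * CE s (\<lambda>x. (f x)\<^sup>2) x - c * v l = v l * (CE s (\<lambda>x. (f x)\<^sup>2) x - c)"
              by (simp add: algebra_simps)
            then show ?case using elim v_nonneg[of l] by (simp add: power_mult_distrib r abs_mult)
          qed
        qed auto
        also have "\<dots> = v l * expectation (\<lambda>x. \<bar>CE s (\<lambda>x. (f x)\<^sup>2) x - c\<bar>)" by simp
        also have "\<dots> \<le> v l * e" by (intro mult_left_mono E2 v_nonneg)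
        finally show ?thesis by (simp add: mult.commute)
      qed
      have up: "AE x in M. CE s f x \<le> K"
        by (rule F.real_cond_exp_le_c[OF fi]) (use fb abs_le_D1 in blast)
      have lo: "AE x in M. CE s f x \<ge> - K"
      proof (rule F.real_cond_exp_ge_c[OF fi])
        have "- K \<le> f x" for x using fb[of x] by linarith
        then show "AE x in M. - K \<le> f x" by simp
      qed
      have 2: "expectation (\<lambda>x. (CE s (\<lambda>x. r * f x) x)\<^sup>2) \<le> e * v l"
      proof -
        have ae: "AE x in M. CE s (\<lambda>x. r * f x) x = r * CE s f x" by (rule F.real_cond_exp_cmult[OF fi])
        have "expectation (\<lambda>x. (CE s (\<lambda>x. r * f x) x)\<^sup>2) \<le> expectation (\<lambda>x. v l * (K * \<bar>CE s f x\<bar>))"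
        proof (rule integral_mono_AE)
          show "AE x in M. (CE s (\<lambda>x. r * f x) x)\<^sup>2 \<le> v l * (K * \<bar>CE s f x\<bar>)"
            using ae up lo
          proof eventually_elim
            case (elim x)
            then have "\<bar>CE s f x\<bar> * \<bar>CE s f x\<bar> \<le> K * \<bar>CE s f x\<bar>" by (intro mult_right_mono) auto
            then have "(CE s f x)\<^sup>2 \<le> K * \<bar>CE s f x\<bar>" by (simp add: power2_eq_square)
            then show ?case unfolding elim power_mult_distrib r by (intro mult_left_mono v_nonneg)
          qed
          show "integrable M (\<lambda>x. (CE s (\<lambda>x. r * f x) x)\<^sup>2)"
            using CE_L2[OF in_L2_cmult[OF fL2, of r], of s] by (simp add: in_L2_def)
          show "integrable M (\<lambda>x. v l * (K * \<bar>CE s f x\<bar>))" using F.real_cond_exp_int(1)[OF fi, of s] by simp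
        qed
        also have "\<dots> = v l * (K * expectation (\<lambda>x. \<bar>CE s f x\<bar>))" by simp
        also have "\<dots> \<le> v l * (K * (e / K))" using K by (intro mult_left_mono E1 v_nonneg) auto
        finally show ?thesis using K by (simp add: mult.commute)
      qed
      have 3: "expectation (\<lambda>x. (W s l x - r * f x)\<^sup>2) \<le> (1 - c + e) * v l"
      proof -
        have "expectation (\<lambda>x. (W s l x - r * f x)\<^sup>2) \<le> expectation (\<lambda>x. (W s l x)\<^sup>2 - v l * (f x)\<^sup>2)"
        proof (rule integral_mono)
          show "integrable M (\<lambda>x. (W s l x - r * f x)\<^sup>2)"
            using in_L2_diff[OF W_L2 in_L2_cmult[OF fL2]] by (simp add: in_L2_def)
          show "integrable M (\<lambda>x. (W s l x)\<^sup>2 - v l * (f x)\<^sup>2)" using f2i W_L2 by (simp add: in_L2_def)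
          fix x
          define y where "y = W s l x / r"
          have W: "W s l x = r * y" using r by (simp add: y_def)
          have fx: "f x = clip K y" by (simp add: f_def y_def)
          have "(W s l x - r * f x)\<^sup>2 = v l * (y - clip K y)\<^sup>2"
            unfolding W fx r(2)[symmetric] by (simp add: power2_eq_square algebra_simps)
          also have "\<dots> \<le> v l * (y\<^sup>2 - (clip K y)\<^sup>2)" using K by (intro mult_left_mono clip_residual v_nonneg) simp
          also have "\<dots> = (W s l x)\<^sup>2 - v l * (f x)\<^sup>2"
            unfolding fx W by (simp add: power_mult_distrib r algebra_simps)
          finally show "(W s l x - r * f x)\<^sup>2 \<le> (W s l x)\<^sup>2 - v l * (f x)\<^sup>2" .
        qed
        also have "\<dots> = v l - v l * expectation (\<lambda>x. (f x)\<^sup>2)"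
          using f2i W_L2[of s l] by (simp add: in_L2_def W_var)
        also have "\<dots> \<le> v l - v l * (c - e)"
        proof (intro diff_left_mono mult_left_mono v_nonneg)
          have "expectation (\<lambda>x. (f x)\<^sup>2) - c = expectation (\<lambda>x. CE s (\<lambda>x. (f x)\<^sup>2) x - c)"
            using F.real_cond_exp_int[OF f2i, of s] by (simp add: prob_space)
          then have "\<bar>expectation (\<lambda>x. (f x)\<^sup>2) - c\<bar> \<le> expectation (\<lambda>x. \<bar>CE s (\<lambda>x. (f x)\<^sup>2) x - c\<bar>)"
            using integral_norm_bound[of M "\<lambda>x. CE s (\<lambda>x. (f x)\<^sup>2) x - c"] by simp
          then show "c - e \<le> expectation (\<lambda>x. (f x)\<^sup>2)" using E2 by linarith
        qed
        finally show ?thesis by (simp add: algebra_simps)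
      qed
      show "expectation (\<lambda>x. \<bar>CE s (\<lambda>x. (\<psi> l s x)\<^sup>2) x - c * v l\<bar>) \<le> e * v l \<and>
        expectation (\<lambda>x. (CE s (\<psi> l s) x)\<^sup>2) \<le> e * v l \<and>
        expectation (\<lambda>x. (W s l x - \<psi> l s x)\<^sup>2) \<le> (1 - c + e) * v l"
        unfolding \<psi> using 1 2 3 by blast
    qed
  qed
qed

lemma clip_level:
  assumes "\<delta> > 0" obtains K :: real where "K > 0" "1 - (\<integral>x. (clip K x)\<^sup>2 \<partial>std_normal_distribution) \<le> \<delta>"
proof -
  have "\<forall>\<^sub>F k in sequentially. 1 - \<delta> < (\<integral>x. (clip (real k) x)\<^sup>2 \<partial>std_normal_distribution)"
    by (rule order_tendstoD(1)[OF clip_sq_integral_tendsto]) (use assms in simp)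
  then have "\<forall>\<^sub>F k in sequentially. 1 - \<delta> < (\<integral>x. (clip (real k) x)\<^sup>2 \<partial>std_normal_distribution) \<and> k > 0"
    using eventually_gt_at_top[of 0] by eventually_elim simp
  then obtain k :: nat where "1 - \<delta> < (\<integral>x. (clip (real k) x)\<^sup>2 \<partial>std_normal_distribution)" "k > 0"
    by (auto simp: eventually_sequentially)
  then show thesis using that[of "real k"] by simp
qed

text \<open>Convergence of bounded test functions says nothing about the unbounded sum itself.
  Clipping at a level whose normal loss is at most \<open>\<delta> / 8\<close> bounds the
  conditional mean of the tail by its L2 norm, and the clipped part has conditional mean near 0.
  Altogether \<open>2 * (2/8) + 2 * (1/8)\<close> of \<delta> is spent.\<close>

lemma conditional_mean_negligible:
  assumes \<delta>: "\<delta> > 0"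
  shows "\<forall>\<^sub>F l in sequentially. \<forall>s. expectation (\<lambda>x. (CE s (W s l) x)\<^sup>2) \<le> \<delta> * v l"
proof -
  obtain K where K: "K > 0" "1 - (\<integral>x. (clip K x)\<^sup>2 \<partial>std_normal_distribution) \<le> \<delta> / 8"
    using clip_level[of "\<delta> / 8"] \<delta> by auto
  have d8: "\<delta> / 8 > 0" using \<delta> by simp
  show ?thesis
    using clip_block_estimates[OF K(1) d8]
  proof eventually_elim
    case (elim l)
    show ?case
    proof
      fix s
      define p where "p x = sqrt (v l) * clip K (W s l x / sqrt (v l))" for x
      have p: "in_L2 M p"
      proof (rule in_L2_bounded)
        show "AE x in M. \<bar>p x\<bar> \<le> sqrt (v l) * K"
          using K(1) v_nonneg[of l] unfolding p_def abs_mult by (intro AE_I2 mult_mono abs_clip_le) auto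
      qed (simp add: p_def[abs_def])
      have d: "in_L2 M (\<lambda>x. W s l x - p x)" by (rule in_L2_diff[OF W_L2 p])
      have "AE x in M. CE s (\<lambda>x. W s l x - p x) x = CE s (W s l) x - CE s p x"
        by (rule F.real_cond_exp_diff[OF in_L2_integrable[OF W_L2] in_L2_integrable[OF p]])
      then have "expectation (\<lambda>x. (CE s (W s l) x)\<^sup>2) = expectation (\<lambda>x. (CE s (\<lambda>x. W s l x - p x) x + CE s p x)\<^sup>2)"
      proof (intro integral_cong_AE)
        assume "AE x in M. CE s (\<lambda>x. W s l x - p x) x = CE s (W s l) x - CE s p x"
        then show "AE x in M. (CE s (W s l) x)\<^sup>2 = (CE s (\<lambda>x. W s l x - p x) x + CE s p x)\<^sup>2"
          by eventually_elim simp
      qed auto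
      also have "\<dots> \<le> 2 * expectation (\<lambda>x. (CE s (\<lambda>x. W s l x - p x) x)\<^sup>2) + 2 * expectation (\<lambda>x. (CE s p x)\<^sup>2)"
        by (rule expectation_sum_sq_le[OF CE_L2[OF d] CE_L2[OF p]])
      also have "\<dots> \<le> 2 * ((1 - (\<integral>x. (clip K x)\<^sup>2 \<partial>std_normal_distribution) + \<delta> / 8) * v l) + 2 * (\<delta> / 8 * v l)"
        using CE_L2_le[OF d, of s] spec[OF elim, of s] unfolding p_def by (intro add_mono) auto
      also have "\<dots> \<le> 2 * ((\<delta> / 8 + \<delta> / 8) * v l) + 2 * (\<delta> / 8 * v l)"
        using K(2) by (intro add_mono mult_left_mono mult_right_mono v_nonneg) auto
      also have "\<dots> \<le> \<delta> * v l" using \<delta> v_nonneg[of l] by (simp add: field_simps)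
      finally show "expectation (\<lambda>x. (CE s (W s l) x)\<^sup>2) \<le> \<delta> * v l" .
    qed
  qed
qed

lemma martingale_approximation_exists:
  assumes \<epsilon>: "\<epsilon> > 0"
  shows "\<forall>\<^sub>F n in sequentially. \<exists>d :: nat \<Rightarrow> 'a \<Rightarrow> real.
    (\<forall>k. d k \<in> borel_measurable (F (Suc k)) \<and> in_L2 M (d k) \<and> (AE x in M. CE k (d k) x = 0) \<and>
      (AE x in M. \<bar>d k x\<bar> \<le> \<epsilon> * sqrt (v n))) \<and>
    (\<forall>k\<le>n. expectation (\<lambda>x. (W 0 k x - (\<Sum>i<k. d i x))\<^sup>2) \<le> \<epsilon> * v n) \<and>
    expectation (\<lambda>x. \<bar>(\<Sum>k<n. CE k (\<lambda>x. (d k x)\<^sup>2) x) - v n\<bar>) \<le> \<epsilon> * v n"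
proof -
  \<comment> \<open>The two bounds serve the requirement \<open>\<theta> \<le> 1/10\<close> of
    \<open>block_approximation\<close> and the constant 14 in its conclusion.\<close>
  define \<theta> where "\<theta> = min (1/10) (\<epsilon> / 14)"
  have \<theta>: "0 < \<theta>" "\<theta> \<le> 1/10" "14 * \<theta> \<le> \<epsilon>" using \<epsilon> by (auto simp: \<theta>_def)
  define \<beta> where "\<beta> = \<theta>\<^sup>2"
  have \<beta>: "\<beta> > 0" using \<theta> by (simp add: \<beta>_def)
  have \<beta>\<epsilon>: "2 * \<beta> \<le> \<epsilon>"
  proof -
    have "\<beta> \<le> \<theta> * (1/10)" unfolding \<beta>_def power2_eq_square using \<theta> by (intro mult_left_mono) auto
    then show ?thesis using \<theta> by linarith
  qed
  have "\<beta> / 24 > 0" using \<beta> by simp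
  then obtain K where K: "K > 0" "1 - (\<integral>x. (clip K x)\<^sup>2 \<partial>std_normal_distribution) \<le> \<beta> / 24"
    by (rule clip_level)
  define c where "c = (\<integral>x. (clip K x)\<^sup>2 \<partial>std_normal_distribution)"
  have c: "0 \<le> c" "c \<le> 1" unfolding c_def using clip_sq_integral[of K] K by auto
  \<comment> \<open>\<open>84 / \<beta>\<close> brings \<open>21 / N\<close> below
    \<open>\<beta> / 4\<close>, and the other summand gives \<open>b2\<close>. The level
    \<open>K\<close> is fixed before \<open>N\<close>, and \<open>N\<close> before
    \<open>e\<close>.\<close>
  obtain N0 :: nat where N0: "84 / \<beta> + 80 * K\<^sup>2 / \<beta>\<^sup>2 < real N0" using reals_Archimedean2 by blast
  define N where "N = Suc N0"
  have N: "N > 0" by (simp add: N_def)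
  have N1: "84 / \<beta> \<le> N" "80 * K\<^sup>2 / \<beta>\<^sup>2 \<le> N"
  proof -
    have "0 \<le> 84 / \<beta>" "0 \<le> 80 * K\<^sup>2 / \<beta>\<^sup>2" "real N = real N0 + 1" using \<beta> by (auto simp: N_def)
    then show "84 / \<beta> \<le> N" "80 * K\<^sup>2 / \<beta>\<^sup>2 \<le> N" using N0 by linarith+
  qed
  \<comment> \<open>This makes \<open>12 * N * e\<close> equal to \<open>\<beta> / 2\<close>; with a
    quarter each from \<open>K\<close> and from \<open>N\<close> the total is at most
    \<beta>.\<close>
  define e where "e = \<beta> / (24 * N)"
  have e: "e > 0" using \<beta> N by (simp add: e_def)
  have b1: "6 * (1 - c) + 12 * real N * e + 21 / real N \<le> \<theta>\<^sup>2"
  proof -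
    have "21 / N \<le> \<beta> / 4" using N1(1) N \<beta> by (simp add: field_simps)
    moreover have "12 * real N * e = \<beta> / 2" using N by (simp add: e_def)
    moreover have "6 * (1 - c) \<le> \<beta> / 4" using K(2) by (simp add: c_def)
    ultimately show ?thesis unfolding \<beta>_def[symmetric] by linarith
  qed
  have b2: "80 * K\<^sup>2 \<le> (\<theta>\<^sup>2)\<^sup>2 * N"
    using N1(2) \<beta> unfolding \<beta>_def[symmetric] by (simp add: field_simps)
  obtain C where C: "\<And>l n. l \<le> n \<Longrightarrow> v l \<le> 5 * v n + C"
    using v_almost_mono[OF conditional_mean_negligible] by blast
  define G where "G m \<longleftrightarrow> (\<forall>s.
      expectation (\<lambda>x. \<bar>CE s (\<lambda>x. (sqrt (v m) * clip K (W s m x / sqrt (v m)))\<^sup>2) x - c * v m\<bar>) \<le> e * v m \<and>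
      expectation (\<lambda>x. (CE s (\<lambda>x. sqrt (v m) * clip K (W s m x / sqrt (v m))) x)\<^sup>2) \<le> e * v m \<and>
      expectation (\<lambda>x. (W s m x - sqrt (v m) * clip K (W s m x / sqrt (v m)))\<^sup>2) \<le> (1 - c + e) * v m)" for m
  define H where "H m \<longleftrightarrow> (\<forall>s. expectation (\<lambda>x. (CE s (W s m) x)\<^sup>2) \<le> e * v m)" for m
  have G: "\<forall>\<^sub>F m in sequentially. G m"
    unfolding G_def c_def by (rule clip_block_estimates[OF K(1) e])
  have H: "\<forall>\<^sub>F m in sequentially. H m"
    unfolding H_def by (rule conditional_mean_negligible[OF e])
  have vC: "\<forall>\<^sub>F m in sequentially. max 1 C \<le> v m" using v_lim unfolding filterlim_at_top by blast
  have ev: "\<forall>\<^sub>F m in sequentially. N \<le> m \<and> max 1 C \<le> v m \<and> G m \<and> H m"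
    by (intro eventually_conj G H vC eventually_ge_at_top)
  \<comment> \<open>\<open>N\<close> stays fixed while the block length \<open>n div N\<close>
    grows, so whatever holds for all large block lengths holds for all large
    \<open>n\<close>.\<close>
  have div: "filterlim (\<lambda>n. n div N) sequentially sequentially"
    unfolding filterlim_at_top
  proof
    fix Z
    show "\<forall>\<^sub>F n in sequentially. Z \<le> n div N"
      using eventually_ge_at_top[of "Z * N"]
    proof eventually_elim
      case (elim n)
      then show ?case using N by (simp add: less_eq_div_iff_mult_less_eq)
    qed
  qed
  show ?thesis
    using eventually_compose_filterlim[OF ev div]
  proof eventually_elim
    case (elim n)
    define m where "m = n div N"
    note el = elim[folded m_def]
    have m: "m > 0" using el N by linarith
    have n: "n = N * m + n mod N" by (simp add: m_def)
    have r: "n mod N \<le> m" using el mod_less_divisor[OF N, of n] by linarith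
    \<comment> \<open>As \<open>C \<le> v m\<close>, the additive constant costs one more multiple
      of \<open>v m\<close>.\<close>
    have v6: "v i \<le> 6 * v m" if "i \<le> m" for i using C[OF that] el by linarith
    have a1: "expectation (\<lambda>x. \<bar>CE s (\<lambda>x. (sqrt (v m) * clip K (W s m x / sqrt (v m)))\<^sup>2) x - c * v m\<bar>) \<le> e * v m"
      and a2: "expectation (\<lambda>x. (CE s (\<lambda>x. sqrt (v m) * clip K (W s m x / sqrt (v m))) x)\<^sup>2) \<le> e * v m"
      and a3: "expectation (\<lambda>x. (W s m x - sqrt (v m) * clip K (W s m x / sqrt (v m)))\<^sup>2) \<le> (1 - c + e) * v m"
      and a4: "expectation (\<lambda>x. (CE s (W s m) x)\<^sup>2) \<le> e * v m" for s
      using el unfolding G_def H_def by blast+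
    have vm: "v m > 0" using el by linarith
    obtain d where d: "\<And>k. d k \<in> borel_measurable (F (Suc k))" "\<And>k. in_L2 M (d k)" "\<And>k. AE x in M. CE k (d k) x = 0"
      "\<And>k. AE x in M. \<bar>d k x\<bar> \<le> \<beta> * sqrt (v n)"
      "\<And>k. k \<le> n \<Longrightarrow> expectation (\<lambda>x. (W 0 k x - (\<Sum>i<k. d i x))\<^sup>2) \<le> 2 * \<beta> * v n"
      "expectation (\<lambda>x. \<bar>(\<Sum>k<n. CE k (\<lambda>x. (d k x)\<^sup>2) x) - v n\<bar>) \<le> 14 * \<theta> * v n"
    proof (rule block_approximation[OF m N n r vm K(1) c less_imp_le[OF e] a1 a2 a3 a4 v6 \<theta>(1,2) b1 b2,
        folded \<beta>_def])
      fix d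
      assume "\<And>k. d k \<in> borel_measurable (F (Suc k))" "\<And>k. in_L2 M (d k)" "\<And>k. AE x in M. CE k (d k) x = 0"
        "\<And>k. AE x in M. \<bar>d k x\<bar> \<le> \<beta> * sqrt (v n)"
        "\<And>k. k \<le> n \<Longrightarrow> expectation (\<lambda>x. (W 0 k x - (\<Sum>i<k. d i x))\<^sup>2) \<le> 2 * \<beta> * v n"
        "expectation (\<lambda>x. \<bar>(\<Sum>k<n. CE k (\<lambda>x. (d k x)\<^sup>2) x) - v n\<bar>) \<le> 14 * \<theta> * v n"
      then show thesis by (rule that)
    qed
    have "AE x in M. \<bar>d k x\<bar> \<le> \<epsilon> * sqrt (v n)" for k
    proof -
      have "\<beta> * sqrt (v n) \<le> \<epsilon> * sqrt (v n)" using \<beta>\<epsilon> \<beta> v_nonneg[of n] by (intro mult_right_mono) auto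
      then show ?thesis using d(4)[of k] by (auto elim!: eventually_mono)
    qed
    moreover have "2 * \<beta> * v n \<le> \<epsilon> * v n" "14 * \<theta> * v n \<le> \<epsilon> * v n"
      using \<beta>\<epsilon> \<theta>(3) by (intro mult_right_mono v_nonneg; simp)+
    moreover have "\<forall>k\<le>n. expectation (\<lambda>x. (W 0 k x - (\<Sum>i<k. d i x))\<^sup>2) \<le> \<epsilon> * v n"
      using order_trans[OF d(5) calculation(2)] by blast
    moreover have "expectation (\<lambda>x. \<bar>(\<Sum>k<n. CE k (\<lambda>x. (d k x)\<^sup>2) x) - v n\<bar>) \<le> \<epsilon> * v n"
      using order_trans[OF d(6) calculation(3)] .
    ultimately show ?case
      using d(1-3) by (intro exI[of _ d]) simp
  qed
qed

end

text \<open>At stage \<open>n\<close> the finest accuracy already attained is used. The restriction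
  \<open>i \<le> n\<close> keeps the set of candidates finite; for small \<open>n\<close> it may be
  empty, and \<open>D n\<close> is then arbitrary.\<close>

lemma diagonal_selection:
  fixes G :: "real \<Rightarrow> nat \<Rightarrow> 'b \<Rightarrow> bool"
  assumes ex: "\<And>\<epsilon>. \<epsilon> > 0 \<Longrightarrow> \<forall>\<^sub>F n in sequentially. \<exists>d. G \<epsilon> n d"
    and mono: "\<And>\<epsilon> \<delta> n d. 0 < \<epsilon> \<Longrightarrow> \<epsilon> \<le> \<delta> \<Longrightarrow> G \<epsilon> n d \<Longrightarrow> G \<delta> n d"
  obtains D where "\<And>\<epsilon>. \<epsilon> > 0 \<Longrightarrow> \<forall>\<^sub>F n in sequentially. G \<epsilon> n (D n)"
proof -
  define e where "e i = 1 / real (Suc i)" for i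
  have e: "e i > 0" for i by (simp add: e_def)
  have "\<exists>m. \<forall>n\<ge>m. \<exists>d. G (e i) n d" for i using ex[OF e] by (simp add: eventually_sequentially)
  then have "\<exists>m. \<forall>i. \<forall>n\<ge>m i. \<exists>d. G (e i) n d" by (intro choice allI)
  then obtain m where m: "\<And>i n. n \<ge> m i \<Longrightarrow> \<exists>d. G (e i) n d" by blast
  define J where "J n = {i. i \<le> n \<and> m i \<le> n}" for n
  have J: "m i \<le> n" if "i \<in> J n" for i n using that by (simp add: J_def)
  define D where "D n = (SOME d. G (e (Max (J n))) n d)" for n
  have "\<forall>\<^sub>F n in sequentially. G \<epsilon> n (D n)" if \<epsilon>: "\<epsilon> > 0" for \<epsilon>
  proof -
    obtain i where i: "e i < \<epsilon>" using reals_Archimedean[OF \<epsilon>] by (auto simp: e_def inverse_eq_divide)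
    show ?thesis
      using eventually_ge_at_top[of "max i (m i)"]
    proof eventually_elim
      case (elim n)
      have fin: "finite (J n)" by (rule finite_subset[of _ "{..n}"]) (auto simp: J_def)
      have iJ: "i \<in> J n" using elim by (simp add: J_def)
      have "Max (J n) \<in> J n" using fin iJ by (intro Max_in) auto
      then have "\<exists>d. G (e (Max (J n))) n d" by (rule m[OF J])
      then have "G (e (Max (J n))) n (D n)" unfolding D_def by (rule someI_ex)
      moreover have "e (Max (J n)) \<le> \<epsilon>"
      proof -
        have "i \<le> Max (J n)" using fin iJ by simp
        then have "e (Max (J n)) \<le> e i" by (simp add: e_def frac_le)
        then show ?thesis using i by simp
      qed
      ultimately show ?case using mono[OF e, of "Max (J n)" \<epsilon> n "D n"] by simp
    qed
  qed
  then show thesis by (rule that)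
qed

section \<open>Martingale arrays\<close>

context filtered_prob_space begin

text \<open>The hypotheses are in probability, whereas \<open>martingale_clt_bound\<close> needs L1
  norms. The gap is closed by \<open>A n \<ge> 0\<close> with mean at most \<open>1 + o(1)\<close>,
  and by the domination of the Lindeberg sums by \<open>A n\<close>.\<close>

lemma martingale_array_clt:
  fixes S :: "nat \<Rightarrow> 'a \<Rightarrow> real" and v :: "nat \<Rightarrow> real" and d :: "nat \<Rightarrow> nat \<Rightarrow> 'a \<Rightarrow> real" and h :: "nat \<Rightarrow> 'a \<Rightarrow> real"
  assumes v: "\<forall>\<^sub>F n in sequentially. v n > 0"
    and S: "\<And>n. in_L2 M (S n)" "\<And>n. expectation (\<lambda>x. (S n x)\<^sup>2) = v n"
    and d: "\<forall>\<^sub>F n in sequentially. \<forall>k<n. in_L2 M (d n k) \<and> d n k \<in> borel_measurable (F (Suc k)) \<and> (AE x in M. CE k (d n k) x = 0)"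
    and approx: "\<And>\<epsilon>. \<epsilon> > 0 \<Longrightarrow> \<forall>\<^sub>F n in sequentially. expectation (\<lambda>x. (S n x - (\<Sum>k<n. d n k x))\<^sup>2) \<le> \<epsilon> * v n"
    and var: "conv_in_prob M (\<lambda>n x. 1 / v n * (\<Sum>k<n. CE k (\<lambda>x. (d n k x)\<^sup>2) x)) (\<lambda>_. 1)"
    and lind: "\<And>\<epsilon>. \<epsilon> > 0 \<Longrightarrow> conv_in_prob M (\<lambda>n x. 1 / v n * (\<Sum>k<n. CE k
        (\<lambda>x. (d n k x)\<^sup>2 * indicator {x. \<epsilon> * sqrt (v n) \<le> \<bar>d n k x\<bar>} x) x)) (\<lambda>_. 0)"
    and h: "\<And>n. h n \<in> borel_measurable (F 0)" "\<And>n x. \<bar>h n x\<bar> \<le> 1"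
  shows "(\<lambda>n. \<integral>x. of_real (h n x) * (iexp (t * (S n x / sqrt (v n))) - of_real (exp (- (t\<^sup>2 / 2)))) \<partial>M) \<longlonglongrightarrow> 0"
proof -
  define A where "A n x = 1 / v n * (\<Sum>k<n. CE k (\<lambda>x. (d n k x)\<^sup>2) x)" for n x
  define l where "l \<epsilon> n k x = (d n k x)\<^sup>2 * indicator {x. \<epsilon> * sqrt (v n) \<le> \<bar>d n k x\<bar>} x" for \<epsilon> n k x
  define L where "L \<epsilon> n x = 1 / v n * (\<Sum>k<n. CE k (l \<epsilon> n k) x)" for \<epsilon> n x
  define good where "good n \<longleftrightarrow> v n > 0 \<and> (\<forall>k<n. in_L2 M (d n k) \<and> d n k \<in> borel_measurable (F (Suc k)) \<and> (AE x in M. CE k (d n k) x = 0))" for n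
  have good: "\<forall>\<^sub>F n in sequentially. good n" using v d unfolding good_def by (rule eventually_conj)
  have d2: "integrable M (\<lambda>x. (d n k x)\<^sup>2)" if "good n" "k < n" for n k using that by (simp add: good_def in_L2_def)
  have dm: "d n k \<in> borel_measurable M" if "good n" "k < n" for n k using that by (simp add: good_def in_L2_def)
  have lm: "l \<epsilon> n k \<in> borel_measurable M" if "good n" "k < n" for \<epsilon> n k
  proof -
    have [measurable]: "d n k \<in> borel_measurable M" by (rule dm[OF that])
    have "l \<epsilon> n k = (\<lambda>x. (d n k x)\<^sup>2 * indicator {y. \<epsilon> * sqrt (v n) \<le> \<bar>y\<bar>} (d n k x))"
      by (simp add: l_def indicator_def fun_eq_iff)
    also have "\<dots> \<in> borel_measurable M" by measurable
    finally show ?thesis .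
  qed
  have li: "integrable M (l \<epsilon> n k)" if "good n" "k < n" for \<epsilon> n k
    by (rule Bochner_Integration.integrable_bound[OF d2[OF that] lm[OF that]]) (simp add: l_def indicator_def)
  have A_int: "integrable M (A n)" if "good n" for n
    unfolding A_def[abs_def]
    by (intro integrable_mult_right Bochner_Integration.integrable_sum F.real_cond_exp_int d2[OF that]) simp
  have L_int: "integrable M (L \<epsilon> n)" if "good n" for \<epsilon> n
    unfolding L_def[abs_def]
    by (intro integrable_mult_right Bochner_Integration.integrable_sum F.real_cond_exp_int li[OF that]) simp
  have EA: "expectation (A n) = 1 / v n * (\<Sum>k<n. expectation (\<lambda>x. (d n k x)\<^sup>2))" if "good n" for n
    unfolding A_def[abs_def] using d2[OF that] by (simp add: F.real_cond_exp_int)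
  have EL: "expectation (L \<epsilon> n) = 1 / v n * (\<Sum>k<n. expectation (l \<epsilon> n k))" if "good n" for \<epsilon> n
    unfolding L_def[abs_def] using li[OF that] by (simp add: F.real_cond_exp_int)
  have A_nonneg: "AE x in M. 0 \<le> A n x" if "good n" for n
  proof -
    have "AE x in M. k < n \<longrightarrow> 0 \<le> CE k (\<lambda>x. (d n k x)\<^sup>2) x" for k
      using F.real_cond_exp_pos[of "\<lambda>x. (d n k x)\<^sup>2" k] dm[OF that, of k] by (cases "k < n") auto
    then have "AE x in M. \<forall>k. k < n \<longrightarrow> 0 \<le> CE k (\<lambda>x. (d n k x)\<^sup>2) x" by (simp add: AE_all_countable)
    then show ?thesis
    proof eventually_elim
      case (elim x)
      then show ?case
        unfolding A_def using that by (intro mult_nonneg_nonneg sum_nonneg) (auto simp: good_def)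
    qed
  qed
  have L_le: "AE x in M. 0 \<le> L \<epsilon> n x \<and> L \<epsilon> n x \<le> A n x" if "good n" for \<epsilon> n
  proof -
    have "AE x in M. k < n \<longrightarrow> 0 \<le> CE k (l \<epsilon> n k) x \<and> CE k (l \<epsilon> n k) x \<le> CE k (\<lambda>x. (d n k x)\<^sup>2) x" for k
    proof (cases "k < n")
      case True
      have "AE x in M. 0 \<le> CE k (l \<epsilon> n k) x"
        by (rule F.real_cond_exp_pos) (use lm[OF that True] in \<open>auto simp: l_def\<close>)
      moreover have "AE x in M. CE k (l \<epsilon> n k) x \<le> CE k (\<lambda>x. (d n k x)\<^sup>2) x"
        by (rule F.real_cond_exp_mono) (use li[OF that True] d2[OF that True] in \<open>auto simp: l_def indicator_def\<close>)
      ultimately show ?thesis by eventually_elim simp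
    qed simp
    then have "AE x in M. \<forall>k. k < n \<longrightarrow> 0 \<le> CE k (l \<epsilon> n k) x \<and> CE k (l \<epsilon> n k) x \<le> CE k (\<lambda>x. (d n k x)\<^sup>2) x"
      by (simp add: AE_all_countable)
    then show ?thesis
    proof eventually_elim
      case (elim x)
      then show ?case
        unfolding L_def A_def using that
        by (intro conjI mult_nonneg_nonneg mult_left_mono sum_nonneg sum_mono) (auto simp: good_def)
    qed
  qed
  have small_prob: "\<forall>\<^sub>F n in sequentially. prob {x \<in> space M. \<bar>Y n x - c\<bar> \<ge> \<eta>} < \<eta>"
    if "conv_in_prob M Y (\<lambda>_. c)" "\<eta> > 0" for Y :: "nat \<Rightarrow> 'a \<Rightarrow> real" and c \<eta>
    using that by (intro order_tendstoD(2)[of _ 0]) (auto simp: conv_in_prob_def)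
  \<comment> \<open>Scheffe's argument: \<open>\<bar>a - 1\<bar>\<close> is
    \<open>(a - 1) + 2 * max 0 (1 - a)\<close>. The mean of the first part is bounded through the
    second moment of the martingale; for \<open>a \<ge> 0\<close> the second part is small outside
    the event \<open>B\<close> and at most 2 on it.\<close>
  have A_L1: "\<forall>\<^sub>F n in sequentially. expectation (\<lambda>x. \<bar>A n x - 1\<bar>) \<le> \<delta>" if \<delta>: "\<delta> > 0" for \<delta>
  proof -
    define \<theta> where "\<theta> = \<delta> / 8"
    have \<theta>: "\<theta> > 0" using \<delta> by (simp add: \<theta>_def)
    \<comment> \<open>Chosen so that the approximation error, multiplied by the large factor
      \<open>1 + 1 / \<theta>\<close>, is still \<theta>.\<close>
    define r where "r = \<theta> / (1 + 1 / \<theta>)"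
    have "1 + 1 / \<theta> > 0" using \<theta> by (simp add: add_pos_pos)
    then have r: "r > 0" "(1 + 1 / \<theta>) * r = \<theta>" using \<theta> by (auto simp: r_def)
    show ?thesis
      using good approx[OF r(1)] small_prob[OF var \<theta>]
    proof eventually_elim
      case (elim n)
      let ?M = "\<lambda>x. \<Sum>k<n. d n k x"
      define B where "B = {x \<in> space M. \<bar>A n x - 1\<bar> \<ge> \<theta>}"
      have M2: "in_L2 M ?M" by (rule in_L2_sum) (use elim in \<open>simp add: good_def\<close>)
      have [measurable]: "A n \<in> borel_measurable M" using A_int[OF elim(1)] by simp
      have Bm: "B \<in> sets M" unfolding B_def by measurable
      have PB: "prob B < \<theta>" using elim(3) by (simp add: B_def A_def)
      have vn: "v n > 0" using elim by (simp add: good_def)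
      have "expectation (\<lambda>x. (?M x)\<^sup>2) = expectation (\<lambda>x. (S n x + - 1 * (S n x - ?M x))\<^sup>2)" by simp
      also have "\<dots> \<le> (1 + \<theta>) * expectation (\<lambda>x. (S n x)\<^sup>2) + (1 + 1 / \<theta>) * expectation (\<lambda>x. (- 1 * (S n x - ?M x))\<^sup>2)"
        by (rule expectation_sum_sq_le'[OF S(1) in_L2_cmult[OF in_L2_diff[OF S(1) M2]] \<theta>])
      also have "\<dots> = (1 + \<theta>) * v n + (1 + 1 / \<theta>) * expectation (\<lambda>x. (S n x - ?M x)\<^sup>2)"
      proof -
        have "(- 1 * y)\<^sup>2 = y\<^sup>2" for y :: real by simp
        then show ?thesis by (simp only: S(2))
      qed
      also have "\<dots> \<le> (1 + \<theta>) * v n + (1 + 1 / \<theta>) * (r * v n)"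
        using elim \<theta> by (intro add_left_mono mult_left_mono) auto
      also have "\<dots> = (1 + 2 * \<theta>) * v n"
        unfolding mult.assoc[symmetric] r(2) by (simp add: algebra_simps)
      finally have "expectation (\<lambda>x. (?M x)\<^sup>2) \<le> (1 + 2 * \<theta>) * v n" .
      moreover have "expectation (\<lambda>x. (?M x)\<^sup>2) = (\<Sum>k<n. expectation (\<lambda>x. (d n k x)\<^sup>2))"
        by (rule orthogonal_sum) (use elim in \<open>auto simp: good_def\<close>)
      ultimately have "v n * expectation (A n) \<le> v n * (1 + 2 * \<theta>)"
        using EA[OF elim(1)] vn by (simp add: mult.commute)
      then have EA1: "expectation (A n) \<le> 1 + 2 * \<theta>" using vn by (rule mult_left_le_imp_le)
      have "expectation (\<lambda>x. \<bar>A n x - 1\<bar>) \<le> expectation (\<lambda>x. (A n x - 1) + 2 * (\<theta> + indicator B x))"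
      proof (rule integral_mono_AE)
        show "integrable M (\<lambda>x. \<bar>A n x - 1\<bar>)" using A_int[OF elim(1)] by simp
        show "integrable M (\<lambda>x. (A n x - 1) + 2 * (\<theta> + indicator B x))"
          using A_int[OF elim(1)] Bm by (auto simp: less_top[symmetric])
        have "AE x in M. x \<in> space M" by simp
        with A_nonneg[OF elim(1)] show "AE x in M. \<bar>A n x - 1\<bar> \<le> (A n x - 1) + 2 * (\<theta> + indicator B x)"
        proof eventually_elim
          case (elim x)
          then show ?case using \<theta> by (cases "x \<in> B") (auto simp: B_def indicator_def)
        qed
      qed
      also have "\<dots> = expectation (A n) - 1 + 2 * (\<theta> + prob B)"
        using A_int[OF elim(1)] Bm by (simp add: prob_space less_top[symmetric])
      also have "\<dots> \<le> 2 * \<theta> + 2 * (\<theta> + \<theta>)" using EA1 PB by simp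
      finally show "expectation (\<lambda>x. \<bar>A n x - 1\<bar>) \<le> \<delta>" using \<delta> by (simp add: \<theta>_def)
    qed
  qed
  \<comment> \<open>Outside \<open>B\<close> the sum is below \<open>\<delta> / 3\<close>; on
    \<open>B\<close> it is at most \<open>A n\<close>, hence at most
    \<open>1 + \<bar>A n - 1\<bar>\<close>.\<close>
  have L_L1: "\<forall>\<^sub>F n in sequentially. expectation (L \<epsilon> n) \<le> \<delta>" if \<delta>: "\<delta> > 0" and \<epsilon>: "\<epsilon> > 0" for \<delta> \<epsilon>
  proof -
    have \<delta>3: "\<delta> / 3 > 0" using \<delta> by simp
    have sp: "\<forall>\<^sub>F n in sequentially. prob {x \<in> space M. \<bar>L \<epsilon> n x - 0\<bar> \<ge> \<delta> / 3} < \<delta> / 3"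
      unfolding L_def l_def[abs_def] by (rule small_prob[OF lind[OF \<epsilon>] \<delta>3])
    show ?thesis
      using good A_L1[OF \<delta>3] sp
    proof eventually_elim
      case (elim n)
      define B where "B = {x \<in> space M. \<bar>L \<epsilon> n x\<bar> \<ge> \<delta> / 3}"
      have [measurable]: "L \<epsilon> n \<in> borel_measurable M" using L_int[OF elim(1)] by simp
      have Bm: "B \<in> sets M" unfolding B_def by measurable
      have PB: "prob B < \<delta> / 3" using elim(3) by (simp add: B_def)
      have "expectation (L \<epsilon> n) \<le> expectation (\<lambda>x. \<delta> / 3 + indicator B x + \<bar>A n x - 1\<bar>)"
      proof (rule integral_mono_AE[OF L_int[OF elim(1)]])
        show "integrable M (\<lambda>x. \<delta> / 3 + indicator B x + \<bar>A n x - 1\<bar>)"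
          using A_int[OF elim(1)] Bm by (auto simp: less_top[symmetric])
        have "AE x in M. x \<in> space M" by simp
        with L_le[OF elim(1), of \<epsilon>] show "AE x in M. L \<epsilon> n x \<le> \<delta> / 3 + indicator B x + \<bar>A n x - 1\<bar>"
        proof eventually_elim
          case (elim x)
          then show ?case using \<delta> by (cases "x \<in> B") (auto simp: B_def indicator_def)
        qed
      qed
      also have "\<dots> = \<delta> / 3 + prob B + expectation (\<lambda>x. \<bar>A n x - 1\<bar>)"
        using A_int[OF elim(1)] Bm by (simp add: prob_space less_top[symmetric])
      also have "\<dots> \<le> \<delta>" using PB elim(2) by linarith
      finally show "expectation (L \<epsilon> n) \<le> \<delta>" .
    qed
  qed
  define q where "q n = (\<integral>x. of_real (h n x) * (iexp (t * (S n x / sqrt (v n))) - of_real (exp (- (t\<^sup>2 / 2)))) \<partial>M)" for n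
  have bound: "cmod (q n) \<le> exp (t\<^sup>2 / 2) * ((t\<^sup>2 + t^4) * expectation (L \<epsilon> n) + \<bar>t\<bar>^3 * \<epsilon> * (1 + expectation (\<lambda>x. \<bar>A n x - 1\<bar>))
        + 2 * t\<^sup>2 * expectation (\<lambda>x. \<bar>A n x - 1\<bar>) + t^4 * \<epsilon>\<^sup>2) + \<bar>t\<bar> * \<eta>"
    if n: "good n" and \<epsilon>: "\<epsilon> > 0" and \<eta>: "\<eta> \<ge> 0" "expectation (\<lambda>x. (S n x - (\<Sum>k<n. d n k x))\<^sup>2) \<le> \<eta>\<^sup>2 * v n" for n \<epsilon> \<eta>
  proof -
    define r where "r = sqrt (v n)"
    have r: "r > 0" "r\<^sup>2 = v n" using n by (auto simp: r_def good_def)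
    define D where "D k x = 1 / r * d n k x" for k x
    \<comment> \<open>A version of the conditional variance that is nonnegative at every point, as
      \<open>martingale_clt_bound\<close> demands.\<close>
    define V where "V k x = max 0 (CE k (\<lambda>x. (D k x)\<^sup>2) x)" for k x
    have DL2: "in_L2 M (D k)" if "k < n" for k
      unfolding D_def[abs_def] by (rule in_L2_cmult) (use n that in \<open>simp add: good_def\<close>)
    have DF: "D k \<in> borel_measurable (F (Suc k))" if "k < n" for k
      unfolding D_def[abs_def] using n that by (auto simp: good_def)
    have D0: "AE x in M. CE k (D k) x = 0" if "k < n" for k
    proof -
      have "AE x in M. CE k (D k) x = 1 / r * CE k (d n k) x"
        unfolding D_def[abs_def] by (rule F.real_cond_exp_cmult) (use n that in_L2_integrable in \<open>simp add: good_def\<close>)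
      moreover have "AE x in M. CE k (d n k) x = 0" using n that by (simp add: good_def)
      ultimately show ?thesis by eventually_elim simp
    qed
    have VF: "V k \<in> borel_measurable (F k)" for k unfolding V_def[abs_def] by simp
    have VD: "AE x in M. CE k (\<lambda>x. (D k x)\<^sup>2) x = V k x" if "k < n" for k
    proof -
      have "AE x in M. 0 \<le> CE k (\<lambda>x. (D k x)\<^sup>2) x"
        by (rule F.real_cond_exp_pos) (use DL2[OF that] in \<open>auto simp: in_L2_def\<close>)
      then show ?thesis by eventually_elim (simp add: V_def)
    qed
    have VA: "AE x in M. (\<Sum>k<n. V k x) = A n x"
    proof -
      have "AE x in M. k < n \<longrightarrow> V k x = 1 / v n * CE k (\<lambda>x. (d n k x)\<^sup>2) x" for k
      proof (cases "k < n")
        case True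
        have "AE x in M. CE k (\<lambda>x. 1 / v n * (d n k x)\<^sup>2) x = 1 / v n * CE k (\<lambda>x. (d n k x)\<^sup>2) x"
          by (rule F.real_cond_exp_cmult[OF d2[OF n True]])
        moreover have "(\<lambda>x. (D k x)\<^sup>2) = (\<lambda>x. 1 / v n * (d n k x)\<^sup>2)"
          by (simp add: D_def power_mult_distrib power_divide r fun_eq_iff)
        ultimately show ?thesis using VD[OF True] by (auto elim!: eventually_elim2)
      qed simp
      then have "AE x in M. \<forall>k. k < n \<longrightarrow> V k x = 1 / v n * CE k (\<lambda>x. (d n k x)\<^sup>2) x"
        by (simp add: AE_all_countable)
      then show ?thesis by eventually_elim (simp add: A_def sum_distrib_left)
    qed
    have Vm: "(\<lambda>x. \<Sum>k<n. V k x) \<in> borel_measurable M" using measurable_F[OF VF] by simp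
    have Am: "A n \<in> borel_measurable M" using A_int[OF n] by simp
    have EV: "expectation (\<lambda>x. \<Sum>k<n. V k x) = expectation (A n)"
      by (rule integral_cong_AE[OF Vm Am VA])
    have EV1: "expectation (\<lambda>x. \<bar>(\<Sum>k<n. V k x) - 1\<bar>) = expectation (\<lambda>x. \<bar>A n x - 1\<bar>)"
    proof (rule integral_cong_AE)
      show "AE x in M. \<bar>(\<Sum>k<n. V k x) - 1\<bar> = \<bar>A n x - 1\<bar>" using VA by eventually_elim simp
    qed (use Vm Am in auto)
    have ELD: "(\<Sum>k<n. expectation (\<lambda>x. (D k x)\<^sup>2 * indicator {y. \<epsilon> \<le> \<bar>y\<bar>} (D k x))) = expectation (L \<epsilon> n)"
    proof -
      have "(D k x)\<^sup>2 * indicator {y. \<epsilon> \<le> \<bar>y\<bar>} (D k x) = 1 / v n * l \<epsilon> n k x" for k x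
        using r by (simp add: D_def l_def power_mult_distrib power_divide indicator_def abs_mult r_def[symmetric] field_simps)
      then show ?thesis by (simp add: EL[OF n] sum_distrib_left)
    qed
    have "cmod (\<integral>x. of_real (h n x) * (iexp (t * (\<Sum>k<n. D k x)) - of_real (exp (- (t\<^sup>2 / 2)))) \<partial>M)
      \<le> exp (t\<^sup>2 / 2) * ((t\<^sup>2 + t^4) * expectation (L \<epsilon> n) + \<bar>t\<bar>^3 * \<epsilon> * expectation (A n)
        + 2 * t\<^sup>2 * expectation (\<lambda>x. \<bar>A n x - 1\<bar>) + t^4 * \<epsilon>\<^sup>2)"
      unfolding EV[symmetric] EV1[symmetric] ELD[symmetric]
      by (rule martingale_clt_bound) (use DL2 DF D0 VF VD h \<epsilon> in \<open>auto simp: V_def\<close>)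
    also have "\<dots> \<le> exp (t\<^sup>2 / 2) * ((t\<^sup>2 + t^4) * expectation (L \<epsilon> n) + \<bar>t\<bar>^3 * \<epsilon> * (1 + expectation (\<lambda>x. \<bar>A n x - 1\<bar>))
        + 2 * t\<^sup>2 * expectation (\<lambda>x. \<bar>A n x - 1\<bar>) + t^4 * \<epsilon>\<^sup>2)"
    proof (intro mult_left_mono add_mono order_refl)
      have "expectation (A n) \<le> expectation (\<lambda>x. 1 + \<bar>A n x - 1\<bar>)"
        using A_int[OF n] by (intro integral_mono) auto
      then show "expectation (A n) \<le> 1 + expectation (\<lambda>x. \<bar>A n x - 1\<bar>)"
        using A_int[OF n] by (simp add: prob_space)
    qed (use \<epsilon> in auto)
    finally have main: "cmod (\<integral>x. of_real (h n x) * (iexp (t * (\<Sum>k<n. D k x)) - of_real (exp (- (t\<^sup>2 / 2)))) \<partial>M) \<le> \<dots>" .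
    have [measurable]: "h n \<in> borel_measurable M" using measurable_F[OF h(1)] .
    have [measurable]: "S n \<in> borel_measurable M" using S(1) by (simp add: in_L2_def)
    have Z: "in_L2 M (\<lambda>x. \<Sum>k<n. D k x)" by (rule in_L2_sum) (use DL2 in auto)
    then have [measurable]: "(\<lambda>x. \<Sum>k<n. D k x) \<in> borel_measurable M" by (simp add: in_L2_def)
    have hb: "integrable M (\<lambda>x. of_real (h n x) * (iexp (t * y x) - of_real (exp (- (t\<^sup>2 / 2)))))"
      if [measurable]: "y \<in> borel_measurable M" for y
    proof (rule integrable_const_bound[where B = 2])
      show "AE x in M. norm (of_real (h n x) * (iexp (t * y x) - of_real (exp (- (t\<^sup>2 / 2))))) \<le> 2"
      proof (rule AE_I2)
        fix x
        have "norm (of_real (h n x) * (iexp (t * y x) - of_real (exp (- (t\<^sup>2 / 2))))) \<le> 1 * (1 + 1)"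
          unfolding norm_mult
        proof (intro mult_mono)
          show "norm (iexp (t * y x) - of_real (exp (- (t\<^sup>2 / 2)))) \<le> 1 + 1"
            by (rule order_trans[OF norm_triangle_ineq4]) (intro add_mono; simp)
        qed (use h in auto)
        then show "norm (of_real (h n x) * (iexp (t * y x) - of_real (exp (- (t\<^sup>2 / 2))))) \<le> 2" by simp
      qed
    qed measurable
    \<comment> \<open>\<open>exp (i t x)\<close> is Lipschitz in \<open>x\<close> with constant
      \<open>\<bar>t\<bar>\<close>, so replacing \<open>S n\<close> by the martingale costs the L1
      norm of the normalised error.\<close>
    have diff: "cmod (q n - (\<integral>x. of_real (h n x) * (iexp (t * (\<Sum>k<n. D k x)) - of_real (exp (- (t\<^sup>2 / 2)))) \<partial>M)) \<le> \<bar>t\<bar> * \<eta>"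
    proof -
      let ?R = "\<lambda>x. S n x / r - (\<Sum>k<n. D k x)"
      have RL2: "in_L2 M ?R" using in_L2_diff[OF in_L2_cmult[OF S(1), of "1 / r" n] Z] by simp
      have Req: "?R x = 1 / r * (S n x - (\<Sum>k<n. d n k x))" for x
        by (simp add: D_def sum_divide_distrib[symmetric] diff_divide_distrib)
      have "expectation (\<lambda>x. (?R x)\<^sup>2) = 1 / v n * expectation (\<lambda>x. (S n x - (\<Sum>k<n. d n k x))\<^sup>2)"
        unfolding Req by (simp add: power_mult_distrib power_divide r)
      also have "\<dots> \<le> 1 / v n * (\<eta>\<^sup>2 * v n)" using \<eta> n by (intro mult_left_mono) (auto simp: good_def)
      also have "\<dots> = \<eta>\<^sup>2" using n by (simp add: good_def)
      finally have ER: "expectation (\<lambda>x. \<bar>?R x\<bar>) \<le> \<eta>" by (rule expectation_abs_le[OF RL2 _ \<eta>(1)])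
      have "q n - (\<integral>x. of_real (h n x) * (iexp (t * (\<Sum>k<n. D k x)) - of_real (exp (- (t\<^sup>2 / 2)))) \<partial>M)
        = (\<integral>x. of_real (h n x) * (iexp (t * (S n x / r)) - of_real (exp (- (t\<^sup>2 / 2)))) -
             of_real (h n x) * (iexp (t * (\<Sum>k<n. D k x)) - of_real (exp (- (t\<^sup>2 / 2)))) \<partial>M)"
        unfolding q_def r_def[symmetric] by (intro Bochner_Integration.integral_diff[symmetric] hb) measurable
      also have "cmod \<dots> \<le> expectation (\<lambda>x. \<bar>t\<bar> * \<bar>?R x\<bar>)"
      proof (rule order_trans[OF integral_norm_bound integral_mono])
        fix x
        have "cmod (of_real (h n x) * (iexp (t * (S n x / r)) - of_real (exp (- (t\<^sup>2 / 2)))) -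
             of_real (h n x) * (iexp (t * (\<Sum>k<n. D k x)) - of_real (exp (- (t\<^sup>2 / 2)))))
          = \<bar>h n x\<bar> * cmod (iexp (t * (S n x / r)) - iexp (t * (\<Sum>k<n. D k x)))"
          unfolding right_diff_distrib[symmetric] norm_mult by simp
        also have "\<dots> \<le> 1 * \<bar>t * (S n x / r) - t * (\<Sum>k<n. D k x)\<bar>"
        proof (intro mult_mono)
          have e: "iexp a - iexp b = iexp b * (iexp (a - b) - 1)" for a b :: real
            unfolding right_diff_distrib exp_add[symmetric] by (simp add: algebra_simps)
          have "iexp (t * (S n x / r)) - iexp (t * (\<Sum>k<n. D k x)) = iexp (t * (\<Sum>k<n. D k x)) * (iexp (t * ?R x) - 1)"
            using e[of "t * (S n x / r)" "t * (\<Sum>k<n. D k x)"] by (simp only: right_diff_distrib)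
          then have "cmod (iexp (t * (S n x / r)) - iexp (t * (\<Sum>k<n. D k x))) = cmod (iexp (t * ?R x) - 1)"
            by (simp add: norm_mult)
          also have "\<dots> \<le> \<bar>t * ?R x\<bar>"
            using iexp_approx1[of "t * ?R x" 0] by simp
          finally show "cmod (iexp (t * (S n x / r)) - iexp (t * (\<Sum>k<n. D k x))) \<le> \<bar>t * (S n x / r) - t * (\<Sum>k<n. D k x)\<bar>"
            by (simp add: algebra_simps)
        qed (use h in auto)
        also have "\<dots> = \<bar>t\<bar> * \<bar>?R x\<bar>" by (simp add: abs_mult[symmetric] right_diff_distrib)
        finally show "cmod (of_real (h n x) * (iexp (t * (S n x / r)) - of_real (exp (- (t\<^sup>2 / 2)))) -
             of_real (h n x) * (iexp (t * (\<Sum>k<n. D k x)) - of_real (exp (- (t\<^sup>2 / 2))))) \<le> \<bar>t\<bar> * \<bar>?R x\<bar>" .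
      next
        show "integrable M (\<lambda>x. cmod (of_real (h n x) * (iexp (t * (S n x / r)) - of_real (exp (- (t\<^sup>2 / 2)))) -
             of_real (h n x) * (iexp (t * (\<Sum>k<n. D k x)) - of_real (exp (- (t\<^sup>2 / 2))))))"
          by (intro integrable_norm Bochner_Integration.integrable_diff hb) measurable
        show "integrable M (\<lambda>x. \<bar>t\<bar> * \<bar>?R x\<bar>)" using in_L2_integrable[OF RL2] by simp
      qed
      also have "\<dots> = \<bar>t\<bar> * expectation (\<lambda>x. \<bar>?R x\<bar>)" by simp
      also have "\<dots> \<le> \<bar>t\<bar> * \<eta>" by (intro mult_left_mono ER) simp
      finally show ?thesis .
    qed
    have "cmod (q n) \<le> cmod (\<integral>x. of_real (h n x) * (iexp (t * (\<Sum>k<n. D k x)) - of_real (exp (- (t\<^sup>2 / 2)))) \<partial>M) +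
      cmod (q n - (\<integral>x. of_real (h n x) * (iexp (t * (\<Sum>k<n. D k x)) - of_real (exp (- (t\<^sup>2 / 2)))) \<partial>M))"
      by (rule norm_triangle_sub)
    then show ?thesis using main diff by linarith
  qed
  have "q \<longlonglongrightarrow> 0"
  proof (rule tendsto_norm_zero_cancel, rule tendstoI)
    fix \<delta> :: real assume \<delta>: "\<delta> > 0"
    define c where "c = exp (t\<^sup>2 / 2) * (t\<^sup>2 + t^4 + 2 * \<bar>t\<bar>^3 + 2 * t\<^sup>2 + t^4) + \<bar>t\<bar>"
    have c: "c \<ge> 0" by (simp add: c_def)
    define \<epsilon> where "\<epsilon> = min 1 (\<delta> / (2 * (c + 1)))"
    have \<epsilon>: "\<epsilon> > 0" "\<epsilon> \<le> 1" using \<delta> c by (auto simp: \<epsilon>_def)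
    have \<epsilon>2: "\<epsilon>\<^sup>2 > 0" using \<epsilon> by simp
    show "\<forall>\<^sub>F n in sequentially. dist (cmod (q n)) 0 < \<delta>"
      using good A_L1[OF \<epsilon>(1)] L_L1[OF \<epsilon>(1) \<epsilon>(1)] approx[OF \<epsilon>2]
    proof eventually_elim
      case (elim n)
      have "cmod (q n) \<le> exp (t\<^sup>2 / 2) * ((t\<^sup>2 + t^4) * expectation (L \<epsilon> n) + \<bar>t\<bar>^3 * \<epsilon> * (1 + expectation (\<lambda>x. \<bar>A n x - 1\<bar>))
        + 2 * t\<^sup>2 * expectation (\<lambda>x. \<bar>A n x - 1\<bar>) + t^4 * \<epsilon>\<^sup>2) + \<bar>t\<bar> * \<epsilon>"
        by (rule bound[OF elim(1) \<epsilon>(1) less_imp_le[OF \<epsilon>(1)] elim(4)])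
      also have "\<dots> \<le> exp (t\<^sup>2 / 2) * ((t\<^sup>2 + t^4) * \<epsilon> + \<bar>t\<bar>^3 * \<epsilon> * (1 + 1)
        + 2 * t\<^sup>2 * \<epsilon> + t^4 * \<epsilon>) + \<bar>t\<bar> * \<epsilon>"
        using elim \<epsilon> by (intro add_mono mult_left_mono order_refl) (auto simp: power2_eq_square mult_le_one)
      also have "\<dots> = c * \<epsilon>" by (simp add: c_def algebra_simps)
      also have "\<dots> \<le> c * (\<delta> / (2 * (c + 1)))" using c by (intro mult_left_mono) (simp_all add: \<epsilon>_def)
      also have "\<dots> < \<delta>"
      proof -
        have "c * \<delta> < (2 * (c + 1)) * \<delta>" using c \<delta> by (intro mult_strict_right_mono) auto
        then show ?thesis using c by (simp add: divide_less_eq mult.commute)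
      qed
      finally show "dist (cmod (q n)) 0 < \<delta>" by simp
    qed
  qed
  then show ?thesis unfolding q_def .
qed

end

section \<open>Stationary Markov chains\<close>

lemma space_process_algebra [simp]: "space (process_algebra P S X I) = space P"
  unfolding process_algebra_def by (rule space_measure_of) auto

lemma sets_process_algebra:
  "sets (process_algebra P S X I) = sigma_sets (space P) (\<Union>i\<in>I. {X i -` B \<inter> space P | B. B \<in> sets S})"
  unfolding process_algebra_def by (rule sets_measure_of) auto

lemma sets_process_algebra_mono: "I \<subseteq> J \<Longrightarrow> sets (process_algebra P S X I) \<subseteq> sets (process_algebra P S X J)"
  unfolding sets_process_algebra by (rule sigma_sets_mono') auto

lemma process_algebra_generator:
  "i \<in> I \<Longrightarrow> B \<in> sets S \<Longrightarrow> X i -` B \<inter> space P \<in> sets (process_algebra P S X I)"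
  unfolding sets_process_algebra by (rule sigma_sets.Basic) auto

lemma measurable_process_algebra:
  assumes "X i \<in> P \<rightarrow>\<^sub>M S" "i \<in> I" shows "X i \<in> process_algebra P S X I \<rightarrow>\<^sub>M S"
  by (rule measurableI) (use assms measurable_space[OF assms(1)] process_algebra_generator[OF assms(2), of _ S X P] in auto)

lemma subalgebra_process_algebra:
  assumes "\<And>i. i \<in> I \<Longrightarrow> X i \<in> P \<rightarrow>\<^sub>M S" shows "subalgebra P (process_algebra P S X I)"
  unfolding subalgebra_def sets_process_algebra
  using assms by (auto intro!: sets.sigma_sets_subset measurable_sets)

lemma subalgebra_vimage_process_algebra:
  assumes "X i \<in> P \<rightarrow>\<^sub>M S" "i \<in> I"
  shows "subalgebra (process_algebra P S X I) (vimage_algebra (space P) (X i) S)"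
  unfolding subalgebra_def
proof
  show "sets (vimage_algebra (space P) (X i) S) \<subseteq> sets (process_algebra P S X I)"
    using assms measurable_space[OF assms(1)] process_algebra_generator[OF assms(2), of _ S X P]
    by (subst sets_vimage_algebra2) auto
qed simp

abbreviation canonical_algebra :: "'s measure \<Rightarrow> int set \<Rightarrow> (int \<Rightarrow> 's) measure" where
  "canonical_algebra S I \<equiv> process_algebra (PiM UNIV (\<lambda>_. S)) S (\<lambda>n x. x n) I"

text \<open>\<open>Q\<close> and \<open>Px\<close> are conditional laws given \<open>X 0\<close>
  alone. Conditioning on the whole past is obtained from \<open>markov\<close>, and starting times
  other than 0 from \<open>stationary\<close>.\<close>

locale stationary_markov_chain = prob_space P for P :: "'w measure" +
  fixes S :: "'s measure" and X :: "int \<Rightarrow> 'w \<Rightarrow> 's" and Q :: "'s \<Rightarrow> 's measure" and Px :: "'s \<Rightarrow> 'w measure"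
  assumes X_meas [measurable]: "\<And>n. X n \<in> P \<rightarrow>\<^sub>M S"
    and stationary: "stationary_process P S X"
    and markov: "markov_process P S X"
    and kernel: "regular_cond_distr P (X 0) S (X 1) S Q"
    and disintegration: "regular_cond_distr P (X 0) S (\<lambda>\<omega>. \<omega>) (process_algebra P S X UNIV) Px"
begin

abbreviation past :: "int \<Rightarrow> 'w measure" where "past j \<equiv> past_algebra P S X j"

abbreviation paths :: "(int \<Rightarrow> 's) measure" where "paths \<equiv> PiM UNIV (\<lambda>_. S)"

section \<open>Transport of events and integrals by the time shift\<close>

definition shifted :: "int \<Rightarrow> 'w \<Rightarrow> int \<Rightarrow> 's" where
  "shifted s \<omega> = (\<lambda>n. X (n + s) \<omega>)"

lemma shifted_measurable [measurable]: "shifted s \<in> P \<rightarrow>\<^sub>M paths"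
  unfolding shifted_def by (rule measurable_PiM_single') (auto intro: measurable_space[OF X_meas])

lemma shifted_law: "distr P paths (shifted (int s)) = distr P paths (shifted 0)"
proof (induction s)
  case (Suc s)
  define \<theta> :: "(int \<Rightarrow> 's) \<Rightarrow> int \<Rightarrow> 's" where "\<theta> x = (\<lambda>n. x (n + int s))" for x
  have \<theta> [measurable]: "\<theta> \<in> paths \<rightarrow>\<^sub>M paths"
    unfolding \<theta>_def by (rule measurable_PiM_single') (auto simp: space_PiM PiE_def)
  have "distr P paths (shifted (int (Suc s))) = distr (distr P paths (shifted 1)) paths \<theta>"
    unfolding distr_distr[OF \<theta> shifted_measurable]
    by (simp add: shifted_def[abs_def] \<theta>_def o_def algebra_simps)
  also have "distr P paths (shifted 1) = distr P paths (shifted 0)"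
    using stationary by (simp add: stationary_process_def path_law_def shifted_def[abs_def])
  also have "distr (distr P paths (shifted 0)) paths \<theta> = distr P paths (shifted (int s))"
    unfolding distr_distr[OF \<theta> shifted_measurable]
    by (simp add: shifted_def[abs_def] \<theta>_def o_def algebra_simps)
  finally show ?case using Suc by simp
qed simp

lemma shift_nn_integral:
  assumes "f \<in> borel_measurable paths"
  shows "(\<integral>\<^sup>+\<omega>. f (shifted (int s) \<omega>) \<partial>P) = (\<integral>\<^sup>+\<omega>. f (shifted 0 \<omega>) \<partial>P)"
proof -
  have "(\<integral>\<^sup>+\<omega>. f (shifted (int s) \<omega>) \<partial>P) = (\<integral>\<^sup>+x. f x \<partial>distr P paths (shifted (int s)))"
    by (rule nn_integral_distr[symmetric]) (use assms in auto)
  also have "\<dots> = (\<integral>\<^sup>+\<omega>. f (shifted 0 \<omega>) \<partial>P)"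
    unfolding shifted_law by (rule nn_integral_distr) (use assms in auto)
  finally show ?thesis .
qed

lemma shift_integral:
  fixes f :: "(int \<Rightarrow> 's) \<Rightarrow> real"
  assumes "f \<in> borel_measurable paths"
  shows "(\<integral>\<omega>. f (shifted (int s) \<omega>) \<partial>P) = (\<integral>\<omega>. f (shifted 0 \<omega>) \<partial>P)"
proof -
  have "(\<integral>\<omega>. f (shifted (int s) \<omega>) \<partial>P) = (\<integral>x. f x \<partial>distr P paths (shifted (int s)))"
    by (rule integral_distr[symmetric]) (use assms in auto)
  also have "\<dots> = (\<integral>\<omega>. f (shifted 0 \<omega>) \<partial>P)"
    unfolding shifted_law by (rule integral_distr) (use assms in auto)
  finally show ?thesis .
qed

text \<open>The pull-backs of canonical path events under a shift are closed under the sigma-algebra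
  operations and contain the generators. This is how an identity known at time 0 gets tested against
  past events of a later time.\<close>

lemma sets_past_shift:
  assumes "A \<in> sets (past s)"
  obtains C where "C \<in> sets (canonical_algebra S {..0})" "A = shifted s -` C \<inter> space P"
proof -
  have "A \<in> sigma_sets (space P) (\<Union>i\<in>{..s}. {X i -` B \<inter> space P | B. B \<in> sets S})"
    using assms by (simp add: sets_process_algebra)
  then have "\<exists>C\<in>sets (canonical_algebra S {..0}). A = shifted s -` C \<inter> space P"
  proof induction
    case (Basic A)
    then obtain i B where iB: "i \<le> s" "B \<in> sets S" "A = X i -` B \<inter> space P" by auto
    let ?C = "(\<lambda>x. x (i - s)) -` B \<inter> space paths"
    have "?C \<in> sets (canonical_algebra S {..0})"
      by (rule process_algebra_generator) (use iB in auto)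
    moreover have "A = shifted s -` ?C \<inter> space P"
      using iB measurable_space[OF shifted_measurable[of s]] by (auto simp: shifted_def)
    ultimately show ?case by blast
  next
    case Empty
    show ?case by (intro bexI[of _ "{}"]) auto
  next
    case (Compl A)
    then obtain C where C: "C \<in> sets (canonical_algebra S {..0})" "A = shifted s -` C \<inter> space P" by blast
    have "space P - A = shifted s -` (space (canonical_algebra S {..0}) - C) \<inter> space P"
      using C measurable_space[OF shifted_measurable[of s]] by auto
    then show ?case using C by blast
  next
    case (Union A)
    then have "\<forall>i. \<exists>C. C \<in> sets (canonical_algebra S {..0}) \<and> A i = shifted s -` C \<inter> space P" by blast
    then obtain C where C: "\<And>i. C i \<in> sets (canonical_algebra S {..0})" "\<And>i. A i = shifted s -` C i \<inter> space P"
      by metis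
    have "(\<Union>i. A i) = shifted s -` (\<Union>i. C i) \<inter> space P" using C(2) by auto
    moreover have "(\<Union>i. C i) \<in> sets (canonical_algebra S {..0})" using C(1) by auto
    ultimately show ?case by blast
  qed
  then show thesis using that by blast
qed

text \<open>Used at \<open>s = 0\<close>: the path event attached to the past of a later time is
  turned into an event of the past of 0.\<close>

lemma shift_vimage_past:
  assumes "C \<in> sets (canonical_algebra S {..0})"
  shows "shifted s -` C \<inter> space P \<in> sets (past s)" "C \<in> sets paths"
proof -
  have sub: "subalgebra paths (canonical_algebra S {..0})"
    by (rule subalgebra_process_algebra) (auto intro: measurable_component_singleton)
  then show "C \<in> sets paths" using assms by (auto simp: subalgebra_def)
  have "shifted s \<in> past s \<rightarrow>\<^sub>M canonical_algebra S {..0}"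
    unfolding process_algebra_def[of paths]
  proof (rule measurable_measure_of)
    show "shifted s \<in> space (past s) \<rightarrow> space paths"
      using measurable_space[OF shifted_measurable] by auto
    fix Y assume "Y \<in> (\<Union>i\<in>{..0}. {(\<lambda>x. x i) -` B \<inter> space paths |B. B \<in> sets S})"
    then obtain i B where iB: "i \<le> 0" "B \<in> sets S" "Y = (\<lambda>x. x i) -` B \<inter> space paths" by auto
    have "shifted s -` Y \<inter> space P = X (i + s) -` B \<inter> space P"
      using iB measurable_space[OF shifted_measurable[of s]] by (auto simp: shifted_def)
    also have "\<dots> \<in> sets (past s)" by (rule process_algebra_generator) (use iB in auto)
    finally show "shifted s -` Y \<inter> space (past s) \<in> sets (past s)" by simp
  qed auto
  from measurable_sets[OF this assms] show "shifted s -` C \<inter> space P \<in> sets (past s)" by simp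
qed

lemma past_subalgebra: "subalgebra P (past s)" by (rule subalgebra_process_algebra) simp

lemma past_sets: "A \<in> sets (past s) \<Longrightarrow> A \<in> sets P" using past_subalgebra by (auto simp: subalgebra_def)

lemma past_filtered: "filtered_prob_space P (\<lambda>k. past (int k))"
proof
  show "subalgebra P (past (int k))" for k by (rule past_subalgebra)
  show "sets (past (int i)) \<subseteq> sets (past (int j))" if "i \<le> j" for i j
    by (rule sets_process_algebra_mono) (use that in auto)
qed

section \<open>Conditional probabilities as integral identities\<close>

lemma cond_exp_indicator_nn:
  assumes sub: "subalgebra P G" and E: "E \<in> sets P" and A: "A \<in> sets G"
    and r: "AE \<omega> in P. real_cond_exp P G (indicator E) \<omega> = r \<omega>" "r \<in> borel_measurable P" "\<And>\<omega>. 0 \<le> r \<omega>"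
  shows "emeasure P (A \<inter> E) = (\<integral>\<^sup>+\<omega>. ennreal (r \<omega>) * indicator A \<omega> \<partial>P)"
proof -
  interpret G: finite_measure_subalgebra P G
    using sub by (simp add: finite_measure_subalgebra_def finite_measure_subalgebra_axioms_def finite_measure_axioms)
  have AP: "A \<in> sets P" using A sub by (auto simp: subalgebra_def)
  have iE: "integrable P (indicator E :: 'w \<Rightarrow> real)" using E by (simp add: less_top[symmetric])
  have ir: "integrable P r"
    by (rule integrable_cong_AE_imp[OF G.real_cond_exp_int(1)[OF iE]]) (use r in auto)
  have "prob (A \<inter> E) = (\<integral>\<omega>. indicator A \<omega> * indicator E \<omega> \<partial>P)"
    using AP E by (simp add: indicator_inter_arith[symmetric])
  also have "\<dots> = (\<integral>\<omega>. indicator A \<omega> * real_cond_exp P G (indicator E) \<omega> \<partial>P)"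
    by (rule G.real_cond_exp_intg(2)[symmetric])
       (use AP A E in \<open>auto simp: indicator_inter_arith[symmetric] less_top[symmetric]\<close>)
  also have "\<dots> = (\<integral>\<omega>. r \<omega> * indicator A \<omega> \<partial>P)"
  proof (rule integral_cong_AE)
    show "AE \<omega> in P. indicator A \<omega> * real_cond_exp P G (indicator E) \<omega> = r \<omega> * indicator A \<omega>"
      using r(1) by eventually_elim simp
  qed (use AP r in auto)
  finally have "ennreal (prob (A \<inter> E)) = ennreal (\<integral>\<omega>. r \<omega> * indicator A \<omega> \<partial>P)" by simp
  also have "\<dots> = (\<integral>\<^sup>+\<omega>. ennreal (r \<omega> * indicator A \<omega>) \<partial>P)"
    by (rule nn_integral_eq_integral[symmetric]) (use ir AP r in \<open>auto intro: integrable_real_mult_indicator\<close>)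
  also have "\<dots> = (\<integral>\<^sup>+\<omega>. ennreal (r \<omega>) * indicator A \<omega> \<partial>P)"
    by (intro nn_integral_cong) (simp add: indicator_def)
  finally show ?thesis by (simp add: emeasure_eq_measure)
qed

text \<open>Identities between nonnegative integrals over past events ignore null sets and are
  preserved by the shift, so conditional probabilities are carried around in that form and converted
  back here.\<close>

lemma cond_exp_indicator_charact:
  assumes sub: "subalgebra P G" and E: "E \<in> sets P"
    and r: "r \<in> borel_measurable G" "\<And>\<omega>. \<omega> \<in> space P \<Longrightarrow> 0 \<le> r \<omega>" "\<And>\<omega>. \<omega> \<in> space P \<Longrightarrow> r \<omega> \<le> 1"
    and eq: "\<And>A. A \<in> sets G \<Longrightarrow> emeasure P (A \<inter> E) = (\<integral>\<^sup>+\<omega>. ennreal (r \<omega>) * indicator A \<omega> \<partial>P)"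
  shows "AE \<omega> in P. real_cond_exp P G (indicator E) \<omega> = r \<omega>"
proof -
  interpret G: finite_measure_subalgebra P G
    using sub by (simp add: finite_measure_subalgebra_def finite_measure_subalgebra_axioms_def finite_measure_axioms)
  have rP [measurable]: "r \<in> borel_measurable P" by (rule measurable_from_subalg[OF sub r(1)])
  have ir: "integrable P r" by (rule integrable_const_bound[where B = 1]) (use r in auto)
  show ?thesis
  proof (rule G.real_cond_exp_charact[OF _ _ ir r(1)])
    show "integrable P (indicator E :: 'w \<Rightarrow> real)" using E by (simp add: less_top[symmetric])
    fix A assume A: "A \<in> sets G"
    then have AP: "A \<in> sets P" using sub by (auto simp: subalgebra_def)
    have "ennreal (\<integral>\<omega>. r \<omega> * indicator A \<omega> \<partial>P) = (\<integral>\<^sup>+\<omega>. ennreal (r \<omega> * indicator A \<omega>) \<partial>P)"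
      by (rule nn_integral_eq_integral[symmetric]) (use ir AP r in \<open>auto intro: integrable_real_mult_indicator\<close>)
    also have "\<dots> = (\<integral>\<^sup>+\<omega>. ennreal (r \<omega>) * indicator A \<omega> \<partial>P)"
      by (intro nn_integral_cong) (simp add: indicator_def)
    also have "\<dots> = ennreal (prob (A \<inter> E))" using eq[OF A] by (simp add: emeasure_eq_measure)
    finally have "(\<integral>\<omega>. r \<omega> * indicator A \<omega> \<partial>P) = prob (A \<inter> E)"
      by (subst (asm) ennreal_inj) (use r in \<open>auto intro!: integral_nonneg_AE simp: indicator_def\<close>)
    then show "(\<integral>\<omega>\<in>A. indicator E \<omega> \<partial>P) = (\<integral>\<omega>\<in>A. r \<omega> \<partial>P)"
      using AP E by (simp add: set_lebesgue_integral_def indicator_inter_arith[symmetric] mult.commute)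
  qed
qed

lemma X0_vimage_measurable: "X 0 \<in> vimage_algebra (space P) (X 0) S \<rightarrow>\<^sub>M S"
  by (rule measurable_vimage_algebra1) (use measurable_space[OF X_meas] in auto)

lemma Q_kernel: "Q \<in> S \<rightarrow>\<^sub>M prob_algebra S" using kernel by (simp add: regular_cond_distr_def)

lemma Q_subprob [measurable]: "Q \<in> S \<rightarrow>\<^sub>M subprob_algebra S" by (rule measurable_prob_algebraD[OF Q_kernel])

lemma Px_kernel: "Px \<in> S \<rightarrow>\<^sub>M prob_algebra (process_algebra P S X UNIV)"
  using disintegration by (simp add: regular_cond_distr_def)

lemma Px_subprob: "Px \<in> S \<rightarrow>\<^sub>M subprob_algebra (process_algebra P S X UNIV)"
  by (rule measurable_prob_algebraD[OF Px_kernel])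

text \<open>\<open>markov\<close> and \<open>kernel\<close> together identify the conditional law of
  \<open>X 1\<close> given the past of 0. Both sides are expressions in the shifted path, so
  stationarity carries the identity to time \<open>s\<close>.\<close>

lemma transition_indicator:
  assumes B: "B \<in> sets S" and A: "A \<in> sets (past (int s))"
  shows "emeasure P (A \<inter> (X (int s + 1) -` B \<inter> space P)) = (\<integral>\<^sup>+\<omega>. emeasure (Q (X (int s) \<omega>)) B * indicator A \<omega> \<partial>P)"
proof -
  obtain C where C: "C \<in> sets (canonical_algebra S {..0})" "A = shifted (int s) -` C \<inter> space P"
    by (rule sets_past_shift[OF A])
  note [measurable] = B shift_vimage_past(2)[OF C(1)]
  have Cp: "shifted 0 -` C \<inter> space P \<in> sets (past 0)" by (rule shift_vimage_past(1)[OF C(1)])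
  let ?E = "X 1 -` B \<inter> space P"
  have E: "?E \<in> sets P" by measurable
  have prob_Q: "prob_space (Q y)" if "y \<in> space S" for y
    using measurable_space[OF Q_kernel that] by (simp add: space_prob_algebra)
  have "AE \<omega> in P. real_cond_exp P (past 0) (indicator ?E) \<omega> = real_cond_exp P (vimage_algebra (space P) (X 0) S) (indicator ?E) \<omega>"
    using markov B unfolding markov_process_def by (auto dest: spec[of _ 0])
  moreover have "AE \<omega> in P. measure (Q (X 0 \<omega>)) B = real_cond_exp P (vimage_algebra (space P) (X 0) S) (indicator ?E) \<omega>"
    using kernel B unfolding regular_cond_distr_def by blast
  ultimately have "AE \<omega> in P. real_cond_exp P (past 0) (indicator ?E) \<omega> = measure (Q (X 0 \<omega>)) B"
    by eventually_elim simp
  then have "emeasure P ((shifted 0 -` C \<inter> space P) \<inter> ?E) = (\<integral>\<^sup>+\<omega>. ennreal (measure (Q (X 0 \<omega>)) B) * indicator (shifted 0 -` C \<inter> space P) \<omega> \<partial>P)"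
    by (intro cond_exp_indicator_nn[OF past_subalgebra E Cp]) auto
  also have "\<dots> = (\<integral>\<^sup>+\<omega>. emeasure (Q (shifted 0 \<omega> 0)) B * indicator C (shifted 0 \<omega>) \<partial>P)"
  proof (rule nn_integral_cong)
    fix \<omega> assume \<omega>: "\<omega> \<in> space P"
    interpret Q: prob_space "Q (X 0 \<omega>)" by (rule prob_Q[OF measurable_space[OF X_meas \<omega>]])
    show "ennreal (measure (Q (X 0 \<omega>)) B) * indicator (shifted 0 -` C \<inter> space P) \<omega> = emeasure (Q (shifted 0 \<omega> 0)) B * indicator C (shifted 0 \<omega>)"
      using \<omega> by (simp add: Q.emeasure_eq_measure shifted_def[of 0 \<omega>] indicator_def)
  qed
  also have "\<dots> = (\<integral>\<^sup>+\<omega>. emeasure (Q (shifted (int s) \<omega> 0)) B * indicator C (shifted (int s) \<omega>) \<partial>P)"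
    by (rule shift_nn_integral[symmetric]) measurable
  also have "\<dots> = (\<integral>\<^sup>+\<omega>. emeasure (Q (X (int s) \<omega>)) B * indicator A \<omega> \<partial>P)"
    by (intro nn_integral_cong) (simp add: C(2) shifted_def[of "int s"] indicator_def)
  finally have 1: "emeasure P ((shifted 0 -` C \<inter> space P) \<inter> ?E) = \<dots>" .
  have mA: "A \<inter> (X (int s + 1) -` B \<inter> space P) \<in> sets P"
    and m0: "(shifted 0 -` C \<inter> space P) \<inter> ?E \<in> sets P"
    using past_sets[OF A] past_sets[OF Cp] E measurable_sets[OF X_meas B] by auto
  have "emeasure P (A \<inter> (X (int s + 1) -` B \<inter> space P)) = (\<integral>\<^sup>+\<omega>. indicator (C \<inter> (\<lambda>x. x 1) -` B) (shifted (int s) \<omega>) \<partial>P)"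
    unfolding nn_integral_indicator[OF mA, symmetric]
    by (intro nn_integral_cong) (auto simp: C(2) shifted_def indicator_def add.commute)
  also have "\<dots> = (\<integral>\<^sup>+\<omega>. indicator (C \<inter> (\<lambda>x. x 1) -` B \<inter> space paths) (shifted (int s) \<omega>) \<partial>P)"
    using measurable_space[OF shifted_measurable] by (intro nn_integral_cong) (auto simp: indicator_def)
  also have "\<dots> = (\<integral>\<^sup>+\<omega>. indicator (C \<inter> (\<lambda>x. x 1) -` B \<inter> space paths) (shifted 0 \<omega>) \<partial>P)"
  proof (rule shift_nn_integral)
    have "C \<inter> ((\<lambda>x. x 1) -` B \<inter> space paths) \<in> sets paths" by measurable
    then show "indicator (C \<inter> (\<lambda>x. x 1) -` B \<inter> space paths) \<in> borel_measurable paths"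
      by (simp add: Int_assoc)
  qed
  also have "\<dots> = emeasure P ((shifted 0 -` C \<inter> space P) \<inter> ?E)"
    unfolding nn_integral_indicator[OF m0, symmetric]
    using measurable_space[OF shifted_measurable[of 0]]
    by (intro nn_integral_cong) (auto simp: shifted_def indicator_def)
  finally show ?thesis using 1 by simp
qed

lemma transition:
  assumes f: "f \<in> borel_measurable S" and A: "A \<in> sets (past (int s))"
  shows "(\<integral>\<^sup>+\<omega>. f (X (int s + 1) \<omega>) * indicator A \<omega> \<partial>P) = (\<integral>\<^sup>+\<omega>. (\<integral>\<^sup>+y. f y \<partial>Q (X (int s) \<omega>)) * indicator A \<omega> \<partial>P)"
  using f
proof (induction rule: borel_measurable_induct)
  case (cong f g)
  have "(\<integral>\<^sup>+y. f y \<partial>Q (X (int s) \<omega>)) = (\<integral>\<^sup>+y. g y \<partial>Q (X (int s) \<omega>))" if "\<omega> \<in> space P" for \<omega>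
    using cong(3) sets_eq_imp_space_eq[OF sets_kernel[OF Q_subprob measurable_space[OF X_meas that]]]
    by (intro nn_integral_cong) auto
  moreover have "f (X (int s + 1) \<omega>) = g (X (int s + 1) \<omega>)" if "\<omega> \<in> space P" for \<omega>
    using cong(3) measurable_space[OF X_meas that] by auto
  ultimately show ?case using cong(4) by (simp cong: nn_integral_cong)
next
  case (set B)
  have AP [measurable]: "A \<in> sets P" by (rule past_sets[OF A])
  have "(\<integral>\<^sup>+\<omega>. indicator B (X (int s + 1) \<omega>) * indicator A \<omega> \<partial>P) = emeasure P (A \<inter> (X (int s + 1) -` B \<inter> space P))"
  proof -
    have m: "A \<inter> (X (int s + 1) -` B \<inter> space P) \<in> sets P" using AP measurable_sets[OF X_meas set] by auto
    show ?thesis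
      unfolding nn_integral_indicator[OF m, symmetric]
      by (intro nn_integral_cong) (auto simp: indicator_def)
  qed
  also have "\<dots> = (\<integral>\<^sup>+\<omega>. emeasure (Q (X (int s) \<omega>)) B * indicator A \<omega> \<partial>P)"
    by (rule transition_indicator[OF set A])
  also have "\<dots> = (\<integral>\<^sup>+\<omega>. (\<integral>\<^sup>+y. indicator B y \<partial>Q (X (int s) \<omega>)) * indicator A \<omega> \<partial>P)"
    using set sets_kernel[OF Q_subprob measurable_space[OF X_meas]]
    by (intro nn_integral_cong) simp
  finally show ?case .
next
  case (mult u c)
  note [measurable] = past_sets[OF A] mult(2)
  have "(\<integral>\<^sup>+y. c * u y \<partial>Q (X (int s) \<omega>)) = c * (\<integral>\<^sup>+y. u y \<partial>Q (X (int s) \<omega>))" if "\<omega> \<in> space P" for \<omega>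
    using mult(2) sets_kernel[OF Q_subprob measurable_space[OF X_meas that]]
    by (intro nn_integral_cmult) (simp cong: measurable_cong_sets)
  then have "(\<integral>\<^sup>+\<omega>. (\<integral>\<^sup>+y. c * u y \<partial>Q (X (int s) \<omega>)) * indicator A \<omega> \<partial>P) = (\<integral>\<^sup>+\<omega>. c * ((\<integral>\<^sup>+y. u y \<partial>Q (X (int s) \<omega>)) * indicator A \<omega>) \<partial>P)"
    by (intro nn_integral_cong) (simp add: mult.assoc)
  then show ?case by (simp add: mult.assoc nn_integral_cmult mult(4))
next
  case (add u w)
  note [measurable] = past_sets[OF A] add.hyps(1,3)
  have "(\<integral>\<^sup>+y. w y + u y \<partial>Q (X (int s) \<omega>)) = (\<integral>\<^sup>+y. w y \<partial>Q (X (int s) \<omega>)) + (\<integral>\<^sup>+y. u y \<partial>Q (X (int s) \<omega>))" if "\<omega> \<in> space P" for \<omega>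
    using add.hyps(1,3) sets_kernel[OF Q_subprob measurable_space[OF X_meas that]]
    by (intro nn_integral_add) (simp_all cong: measurable_cong_sets)
  then have "(\<integral>\<^sup>+\<omega>. (\<integral>\<^sup>+y. w y + u y \<partial>Q (X (int s) \<omega>)) * indicator A \<omega> \<partial>P) = (\<integral>\<^sup>+\<omega>. (\<integral>\<^sup>+y. w y \<partial>Q (X (int s) \<omega>)) * indicator A \<omega> + (\<integral>\<^sup>+y. u y \<partial>Q (X (int s) \<omega>)) * indicator A \<omega> \<partial>P)"
    by (intro nn_integral_cong) (simp add: distrib_right)
  then show ?case by (simp add: distrib_right nn_integral_add add)
next
  case (seq U)
  note [measurable] = past_sets[OF A] seq(1)
  have Sup_eq: "(SUP i. U i) y = (SUP i. U i y)" for y by (simp add: image_comp)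
  have inc: "incseq (\<lambda>i. U i y * c)" for y c
    using seq(3) by (auto simp: incseq_def le_fun_def intro: mult_right_mono)
  have "(\<integral>\<^sup>+\<omega>. (SUP i. U i) (X (int s + 1) \<omega>) * indicator A \<omega> \<partial>P) = (\<integral>\<^sup>+\<omega>. (SUP i. U i (X (int s + 1) \<omega>) * indicator A \<omega>) \<partial>P)"
    by (simp only: Sup_eq SUP_mult_right_ennreal)
  also have "\<dots> = (SUP i. \<integral>\<^sup>+\<omega>. U i (X (int s + 1) \<omega>) * indicator A \<omega> \<partial>P)"
    by (rule nn_integral_monotone_convergence_SUP) (use seq(3) in \<open>auto simp: incseq_def le_fun_def intro: mult_right_mono\<close>)
  also have "\<dots> = (SUP i. \<integral>\<^sup>+\<omega>. (\<integral>\<^sup>+y. U i y \<partial>Q (X (int s) \<omega>)) * indicator A \<omega> \<partial>P)"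
    by (simp add: seq.IH)
  also have "\<dots> = (\<integral>\<^sup>+\<omega>. (SUP i. (\<integral>\<^sup>+y. U i y \<partial>Q (X (int s) \<omega>)) * indicator A \<omega>) \<partial>P)"
    by (rule nn_integral_monotone_convergence_SUP[symmetric])
       (use seq(3) in \<open>auto simp: incseq_def le_fun_def intro!: mult_right_mono nn_integral_mono\<close>)
  also have "\<dots> = (\<integral>\<^sup>+\<omega>. (\<integral>\<^sup>+y. (SUP i. U i) y \<partial>Q (X (int s) \<omega>)) * indicator A \<omega> \<partial>P)"
  proof (rule nn_integral_cong)
    fix \<omega> assume "\<omega> \<in> space P"
    then have "(\<integral>\<^sup>+y. (SUP i. U i y) \<partial>Q (X (int s) \<omega>)) = (SUP i. \<integral>\<^sup>+y. U i y \<partial>Q (X (int s) \<omega>))"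
      using seq(1,3) sets_kernel[OF Q_subprob measurable_space[OF X_meas]]
      by (intro nn_integral_monotone_convergence_SUP) (simp_all cong: measurable_cong_sets)
    then show "(SUP i. (\<integral>\<^sup>+y. U i y \<partial>Q (X (int s) \<omega>)) * indicator A \<omega>) = (\<integral>\<^sup>+y. (SUP i. U i) y \<partial>Q (X (int s) \<omega>)) * indicator A \<omega>"
      by (simp only: Sup_eq SUP_mult_right_ennreal)
  qed
  finally show ?case .
qed

section \<open>Cylinder events and iterated transition kernels\<close>

fun cylinder :: "int \<Rightarrow> 's set list \<Rightarrow> 'w set" where
  "cylinder s [] = space P"
| "cylinder s (B # Bs) = (X (s + 1) -` B \<inter> space P) \<inter> cylinder (s + 1) Bs"

text \<open>The probability, started from \<open>x\<close>, that the next \<open>length Bs\<close>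
  states lie in the listed sets in turn.\<close>

fun cylinder_kernel :: "'s set list \<Rightarrow> 's \<Rightarrow> ennreal" where
  "cylinder_kernel [] x = 1"
| "cylinder_kernel (B # Bs) x = (\<integral>\<^sup>+y. indicator B y * cylinder_kernel Bs y \<partial>Q x)"

lemma cylinder_kernel_measurable: "set Bs \<subseteq> sets S \<Longrightarrow> cylinder_kernel Bs \<in> borel_measurable S"
proof (induction Bs)
  case (Cons B Bs)
  then have [measurable]: "B \<in> sets S" "cylinder_kernel Bs \<in> borel_measurable S" by auto
  show ?case by (simp only: cylinder_kernel.simps[abs_def]) measurable
qed (simp add: cylinder_kernel.simps[abs_def])

text \<open>Induction on the list: the first constraint is absorbed into an event of the past of
  \<open>Suc s\<close>, the induction hypothesis applies there, and \<open>transition\<close>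
  integrates that step out. Hence \<open>A\<close> and \<open>s\<close> have to vary.\<close>

lemma emeasure_cylinder:
  assumes "set Bs \<subseteq> sets S" "A \<in> sets (past (int s))"
  shows "emeasure P (A \<inter> cylinder (int s) Bs) = (\<integral>\<^sup>+\<omega>. cylinder_kernel Bs (X (int s) \<omega>) * indicator A \<omega> \<partial>P)"
  using assms
proof (induction Bs arbitrary: s A)
  case Nil
  have "A \<inter> space P = A" using past_sets[OF Nil(2)] sets.sets_into_space by blast
  then show ?case using past_sets[OF Nil(2)] by simp
next
  case (Cons B Bs)
  have B: "B \<in> sets S" using Cons by simp
  have [measurable]: "cylinder_kernel Bs \<in> borel_measurable S" "B \<in> sets S"
    using Cons cylinder_kernel_measurable by auto
  let ?A = "A \<inter> (X (int s + 1) -` B \<inter> space P)"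
  have "A \<in> sets (past (int (Suc s)))"
    using sets_process_algebra_mono[of "{..int s}" "{..int (Suc s)}" P S X] Cons.prems(2) by auto
  moreover have "X (int s + 1) -` B \<inter> space P \<in> sets (past (int (Suc s)))"
    by (rule process_algebra_generator) (use B in auto)
  ultimately have A: "?A \<in> sets (past (int (Suc s)))" by auto
  have "emeasure P (A \<inter> cylinder (int s) (B # Bs)) = emeasure P (?A \<inter> cylinder (int (Suc s)) Bs)"
    by (simp add: Int_assoc add.commute)
  also have "\<dots> = (\<integral>\<^sup>+\<omega>. cylinder_kernel Bs (X (int (Suc s)) \<omega>) * indicator ?A \<omega> \<partial>P)"
    by (rule Cons.IH[OF _ A]) (use Cons.prems in auto)
  also have "\<dots> = (\<integral>\<^sup>+\<omega>. (indicator B (X (int s + 1) \<omega>) * cylinder_kernel Bs (X (int s + 1) \<omega>)) * indicator A \<omega> \<partial>P)"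
    by (intro nn_integral_cong) (auto simp: indicator_def add.commute)
  also have "\<dots> = (\<integral>\<^sup>+\<omega>. (\<integral>\<^sup>+y. indicator B y * cylinder_kernel Bs y \<partial>Q (X (int s) \<omega>)) * indicator A \<omega> \<partial>P)"
    by (rule transition[OF _ Cons.prems(2)]) measurable
  finally show ?case by simp
qed

lemma cylinder_iff:
  "\<omega> \<in> cylinder s Bs \<longleftrightarrow> \<omega> \<in> space P \<and> (\<forall>i<length Bs. X (s + 1 + int i) \<omega> \<in> Bs ! i)"
proof (induction Bs arbitrary: s)
  case (Cons B Bs)
  have "(\<forall>i<length (B # Bs). X (s + 1 + int i) \<omega> \<in> (B # Bs) ! i) \<longleftrightarrow>
      X (s + 1) \<omega> \<in> B \<and> (\<forall>i<length Bs. X (s + 1 + 1 + int i) \<omega> \<in> Bs ! i)"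
    by (simp add: All_less_Suc2 algebra_simps)
  then show ?case using Cons[of "s + 1"] by auto
qed simp

lemma cylinder_sets:
  assumes "set Bs \<subseteq> sets S"
  shows "cylinder 0 Bs \<in> sets (process_algebra P S X {1..int (length Bs)})"
proof -
  let ?G = "process_algebra P S X {1..int (length Bs)}"
  have "cylinder 0 Bs = space ?G \<inter> (\<Inter>i\<in>{..<length Bs}. {\<omega> \<in> space ?G. X (1 + int i) \<omega> \<in> Bs ! i})"
    by (auto simp: cylinder_iff)
  also have "\<dots> \<in> sets ?G"
  proof (cases "Bs = []")
    case False
    have "{\<omega> \<in> space ?G. X (1 + int i) \<omega> \<in> Bs ! i} \<in> sets ?G" if "i < length Bs" for i
    proof -
      have "X (1 + int i) -` (Bs ! i) \<inter> space P \<in> sets ?G"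
        by (rule process_algebra_generator) (use that assms nth_mem in auto)
      moreover have "{\<omega> \<in> space ?G. X (1 + int i) \<omega> \<in> Bs ! i} = X (1 + int i) -` (Bs ! i) \<inter> space P" by auto
      ultimately show ?thesis by simp
    qed
    then show ?thesis using False by (intro sets.Int sets.top sets.finite_INT) auto
  qed (use sets.top[of ?G] in simp)
  finally show ?thesis .
qed

section \<open>The conditional law of the future given the initial state\<close>

lemma Px_prob: "\<omega> \<in> space P \<Longrightarrow> prob_space (Px (X 0 \<omega>))"
  "\<omega> \<in> space P \<Longrightarrow> sets (Px (X 0 \<omega>)) = sets (process_algebra P S X UNIV)"
  "\<omega> \<in> space P \<Longrightarrow> space (Px (X 0 \<omega>)) = space P"
proof -
  assume \<omega>: "\<omega> \<in> space P"
  have "Px (X 0 \<omega>) \<in> space (prob_algebra (process_algebra P S X UNIV))"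
    by (rule measurable_space[OF Px_kernel measurable_space[OF X_meas \<omega>]])
  then show "prob_space (Px (X 0 \<omega>))" and s: "sets (Px (X 0 \<omega>)) = sets (process_algebra P S X UNIV)"
    by (auto simp: space_prob_algebra)
  from sets_eq_imp_space_eq[OF s] show "space (Px (X 0 \<omega>)) = space P" by simp
qed

lemma Px_emeasure_measurable:
  assumes "E \<in> sets (process_algebra P S X UNIV)" shows "(\<lambda>x. emeasure (Px x) E) \<in> borel_measurable S"
  using measurable_emeasure_subprob_algebra[OF assms] Px_subprob by (rule measurable_compose[rotated])

lemma Px_measure_measurable:
  assumes "E \<in> sets (process_algebra P S X UNIV)" shows "(\<lambda>x. measure (Px x) E) \<in> borel_measurable S"
  using measurable_measure_subprob_algebra[OF assms] Px_subprob by (rule measurable_compose[rotated])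

text \<open>Given \<open>X 0\<close>, both \<open>Px\<close> and the iterated kernel are versions of
  the conditional probability of the cylinder, so they agree almost surely; and for the kernel the
  identity is known against the whole past.\<close>

lemma Px_cylinder:
  assumes Bs: "set Bs \<subseteq> sets S" and A: "A \<in> sets (past 0)"
  shows "emeasure P (A \<inter> cylinder 0 Bs) = (\<integral>\<^sup>+\<omega>. emeasure (Px (X 0 \<omega>)) (cylinder 0 Bs) * indicator A \<omega> \<partial>P)"
proof -
  let ?E = "cylinder 0 Bs" and ?V = "vimage_algebra (space P) (X 0) S"
  have EU: "?E \<in> sets (process_algebra P S X UNIV)"
    using cylinder_sets[OF Bs] sets_process_algebra_mono[of _ UNIV] by blast
  then have E: "?E \<in> sets P" using subalgebra_process_algebra[of UNIV X P S] by (auto simp: subalgebra_def)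
  note [measurable] = cylinder_kernel_measurable[OF Bs]
  \<comment> \<open>On the space of \<open>P\<close> the cap at 1 never acts, by
    \<open>r_eq\<close>; it makes the bounds on \<open>r\<close> immediate.\<close>
  define r where "r \<omega> = min 1 (enn2real (cylinder_kernel Bs (X 0 \<omega>)))" for \<omega>
  have V: "subalgebra (past 0) ?V" by (rule subalgebra_vimage_process_algebra) auto
  have PV: "subalgebra P ?V" using V past_subalgebra[of 0] by (auto simp: subalgebra_def)
  have le1: "cylinder_kernel Cs x \<le> 1" if "x \<in> space S" for Cs x
    using that
  proof (induction Cs arbitrary: x)
    case (Cons C Cs)
    have sp: "space (Q x) = space S" using sets_eq_imp_space_eq[OF sets_kernel[OF Q_subprob Cons.prems]] .
    interpret Qx: prob_space "Q x"
      using measurable_space[OF Q_kernel Cons.prems] by (simp add: space_prob_algebra)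
    have "cylinder_kernel (C # Cs) x \<le> (\<integral>\<^sup>+y. 1 \<partial>Q x)"
      unfolding cylinder_kernel.simps
    proof (rule nn_integral_mono)
      fix y assume "y \<in> space (Q x)"
      then have "cylinder_kernel Cs y \<le> 1" using Cons.IH sp by simp
      then show "indicator C y * cylinder_kernel Cs y \<le> 1" by (cases "y \<in> C") auto
    qed
    then show ?case by (simp add: Qx.emeasure_space_1)
  qed simp
  have r_eq: "ennreal (r \<omega>) = cylinder_kernel Bs (X 0 \<omega>)" if "\<omega> \<in> space P" for \<omega>
  proof -
    have le: "cylinder_kernel Bs (X 0 \<omega>) \<le> 1" by (rule le1[OF measurable_space[OF X_meas that]])
    then have "enn2real (cylinder_kernel Bs (X 0 \<omega>)) \<le> 1" by (simp add: enn2real_leI)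
    moreover have "cylinder_kernel Bs (X 0 \<omega>) < top" using le le_less_trans ennreal_one_less_top by blast
    ultimately show ?thesis by (simp add: r_def)
  qed
  have rV: "r \<in> borel_measurable ?V"
    unfolding r_def using X0_vimage_measurable by measurable
  have charact: "AE \<omega> in P. real_cond_exp P G (indicator ?E) \<omega> = r \<omega>"
    if G: "subalgebra P G" "sets G \<subseteq> sets (past 0)" "r \<in> borel_measurable G" for G
  proof (rule cond_exp_indicator_charact[OF G(1) E G(3)])
    fix A' assume "A' \<in> sets G"
    then have "A' \<in> sets (past (int 0))" using G by auto
    from emeasure_cylinder[OF Bs this] have "emeasure P (A' \<inter> ?E) = (\<integral>\<^sup>+\<omega>. cylinder_kernel Bs (X 0 \<omega>) * indicator A' \<omega> \<partial>P)"
      by simp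
    also have "\<dots> = (\<integral>\<^sup>+\<omega>. ennreal (r \<omega>) * indicator A' \<omega> \<partial>P)"
      by (intro nn_integral_cong) (simp add: r_eq)
    finally show "emeasure P (A' \<inter> ?E) = (\<integral>\<^sup>+\<omega>. ennreal (r \<omega>) * indicator A' \<omega> \<partial>P)" .
  qed (simp_all add: r_def)
  have 1: "AE \<omega> in P. real_cond_exp P ?V (indicator ?E) \<omega> = r \<omega>"
    by (rule charact[OF PV _ rV]) (use V in \<open>auto simp: subalgebra_def\<close>)
  have "AE \<omega> in P. measure (Px (X 0 \<omega>)) ?E = real_cond_exp P ?V (indicator ((\<lambda>\<omega>. \<omega>) -` ?E \<inter> space P)) \<omega>"
    using disintegration EU unfolding regular_cond_distr_def by blast
  moreover have "(\<lambda>\<omega>. \<omega>) -` ?E \<inter> space P = ?E" by (auto simp: cylinder_iff)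
  ultimately have ae: "AE \<omega> in P. measure (Px (X 0 \<omega>)) ?E = r \<omega>" using 1 by (auto elim!: eventually_elim2)
  have "emeasure P (A \<inter> ?E) = (\<integral>\<^sup>+\<omega>. cylinder_kernel Bs (X 0 \<omega>) * indicator A \<omega> \<partial>P)"
    using emeasure_cylinder[OF Bs, of A 0] A by simp
  also have "\<dots> = (\<integral>\<^sup>+\<omega>. emeasure (Px (X 0 \<omega>)) ?E * indicator A \<omega> \<partial>P)"
  proof (rule nn_integral_cong_AE)
    have "AE \<omega> in P. \<omega> \<in> space P" by simp
    with ae show "AE \<omega> in P. cylinder_kernel Bs (X 0 \<omega>) * indicator A \<omega> = emeasure (Px (X 0 \<omega>)) ?E * indicator A \<omega>"
    proof eventually_elim
      case (elim \<omega>)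
      interpret Px: prob_space "Px (X 0 \<omega>)" by (rule Px_prob(1)[OF elim(2)])
      show ?case using elim by (simp add: Px.emeasure_eq_measure r_eq[symmetric])
    qed
  qed
  finally show ?thesis .
qed

text \<open>The null set on which \<open>Px\<close> and the kernel disagree depends on the cylinder,
  so the extension to all events of the times 1 to \<open>l\<close> is made on the integrated
  identity, by Dynkin's argument. Cylinders of the fixed length \<open>l\<close> generate these
  events and are closed under intersection coordinate by coordinate.\<close>

lemma Px_future:
  assumes A: "A \<in> sets (past 0)" and E: "E \<in> sets (process_algebra P S X {1..int l})"
  shows "emeasure P (A \<inter> E) = (\<integral>\<^sup>+\<omega>. emeasure (Px (X 0 \<omega>)) E * indicator A \<omega> \<partial>P)"
proof -
  let ?G = "{cylinder 0 Bs | Bs. length Bs = l \<and> set Bs \<subseteq> sets S}"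
  have AP [measurable]: "A \<in> sets P" by (rule past_sets[OF A])
  have Gsub: "?G \<subseteq> sets (process_algebra P S X {1..int l})" using cylinder_sets by auto
  have sigma_eq: "sets (process_algebra P S X {1..int l}) = sigma_sets (space P) ?G"
  proof
    show "sigma_sets (space P) ?G \<subseteq> sets (process_algebra P S X {1..int l})"
      using sets.sigma_sets_subset[OF Gsub] by simp
    show "sets (process_algebra P S X {1..int l}) \<subseteq> sigma_sets (space P) ?G"
      unfolding sets_process_algebra
    proof (rule sigma_sets_mono, safe)
      fix i B assume i: "i \<in> {1..int l}" and B: "B \<in> sets S"
      \<comment> \<open>A single constraint at time \<open>i\<close> becomes a cylinder of length
        \<open>l\<close> by imposing the trivial constraint \<open>space S\<close> elsewhere; list
        position \<open>i - 1\<close> belongs to time \<open>i\<close>.\<close>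
      define Bs where "Bs = (replicate l (space S))[nat (i - 1) := B]"
      have len: "length Bs = l" by (simp add: Bs_def)
      have "set Bs \<subseteq> insert B {space S}" unfolding Bs_def by (rule order_trans[OF set_update_subset_insert]) auto
      then have Bs: "set Bs \<subseteq> sets S" using B by auto
      have "X i -` B \<inter> space P = cylinder 0 Bs"
      proof (intro set_eqI iffI)
        fix \<omega> assume \<omega>: "\<omega> \<in> X i -` B \<inter> space P"
        have "X (1 + int j) \<omega> \<in> Bs ! j" if "j < l" for j
          using that \<omega> i measurable_space[OF X_meas, of \<omega>] by (cases "j = nat (i - 1)") (auto simp: Bs_def)
        then show "\<omega> \<in> cylinder 0 Bs" using \<omega> by (auto simp: cylinder_iff len)
      next
        fix \<omega> assume \<omega>: "\<omega> \<in> cylinder 0 Bs"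
        have "nat (i - 1) < l" using i by auto
        then have "X (1 + int (nat (i - 1))) \<omega> \<in> Bs ! nat (i - 1)" using \<omega> by (auto simp: cylinder_iff len)
        then show "\<omega> \<in> X i -` B \<inter> space P" using \<omega> i by (auto simp: Bs_def cylinder_iff)
      qed
      then show "X i -` B \<inter> space P \<in> sigma_sets (space P) ?G" using len Bs by (auto intro!: sigma_sets.Basic)
    qed
  qed
  have stable: "Int_stable ?G"
  proof (rule Int_stableI)
    fix a b assume "a \<in> ?G" "b \<in> ?G"
    then obtain Bs Cs where BC: "a = cylinder 0 Bs" "b = cylinder 0 Cs" "length Bs = l" "length Cs = l"
      "set Bs \<subseteq> sets S" "set Cs \<subseteq> sets S" by blast
    define Ds where "Ds = map (\<lambda>i. Bs ! i \<inter> Cs ! i) [0..<l]"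
    have "a \<inter> b = cylinder 0 Ds" using BC by (auto simp: cylinder_iff Ds_def)
    moreover have "Bs ! i \<inter> Cs ! i \<in> sets S" if "i < l" for i
      using BC that nth_mem[of i Bs] nth_mem[of i Cs] by (intro sets.Int) auto
    then have "set Ds \<subseteq> sets S" by (auto simp: Ds_def)
    moreover have "length Ds = l" by (simp add: Ds_def)
    ultimately show "a \<inter> b \<in> ?G" by blast
  qed
  have UNIV: "sigma_sets (space P) ?G \<subseteq> sets (process_algebra P S X UNIV)"
    unfolding sigma_eq[symmetric] by (rule sets_process_algebra_mono) simp
  then have sP: "sigma_sets (space P) ?G \<subseteq> sets P"
    using subalgebra_process_algebra[of UNIV X P S] by (auto simp: subalgebra_def)
  have meas: "(\<lambda>\<omega>. emeasure (Px (X 0 \<omega>)) E) \<in> borel_measurable P" if "E \<in> sigma_sets (space P) ?G" for E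
    using Px_emeasure_measurable that UNIV by (intro measurable_compose[OF X_meas]) auto
  have GP: "?G \<subseteq> Pow (space P)" by (auto simp: cylinder_iff)
  have "E \<in> sigma_sets (space P) ?G" using E sigma_eq by simp
  from stable GP this show ?thesis
  proof (induction rule: sigma_sets_induct_disjoint)
    case (basic E)
    then show ?case using Px_cylinder[OF _ A] by auto
  next
    case empty
    then show ?case by simp
  next
    case (compl E)
    have EP [measurable]: "E \<in> sets P" using compl sP by auto
    note [measurable] = meas[OF compl(1)]
    \<comment> \<open>Differences of extended nonnegative integrals require the subtracted one to be
      finite.\<close>
    have fin: "(\<integral>\<^sup>+\<omega>. emeasure (Px (X 0 \<omega>)) E * indicator A \<omega> \<partial>P) \<noteq> \<infinity>"
      unfolding compl(2)[symmetric] by simp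
    have "emeasure P (A \<inter> (space P - E)) = emeasure P (A - (A \<inter> E))"
      using sets.sets_into_space[OF AP] by (intro arg_cong[where f = "emeasure P"]) auto
    also have "\<dots> = emeasure P A - emeasure P (A \<inter> E)" by (rule emeasure_Diff) auto
    also have "\<dots> = (\<integral>\<^sup>+\<omega>. indicator A \<omega> \<partial>P) - (\<integral>\<^sup>+\<omega>. emeasure (Px (X 0 \<omega>)) E * indicator A \<omega> \<partial>P)"
      by (simp add: compl(2))
    also have "\<dots> = (\<integral>\<^sup>+\<omega>. indicator A \<omega> - emeasure (Px (X 0 \<omega>)) E * indicator A \<omega> \<partial>P)"
    proof (rule nn_integral_diff[symmetric])
      have "AE \<omega> in P. \<omega> \<in> space P" by simp
      then show "AE \<omega> in P. emeasure (Px (X 0 \<omega>)) E * indicator A \<omega> \<le> indicator A \<omega>"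
      proof eventually_elim
        case (elim \<omega>)
        interpret Px: prob_space "Px (X 0 \<omega>)" by (rule Px_prob(1)[OF elim])
        show ?case using Px.measure_le_1 by (auto simp: indicator_def)
      qed
    qed (use fin in auto)
    also have "\<dots> = (\<integral>\<^sup>+\<omega>. emeasure (Px (X 0 \<omega>)) (space P - E) * indicator A \<omega> \<partial>P)"
    proof (rule nn_integral_cong)
      fix \<omega> assume \<omega>: "\<omega> \<in> space P"
      interpret Px: prob_space "Px (X 0 \<omega>)" by (rule Px_prob(1)[OF \<omega>])
      have "E \<in> sets (Px (X 0 \<omega>))" using compl(1) UNIV Px_prob(2)[OF \<omega>] by auto
      from emeasure_compl[OF this] show "indicator A \<omega> - emeasure (Px (X 0 \<omega>)) E * indicator A \<omega> = emeasure (Px (X 0 \<omega>)) (space P - E) * indicator A \<omega>"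
        by (auto simp: Px.emeasure_space_1[unfolded Px_prob(3)[OF \<omega>]] Px_prob(3)[OF \<omega>] Px.emeasure_finite indicator_def)
    qed
    finally show ?case .
  next
    case (union E)
    have EP: "E i \<in> sets P" for i using union(2) sP by auto
    have "emeasure P (A \<inter> (\<Union>i. E i)) = emeasure P (\<Union>i. A \<inter> E i)" by simp
    also have "\<dots> = (\<Sum>i. emeasure P (A \<inter> E i))"
      using union(1) EP by (intro suminf_emeasure[symmetric]) (auto simp: disjoint_family_on_def)
    also have "\<dots> = (\<Sum>i. \<integral>\<^sup>+\<omega>. emeasure (Px (X 0 \<omega>)) (E i) * indicator A \<omega> \<partial>P)" by (simp add: union(3))
    also have "\<dots> = (\<integral>\<^sup>+\<omega>. (\<Sum>i. emeasure (Px (X 0 \<omega>)) (E i) * indicator A \<omega>) \<partial>P)"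
    proof (rule nn_integral_suminf[symmetric])
      fix i
      have [measurable]: "(\<lambda>\<omega>. emeasure (Px (X 0 \<omega>)) (E i)) \<in> borel_measurable P" by (rule meas) (use union(2) in auto)
      show "(\<lambda>\<omega>. emeasure (Px (X 0 \<omega>)) (E i) * indicator A \<omega>) \<in> borel_measurable P" by measurable
    qed
    also have "\<dots> = (\<integral>\<^sup>+\<omega>. emeasure (Px (X 0 \<omega>)) (\<Union>i. E i) * indicator A \<omega> \<partial>P)"
    proof (rule nn_integral_cong)
      fix \<omega> assume \<omega>: "\<omega> \<in> space P"
      have "range E \<subseteq> sets (Px (X 0 \<omega>))" using union(2) UNIV Px_prob(2)[OF \<omega>] by auto
      from suminf_emeasure[OF this union(1)]
      show "(\<Sum>i. emeasure (Px (X 0 \<omega>)) (E i) * indicator A \<omega>) = emeasure (Px (X 0 \<omega>)) (\<Union>i. E i) * indicator A \<omega>"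
        by (simp add: ennreal_suminf_multc)
    qed
    finally show ?case .
  qed
qed

end

section \<open>The Levy distance to the normal distribution\<close>

text \<open>The normal density is bounded by 1.\<close>

lemma std_normal_cdf_lipschitz:
  assumes "a \<le> b" shows "cdf std_normal_distribution b \<le> cdf std_normal_distribution a + (b - a)"
proof (cases "a = b")
  case False
  then have ab: "a < b" using assms by simp
  have "ennreal (cdf std_normal_distribution b - cdf std_normal_distribution a) = emeasure std_normal_distribution {a<..b}"
    using ab by (subst std_normal.cdf_diff_eq) (auto simp: std_normal.emeasure_eq_measure)
  also have "\<dots> = (\<integral>\<^sup>+x. ennreal (std_normal_density x) * indicator {a<..b} x \<partial>lborel)"
    by (subst emeasure_density) auto
  also have "\<dots> \<le> (\<integral>\<^sup>+x. indicator {a<..b} x \<partial>lborel)"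
  proof (rule nn_integral_mono)
    fix x
    have "1 \<le> sqrt (2 * pi)" using pi_gt3 by simp
    then have "std_normal_density x \<le> 1"
      unfolding std_normal_density_def by (intro mult_le_one) auto
    then show "ennreal (std_normal_density x) * indicator {a<..b} x \<le> indicator {a<..b} x"
      by (simp add: indicator_def)
  qed
  also have "\<dots> = ennreal (b - a)" using ab by simp
  finally have "cdf std_normal_distribution b - cdf std_normal_distribution a \<le> b - a"
    using ab by (subst (asm) ennreal_le_iff) auto
  then show ?thesis by simp
qed simp

lemma std_normal_cdf_mono: "x \<le> y \<Longrightarrow> cdf std_normal_distribution x \<le> cdf std_normal_distribution y"
  by (rule std_normal.cdf_nondecreasing)

lemma std_normal_cdf_bounds: "0 \<le> cdf std_normal_distribution x" "cdf std_normal_distribution x \<le> 1"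
  by (rule std_normal.cdf_nonneg, rule std_normal.cdf_bounded_prob)

lemma std_normal_cdf_isCont: "isCont (cdf std_normal_distribution) x"
proof -
  have "emeasure std_normal_distribution {x} = (\<integral>\<^sup>+y. ennreal (std_normal_density y) * indicator {x} y \<partial>lborel)"
    by (subst emeasure_density) auto
  also have "\<dots> = 0"
    by (rule nn_integral_null_set) (simp add: null_sets_def)
  finally show ?thesis by (simp add: std_normal.isCont_cdf measure_def)
qed

definition levy_set :: "(real \<Rightarrow> real) \<Rightarrow> real set" where
  "levy_set G = {\<epsilon>. \<epsilon> > 0 \<and> (\<forall>x. cdf std_normal_distribution (x - \<epsilon>) - \<epsilon> \<le> G x \<and> G x \<le> cdf std_normal_distribution (x + \<epsilon>) + \<epsilon>)}"

lemma levy_dist_eq: "levy_dist (cdf std_normal_distribution) G = Inf (levy_set G)"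
  by (simp add: levy_dist_def levy_set_def)

lemma levy_set_bdd: "bdd_below (levy_set G)"
  by (rule bdd_belowI[of _ 0]) (simp add: levy_set_def)

lemma levy_set_one: assumes "\<And>x. 0 \<le> G x" "\<And>x. G x \<le> 1" shows "1 \<in> levy_set G"
  unfolding levy_set_def mem_Collect_eq
proof (intro conjI allI)
  fix x :: real
  show "cdf std_normal_distribution (x - 1) - 1 \<le> G x" using assms(1)[of x] std_normal_cdf_bounds(2)[of "x - 1"] by linarith
  show "G x \<le> cdf std_normal_distribution (x + 1) + 1" using assms(2)[of x] std_normal_cdf_bounds(1)[of "x + 1"] by linarith
qed simp

lemma levy_dist_bounds:
  assumes "\<And>x. 0 \<le> G x" "\<And>x. G x \<le> 1"
  shows "0 \<le> levy_dist (cdf std_normal_distribution) G" "levy_dist (cdf std_normal_distribution) G \<le> 1"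
proof -
  have ne: "levy_set G \<noteq> {}" using levy_set_one[of G, OF assms] by blast
  show "0 \<le> levy_dist (cdf std_normal_distribution) G"
    unfolding levy_dist_eq by (rule cInf_greatest[OF ne]) (simp add: levy_set_def)
  show "levy_dist (cdf std_normal_distribution) G \<le> 1"
    unfolding levy_dist_eq by (rule cInf_lower[OF levy_set_one[of G, OF assms] levy_set_bdd])
qed

text \<open>An admissible \<epsilon> moves argument and value by at most \<epsilon> each, and the
  normal distribution function is 1-Lipschitz, so the total deviation is at most
  \<open>2 * \<epsilon>\<close>. Smoothness of the limit is what gives pointwise control by the Levy
  distance.\<close>

lemma cdf_diff_le_levy_dist:
  assumes "\<And>x. 0 \<le> G x" "\<And>x. G x \<le> 1"
  shows "\<bar>G z - cdf std_normal_distribution z\<bar> \<le> 2 * levy_dist (cdf std_normal_distribution) G"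
proof -
  have "\<bar>G z - cdf std_normal_distribution z\<bar> / 2 \<le> Inf (levy_set G)"
  proof (rule cInf_greatest)
    show "levy_set G \<noteq> {}" using levy_set_one[of G, OF assms] by blast
    fix \<epsilon> assume "\<epsilon> \<in> levy_set G"
    then have e: "\<epsilon> > 0" "cdf std_normal_distribution (z - \<epsilon>) - \<epsilon> \<le> G z" "G z \<le> cdf std_normal_distribution (z + \<epsilon>) + \<epsilon>"
      by (auto simp: levy_set_def)
    have "cdf std_normal_distribution z \<le> cdf std_normal_distribution (z - \<epsilon>) + \<epsilon>"
      "cdf std_normal_distribution (z + \<epsilon>) \<le> cdf std_normal_distribution z + \<epsilon>"
      using std_normal_cdf_lipschitz[of "z - \<epsilon>" z] std_normal_cdf_lipschitz[of z "z + \<epsilon>"] e(1) by simp_all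
    with e(2,3) have "\<bar>G z - cdf std_normal_distribution z\<bar> \<le> 2 * \<epsilon>"
      unfolding abs_le_iff by auto
    then show "\<bar>G z - cdf std_normal_distribution z\<bar> / 2 \<le> \<epsilon>" by simp
  qed
  then show ?thesis by (simp add: levy_dist_eq)
qed

text \<open>Monotonicity transfers closeness at a finite grid, which covers the bulk of the normal
  law with mesh \<epsilon>, to all arguments. The grid does not depend on \<open>G\<close>, so the
  inequality can be integrated over a random \<open>G\<close>; a sum in place of a maximum makes
  this termwise.\<close>

lemma levy_dist_le_grid:
  assumes "\<epsilon> > 0"
  obtains I :: "real set" where "finite I"
    "\<And>G. mono G \<Longrightarrow> (\<And>x. 0 \<le> G x) \<Longrightarrow> (\<And>x. G x \<le> 1) \<Longrightarrow>
      levy_dist (cdf std_normal_distribution) G \<le> \<epsilon> + (\<Sum>z\<in>I. \<bar>G z - cdf std_normal_distribution z\<bar>)"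
proof -
  let ?\<Phi> = "cdf std_normal_distribution"
  have "\<forall>\<^sub>F k in sequentially. ?\<Phi> (- real k) < \<epsilon> \<and> 1 - \<epsilon> < ?\<Phi> (real k)"
    using order_tendstoD(2)[OF std_normal.cdf_lim_neg_infty, of \<epsilon>] order_tendstoD(1)[OF std_normal.cdf_lim_infty_prob, of "1 - \<epsilon>"] assms
    by (auto elim: eventually_elim2)
  then obtain k :: nat where k: "?\<Phi> (- real k) < \<epsilon>" "1 - \<epsilon> < ?\<Phi> (real k)"
    by (auto simp: eventually_sequentially)
  define p where "p = nat \<lceil>2 * real k / \<epsilon>\<rceil>"
  define y where "y i = - real k + real i * \<epsilon>" for i
  have "2 * real k / \<epsilon> \<le> p" unfolding p_def by (rule real_nat_ceiling_ge)
  then have yp: "real k \<le> y p" using assms by (simp add: y_def field_simps)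
  have cover: "x < y 0 \<or> (\<exists>i<p. y i \<le> x \<and> x \<le> y (Suc i)) \<or> y p \<le> x" for x
  proof (cases "x < y 0 \<or> y p \<le> x")
    case False
    define i where "i = nat \<lfloor>(x + k) / \<epsilon>\<rfloor>"
    have x0: "0 \<le> (x + k) / \<epsilon>" using False assms by (simp add: y_def)
    have i1: "real i \<le> (x + k) / \<epsilon>" "(x + k) / \<epsilon> < real i + 1"
      unfolding i_def using x0 by (simp_all add: of_nat_nat)
    have a: "y i \<le> x" "x \<le> y (Suc i)" using i1 assms by (simp_all add: y_def field_simps)
    have "i < p"
    proof (rule ccontr)
      assume "\<not> i < p"
      then have "y p \<le> y i" using assms by (simp add: y_def)
      then show False using a False by simp
    qed
    then show ?thesis using a by blast
  qed blast
  define I where "I = y ` {..p}"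
  have fin: "finite I" by (simp add: I_def)
  have "levy_dist ?\<Phi> G \<le> \<epsilon> + (\<Sum>z\<in>I. \<bar>G z - ?\<Phi> z\<bar>)"
    if G: "mono G" "\<And>x. 0 \<le> G x" "\<And>x. G x \<le> 1" for G
  proof -
    \<comment> \<open>A shift by \<delta> is at least the mesh and so reaches past the neighbouring
      grid point; the remaining \<open>\<delta> - \<epsilon>\<close> bounds the deviation at each
      grid point.\<close>
    define \<delta> where "\<delta> = \<epsilon> + (\<Sum>z\<in>I. \<bar>G z - ?\<Phi> z\<bar>)"
    have s0: "0 \<le> (\<Sum>z\<in>I. \<bar>G z - ?\<Phi> z\<bar>)" by (simp add: sum_nonneg)
    then have \<delta>: "\<epsilon> \<le> \<delta>" by (simp add: \<delta>_def)
    have near: "\<bar>G (y i) - ?\<Phi> (y i)\<bar> \<le> \<delta> - \<epsilon>" if "i \<le> p" for i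
    proof -
      have "\<bar>G (y i) - ?\<Phi> (y i)\<bar> \<le> (\<Sum>z\<in>I. \<bar>G z - ?\<Phi> z\<bar>)"
        by (rule member_le_sum) (use that fin in \<open>auto simp: I_def\<close>)
      then show ?thesis by (simp add: \<delta>_def)
    qed
    have up: "G x \<le> ?\<Phi> (x + \<delta>) + \<delta>" for x
    proof -
      consider "x < y 0" | i where "i < p" "y i \<le> x" "x \<le> y (Suc i)" | "y p \<le> x"
        using cover[of x] by blast
      then show ?thesis
      proof cases
        case 1
        then have "G x \<le> G (y 0)" using G(1) by (simp add: monoD)
        also have "\<dots> \<le> ?\<Phi> (y 0) + (\<delta> - \<epsilon>)" using near[of 0] by simp
        also have "\<dots> \<le> \<delta>" using k(1) by (simp add: y_def)
        finally show ?thesis using std_normal_cdf_bounds(1)[of "x + \<delta>"] by linarith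
      next
        case (2 i)
        have "G x \<le> G (y (Suc i))" using 2 G(1) by (simp add: monoD)
        also have "\<dots> \<le> ?\<Phi> (y (Suc i)) + (\<delta> - \<epsilon>)" using near[of "Suc i"] 2 by simp
        also have "?\<Phi> (y (Suc i)) \<le> ?\<Phi> (x + \<delta>)" using 2 \<delta> by (intro std_normal_cdf_mono) (simp add: y_def algebra_simps)
        finally show ?thesis using assms by simp
      next
        case 3
        have "1 - \<epsilon> < ?\<Phi> (x + \<delta>)"
          by (rule less_le_trans[OF k(2) std_normal_cdf_mono]) (use 3 yp \<delta> assms in linarith)
        then show ?thesis using G(3)[of x] \<delta> by linarith
      qed
    qed
    have lo: "?\<Phi> (x - \<delta>) - \<delta> \<le> G x" for x
    proof -
      consider "x < y 0" | i where "i < p" "y i \<le> x" "x \<le> y (Suc i)" | "y p \<le> x"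
        using cover[of x] by blast
      then show ?thesis
      proof cases
        case 1
        have "?\<Phi> (x - \<delta>) \<le> ?\<Phi> (- real k)" using 1 \<delta> assms by (intro std_normal_cdf_mono) (simp add: y_def)
        then show ?thesis using k(1) G(2)[of x] \<delta> by linarith
      next
        case (2 i)
        have "?\<Phi> (x - \<delta>) \<le> ?\<Phi> (y i)" using 2 \<delta> by (intro std_normal_cdf_mono) (simp add: y_def algebra_simps)
        also have "\<dots> \<le> G (y i) + (\<delta> - \<epsilon>)" using near[of i] 2 by simp
        also have "G (y i) \<le> G x" using 2 G(1) by (simp add: monoD)
        finally show ?thesis using assms by simp
      next
        case 3
        have "1 - \<epsilon> < ?\<Phi> (y p)" by (rule less_le_trans[OF k(2) std_normal_cdf_mono[OF yp]])
        also have "?\<Phi> (y p) \<le> G (y p) + (\<delta> - \<epsilon>)" using near[of p] by simp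
        also have "G (y p) \<le> G x" using 3 G(1) by (simp add: monoD)
        finally show ?thesis using std_normal_cdf_bounds(2)[of "x - \<delta>"] by linarith
      qed
    qed
    have "\<delta> \<in> levy_set G" using up lo \<delta> assms by (simp add: levy_set_def)
    then show ?thesis unfolding levy_dist_eq \<delta>_def[symmetric] by (rule cInf_lower[OF _ levy_set_bdd])
  qed
  then show thesis using that[OF fin] by blast
qed

text \<open>A countable description, needed for measurability in a parameter of \<open>G\<close>.
  Admissible values form an upward closed set, so a rational one can be taken, and monotonicity with
  a little room reduces all arguments to rational ones.\<close>

lemma levy_dist_less_iff:
  assumes G: "mono G" "\<And>x. 0 \<le> G x" "\<And>x. G x \<le> 1"
  shows "levy_dist (cdf std_normal_distribution) G < c \<longleftrightarrow>
    (\<exists>\<epsilon>\<in>\<rat>. 0 < \<epsilon> \<and> \<epsilon> < c \<and> (\<forall>z\<in>\<rat>. cdf std_normal_distribution (z - \<epsilon>) - \<epsilon> \<le> G z \<and> G z \<le> cdf std_normal_distribution (z + \<epsilon>) + \<epsilon>))"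
    (is "_ \<longleftrightarrow> ?R")
proof
  let ?\<Phi> = "cdf std_normal_distribution"
  assume "levy_dist ?\<Phi> G < c"
  then obtain e where e: "e \<in> levy_set G" "e < c"
    unfolding levy_dist_eq using cInf_lessD levy_set_one[of G, OF G(2,3)] by blast
  obtain \<epsilon> where \<epsilon>: "\<epsilon> \<in> \<rat>" "e < \<epsilon>" "\<epsilon> < c" using Rats_dense_in_real[OF e(2)] by auto
  have "?\<Phi> (z - \<epsilon>) - \<epsilon> \<le> G z \<and> G z \<le> ?\<Phi> (z + \<epsilon>) + \<epsilon>" for z
  proof -
    have "?\<Phi> (z - e) - e \<le> G z" "G z \<le> ?\<Phi> (z + e) + e" using e(1) by (auto simp: levy_set_def)
    moreover have "?\<Phi> (z - \<epsilon>) \<le> ?\<Phi> (z - e)" "?\<Phi> (z + e) \<le> ?\<Phi> (z + \<epsilon>)"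
      using \<epsilon> by (auto intro: std_normal_cdf_mono)
    ultimately show ?thesis using \<epsilon> by linarith
  qed
  moreover have "0 < \<epsilon>" using e(1) \<epsilon> by (auto simp: levy_set_def)
  ultimately show ?R using \<epsilon> by blast
next
  let ?\<Phi> = "cdf std_normal_distribution"
  assume ?R
  then obtain \<epsilon> where \<epsilon>: "0 < \<epsilon>" "\<epsilon> < c" "\<And>z. z \<in> \<rat> \<Longrightarrow> ?\<Phi> (z - \<epsilon>) - \<epsilon> \<le> G z \<and> G z \<le> ?\<Phi> (z + \<epsilon>) + \<epsilon>"
    by blast
  \<comment> \<open>The slack between \<epsilon> and \<open>c\<close> pays for moving an arbitrary
    argument to a nearby rational.\<close>
  define \<delta> where "\<delta> = (c - \<epsilon>) / 2"
  have \<delta>: "\<delta> > 0" "\<epsilon> + \<delta> < c" using \<epsilon>(2) by (auto simp: \<delta>_def field_simps)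
  have "?\<Phi> (z - (\<epsilon> + \<delta>)) - (\<epsilon> + \<delta>) \<le> G z \<and> G z \<le> ?\<Phi> (z + (\<epsilon> + \<delta>)) + (\<epsilon> + \<delta>)" for z
  proof
    obtain a where a: "a \<in> \<rat>" "z - \<delta> < a" "a < z" using Rats_dense_in_real[of "z - \<delta>" z] \<delta> by auto
    have "?\<Phi> (z - (\<epsilon> + \<delta>)) \<le> ?\<Phi> (a - \<epsilon>)" using a by (intro std_normal_cdf_mono) simp
    moreover have "G a \<le> G z" using a G(1) by (simp add: monoD)
    ultimately show "?\<Phi> (z - (\<epsilon> + \<delta>)) - (\<epsilon> + \<delta>) \<le> G z" using \<epsilon>(3)[OF a(1)] \<delta> by linarith
    obtain b where b: "b \<in> \<rat>" "z < b" "b < z + \<delta>" using Rats_dense_in_real[of z "z + \<delta>"] \<delta> by auto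
    have "?\<Phi> (b + \<epsilon>) \<le> ?\<Phi> (z + (\<epsilon> + \<delta>))" using b by (intro std_normal_cdf_mono) simp
    moreover have "G z \<le> G b" using b G(1) by (simp add: monoD)
    ultimately show "G z \<le> ?\<Phi> (z + (\<epsilon> + \<delta>)) + (\<epsilon> + \<delta>)" using \<epsilon>(3)[OF b(1)] \<delta> by linarith
  qed
  then have "\<epsilon> + \<delta> \<in> levy_set G" using \<epsilon>(1) \<delta>(1) by (simp add: levy_set_def)
  then have "levy_dist ?\<Phi> G \<le> \<epsilon> + \<delta>" unfolding levy_dist_eq by (rule cInf_lower[OF _ levy_set_bdd])
  then show "levy_dist ?\<Phi> G < c" using \<delta> by linarith
qed

lemma levy_dist_measurable:
  assumes "\<And>x. x \<in> space S \<Longrightarrow> mono (G x)" "\<And>x z. 0 \<le> G x z" "\<And>x z. x \<in> space S \<Longrightarrow> G x z \<le> 1"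
    and [measurable]: "\<And>z. (\<lambda>x. G x z) \<in> borel_measurable S"
  shows "(\<lambda>x. levy_dist (cdf std_normal_distribution) (G x)) \<in> borel_measurable S"
proof (rule borel_measurableI_less)
  fix c
  have "{x \<in> space S. levy_dist (cdf std_normal_distribution) (G x) < c} =
    {x \<in> space S. \<exists>\<epsilon>\<in>\<rat>. 0 < \<epsilon> \<and> \<epsilon> < c \<and> (\<forall>z\<in>\<rat>. cdf std_normal_distribution (z - \<epsilon>) - \<epsilon> \<le> G x z \<and> G x z \<le> cdf std_normal_distribution (z + \<epsilon>) + \<epsilon>)}"
    using levy_dist_less_iff assms(1-3) by blast
  also have "\<dots> \<in> sets S"
    using countable_rat by measurable
  finally show "{x \<in> space S. levy_dist (cdf std_normal_distribution) (G x) < c} \<in> sets S" .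
qed

section \<open>Limit laws under changes of weight\<close>

context prob_space begin

lemma weighted_clt:
  fixes Z w :: "nat \<Rightarrow> 'a \<Rightarrow> real"
  assumes [measurable]: "\<And>n. Z n \<in> borel_measurable M" "\<And>n. w n \<in> borel_measurable M"
    and w: "\<And>n x. 1 \<le> w n x" "\<And>n x. w n x \<le> 2"
    and conv: "\<And>t. (\<lambda>n. \<integral>x. of_real (w n x) * (iexp (t * Z n x) - of_real (exp (- (t\<^sup>2 / 2)))) \<partial>M) \<longlonglongrightarrow> 0"
  shows "(\<lambda>n. \<integral>x. w n x * (indicator {..z} (Z n x) - cdf std_normal_distribution z) \<partial>M) \<longlonglongrightarrow> 0"
proof -
  define c where "c n = expectation (w n)" for n
  have wi: "integrable M (w n)" for n
    by (rule integrable_const_bound[where B = 2]) (use w order_trans[OF _ w(1)] in \<open>auto simp: abs_le_iff intro: order_trans[of _ 1]\<close>)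
  have c1: "1 \<le> c n" for n
    using integral_mono[of M "\<lambda>_. 1" "w n"] wi w by (simp add: c_def prob_space)
  have c2: "c n \<le> 2" for n
    using integral_mono[of M "w n" "\<lambda>_. 2"] wi w by (simp add: c_def prob_space)
  have c0: "c n > 0" for n using c1[of n] by linarith
  have w0: "0 \<le> w n x" for n x using w(1)[of n x] by linarith
  \<comment> \<open>Weights bounded below keep the normalising constants away from 0.\<close>
  define D where "D n = density M (\<lambda>x. ennreal (w n x / c n))" for n
  have D_prob: "prob_space (D n)" for n
  proof
    have "emeasure (D n) (space (D n)) = (\<integral>\<^sup>+x. ennreal (w n x / c n) \<partial>M)"
      unfolding D_def by (subst emeasure_density) (auto intro!: nn_integral_cong)
    also have "\<dots> = ennreal (\<integral>x. w n x / c n \<partial>M)"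
      by (rule nn_integral_eq_integral) (use wi w0 c0[of n] in \<open>auto intro!: divide_nonneg_pos\<close>)
    also have "\<dots> = 1" using c0[of n] by (simp add: c_def[symmetric])
    finally show "emeasure (D n) (space (D n)) = 1" .
  qed
  have [measurable]: "Z n \<in> borel_measurable (D n)" for n by (simp add: D_def)
  define \<mu> where "\<mu> n = distr (D n) borel (Z n)" for n
  have \<mu>: "real_distribution (\<mu> n)" for n
  proof -
    interpret D: prob_space "D n" by (rule D_prob)
    show ?thesis unfolding \<mu>_def by (rule D.real_distribution_distr) simp
  qed
  have int_D: "(\<integral>x. f (Z n x) \<partial>D n) = (\<integral>x. (w n x / c n) *\<^sub>R f (Z n x) \<partial>M)"
    if [measurable]: "f \<in> borel_measurable borel" for f :: "real \<Rightarrow> 'b::{banach, second_countable_topology}" and n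
    unfolding D_def by (rule integral_density) (use w0 c0[of n] in \<open>auto intro!: divide_nonneg_pos\<close>)
  have char_eq: "char (\<mu> n) t = (\<integral>x. of_real (w n x) * (iexp (t * Z n x) - of_real (exp (- (t\<^sup>2 / 2)))) \<partial>M) / of_real (c n) + of_real (exp (- (t\<^sup>2 / 2)))" for n t
  proof -
    have i1: "integrable M (\<lambda>x. of_real (w n x) * iexp (t * Z n x))"
      by (rule integrable_const_bound[where B = 2]) (use w w0 in \<open>auto simp: norm_mult\<close>)
    have "char (\<mu> n) t = (\<integral>x. iexp (t * Z n x) \<partial>D n)"
      unfolding char_def \<mu>_def by (subst integral_distr) auto
    also have "\<dots> = (\<integral>x. (w n x / c n) *\<^sub>R iexp (t * Z n x) \<partial>M)" by (rule int_D) measurable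
    also have "\<dots> = (\<integral>x. of_real (w n x) * iexp (t * Z n x) / of_real (c n) \<partial>M)"
      by (simp add: scaleR_conv_of_real)
    also have "\<dots> = (\<integral>x. of_real (w n x) * iexp (t * Z n x) \<partial>M) / of_real (c n)"
      by simp
    also have "(\<integral>x. of_real (w n x) * iexp (t * Z n x) \<partial>M) =
      (\<integral>x. of_real (w n x) * (iexp (t * Z n x) - of_real (exp (- (t\<^sup>2 / 2)))) \<partial>M) + of_real (c n) * of_real (exp (- (t\<^sup>2 / 2)))"
      unfolding right_diff_distrib c_def using i1 wi[of n] by simp
    finally show ?thesis using c0[of n] by (simp add: add_divide_distrib)
  qed
  have "(\<lambda>n. char (\<mu> n) t) \<longlonglongrightarrow> char std_normal_distribution t" for t
  proof -
    let ?q = "\<lambda>n. (\<integral>x. of_real (w n x) * (iexp (t * Z n x) - of_real (exp (- (t\<^sup>2 / 2)))) \<partial>M)"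
    have "(\<lambda>n. ?q n / of_real (c n)) \<longlonglongrightarrow> 0"
    proof (rule Lim_null_comparison)
      show "(\<lambda>n. cmod (?q n)) \<longlonglongrightarrow> 0" using conv[of t] by (rule tendsto_norm_zero)
      show "\<forall>\<^sub>F n in sequentially. norm (?q n / of_real (c n)) \<le> cmod (?q n)"
      proof (rule always_eventually, rule allI)
        fix n
        have "norm (?q n / of_real (c n)) = cmod (?q n) / c n" using c0[of n] by (simp add: norm_divide)
        also have "\<dots> \<le> cmod (?q n) / 1" using c1[of n] by (intro divide_left_mono) auto
        finally show "norm (?q n / of_real (c n)) \<le> cmod (?q n)" by simp
      qed
    qed
    from tendsto_add[OF this tendsto_const[of "of_real (exp (- (t\<^sup>2 / 2)))"]]
    show ?thesis unfolding char_eq by (simp add: char_std_normal_distribution)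
  qed
  then have "weak_conv_m \<mu> std_normal_distribution"
    by (intro levy_continuity \<mu> real_dist_normal_dist)
  then have lim: "(\<lambda>n. cdf (\<mu> n) z) \<longlonglongrightarrow> cdf std_normal_distribution z"
    using std_normal_cdf_isCont by (simp add: weak_conv_m_def weak_conv_def)
  have eq: "(\<integral>x. w n x * (indicator {..z} (Z n x) - cdf std_normal_distribution z) \<partial>M) = c n * (cdf (\<mu> n) z - cdf std_normal_distribution z)" for n
  proof -
    interpret D: prob_space "D n" by (rule D_prob)
    have i2: "integrable M (\<lambda>x. w n x * indicator {..z} (Z n x))"
      by (rule integrable_const_bound[where B = 2]) (use w w0 in \<open>auto simp: indicator_def\<close>)
    have "cdf (\<mu> n) z = (\<integral>x. indicator {..z} x \<partial>\<mu> n)" by (simp add: cdf_def \<mu>_def)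
    also have "\<dots> = (\<integral>x. indicator {..z} (Z n x) \<partial>D n)" unfolding \<mu>_def by (subst integral_distr) auto
    also have "\<dots> = (\<integral>x. (w n x / c n) *\<^sub>R indicator {..z} (Z n x) \<partial>M)" by (rule int_D) measurable
    also have "\<dots> = (\<integral>x. w n x * indicator {..z} (Z n x) \<partial>M) / c n" by simp
    finally have "c n * cdf (\<mu> n) z = (\<integral>x. w n x * indicator {..z} (Z n x) \<partial>M)" using c0[of n] by simp
    then show ?thesis unfolding right_diff_distrib using i2 wi[of n] by (simp add: c_def)
  qed
  show ?thesis
  proof (rule Lim_null_comparison)
    have "(\<lambda>n. cdf (\<mu> n) z - cdf std_normal_distribution z) \<longlonglongrightarrow> 0" using lim by (simp add: LIM_zero)
    then show "(\<lambda>n. 2 * \<bar>cdf (\<mu> n) z - cdf std_normal_distribution z\<bar>) \<longlonglongrightarrow> 0"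
      by (intro tendsto_mult_right_zero tendsto_rabs_zero)
    show "\<forall>\<^sub>F n in sequentially. norm (\<integral>x. w n x * (indicator {..z} (Z n x) - cdf std_normal_distribution z) \<partial>M)
      \<le> 2 * \<bar>cdf (\<mu> n) z - cdf std_normal_distribution z\<bar>"
      unfolding eq using c2 by (auto simp: abs_mult abs_of_pos[OF c0] intro!: always_eventually mult_right_mono)
  qed
qed

text \<open>The mean of \<open>h n\<close> may tend to 0, which rules out normalising it. The
  weights \<open>1 + h n\<close> and 1 lie between 1 and 2, and the claim is the difference of their
  two limits.\<close>

lemma restricted_clt:
  fixes Z h :: "nat \<Rightarrow> 'a \<Rightarrow> real"
  assumes [measurable]: "\<And>n. Z n \<in> borel_measurable M" "\<And>n. h n \<in> borel_measurable M"
    and h: "\<And>n x. 0 \<le> h n x" "\<And>n x. h n x \<le> 1"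
    and conv: "\<And>t. (\<lambda>n. \<integral>x. of_real (h n x) * (iexp (t * Z n x) - of_real (exp (- (t\<^sup>2 / 2)))) \<partial>M) \<longlonglongrightarrow> 0"
      "\<And>t. (\<lambda>n. \<integral>x. of_real 1 * (iexp (t * Z n x) - of_real (exp (- (t\<^sup>2 / 2)))) \<partial>M) \<longlonglongrightarrow> 0"
  shows "(\<lambda>n. \<integral>x. h n x * (indicator {..z} (Z n x) - cdf std_normal_distribution z) \<partial>M) \<longlonglongrightarrow> 0"
proof -
  have b: "norm (iexp (t * Z n x) - of_real (exp (- (t\<^sup>2 / 2)))) \<le> 2" for t n x
  proof -
    have "norm (iexp (t * Z n x) - of_real (exp (- (t\<^sup>2 / 2)))) \<le> 1 + 1"
      by (rule order_trans[OF norm_triangle_ineq4]) (intro add_mono; simp)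
    then show ?thesis by simp
  qed
  have i1: "integrable M (\<lambda>x. iexp (t * Z n x) - of_real (exp (- (t\<^sup>2 / 2))))" for t n
    by (rule integrable_const_bound[where B = 2]) (use b in auto)
  have i2: "integrable M (\<lambda>x. of_real (h n x) * (iexp (t * Z n x) - of_real (exp (- (t\<^sup>2 / 2)))))" for t n
    by (rule bounded_mult_integrable(1)[OF _ _ i1, where c = 1]) (use h in auto)
  have "(\<lambda>n. \<integral>x. (1 + h n x) * (indicator {..z} (Z n x) - cdf std_normal_distribution z) \<partial>M) \<longlonglongrightarrow> 0"
  proof (rule weighted_clt)
    show "(\<lambda>n. \<integral>x. of_real (1 + h n x) * (iexp (t * Z n x) - of_real (exp (- (t\<^sup>2 / 2)))) \<partial>M) \<longlonglongrightarrow> 0" for t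
    proof -
      have "(\<integral>x. of_real (1 + h n x) * (iexp (t * Z n x) - of_real (exp (- (t\<^sup>2 / 2)))) \<partial>M) =
        (\<integral>x. of_real 1 * (iexp (t * Z n x) - of_real (exp (- (t\<^sup>2 / 2)))) \<partial>M) +
        (\<integral>x. of_real (h n x) * (iexp (t * Z n x) - of_real (exp (- (t\<^sup>2 / 2)))) \<partial>M)" for n
        unfolding of_real_add distrib_right of_real_1 mult_1
        by (rule Bochner_Integration.integral_add[OF i1 i2])
      then show ?thesis using tendsto_add[OF conv(2)[of t] conv(1)[of t]] by simp
    qed
  qed (use h in auto)
  moreover have "(\<lambda>n. \<integral>x. 1 * (indicator {..z} (Z n x) - cdf std_normal_distribution z) \<partial>M) \<longlonglongrightarrow> 0"
    by (rule weighted_clt[where w = "\<lambda>_ _. 1"]) (use conv(2) in auto)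
  ultimately have "(\<lambda>n. (\<integral>x. (1 + h n x) * (indicator {..z} (Z n x) - cdf std_normal_distribution z) \<partial>M)
      - (\<integral>x. 1 * (indicator {..z} (Z n x) - cdf std_normal_distribution z) \<partial>M)) \<longlonglongrightarrow> 0 - 0"
    by (rule tendsto_diff)
  moreover have "(\<integral>x. (1 + h n x) * (indicator {..z} (Z n x) - cdf std_normal_distribution z) \<partial>M)
      - (\<integral>x. 1 * (indicator {..z} (Z n x) - cdf std_normal_distribution z) \<partial>M)
    = (\<integral>x. h n x * (indicator {..z} (Z n x) - cdf std_normal_distribution z) \<partial>M)" for n
  proof -
    have e1: "\<bar>indicator {..z} y - cdf std_normal_distribution z\<bar> \<le> 1" for y
      using std_normal_cdf_bounds[of z] by (auto simp: indicator_def)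
    have j1: "integrable M (\<lambda>x. 1 * (indicator {..z} (Z n x) - cdf std_normal_distribution z))"
      by (rule integrable_const_bound[where B = 1]) (use e1 in auto)
    have j2: "integrable M (\<lambda>x. h n x * (indicator {..z} (Z n x) - cdf std_normal_distribution z))"
      by (rule integrable_const_bound[where B = 1]) (use e1 h in \<open>auto simp: abs_mult intro!: mult_le_one\<close>)
    show ?thesis unfolding distrib_right using Bochner_Integration.integral_add[OF j1 j2] by simp
  qed
  ultimately show ?thesis by simp
qed

end

section \<open>Additive functionals of the chain\<close>

text \<open>Lets the extended nonnegative quotient in \<open>martingale_approximation\<close> be
  handled through real bounds.\<close>

lemma tendsto_zero_ennreal_iff:
  fixes f :: "nat \<Rightarrow> ennreal"
  shows "f \<longlonglongrightarrow> 0 \<longleftrightarrow> (\<forall>\<epsilon>>0. \<forall>\<^sub>F n in sequentially. f n \<le> ennreal \<epsilon>)"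
proof
  assume "f \<longlonglongrightarrow> 0"
  show "\<forall>\<epsilon>>0. \<forall>\<^sub>F n in sequentially. f n \<le> ennreal \<epsilon>"
  proof (intro allI impI)
    fix \<epsilon> :: real assume "\<epsilon> > 0"
    then have "\<forall>\<^sub>F n in sequentially. f n < ennreal \<epsilon>"
      using \<open>f \<longlonglongrightarrow> 0\<close> by (intro order_tendstoD(2)) auto
    then show "\<forall>\<^sub>F n in sequentially. f n \<le> ennreal \<epsilon>" by (rule eventually_mono) simp
  qed
next
  assume *: "\<forall>\<epsilon>>0. \<forall>\<^sub>F n in sequentially. f n \<le> ennreal \<epsilon>"
  show "f \<longlonglongrightarrow> 0"
  proof (rule order_tendstoI)
    fix a :: ennreal assume a: "0 < a"
    obtain r :: real where r: "r > 0" "ennreal r < a"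
    proof (cases a)
      case (real x)
      then show ?thesis using a that[of "x / 2"] by (simp add: ennreal_less_iff)
    next
      case top
      then show ?thesis using that[of 1] by simp
    qed
    have "\<forall>\<^sub>F n in sequentially. f n \<le> ennreal r" using * r by simp
    then show "\<forall>\<^sub>F n in sequentially. f n < a" by eventually_elim (use r in auto)
  qed simp
qed

locale stationary_functional = stationary_markov_chain P S X Q Px
  for P :: "'w measure" and S :: "'s measure" and X Q Px +
  fixes g :: "'s \<Rightarrow> real"
  assumes g_meas [measurable]: "g \<in> borel_measurable S"
    and g_sq: "integrable P (\<lambda>\<omega>. (g (X 0 \<omega>))\<^sup>2)"
    and var_lim: "filterlim (sum_variance P g X) at_top sequentially"
begin

abbreviation v :: "nat \<Rightarrow> real" where "v \<equiv> sum_variance P g X"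

text \<open>\<open>Y i\<close> is the summand at time \<open>i + 1\<close>, hence measurable for the
  past of \<open>Suc i\<close>, in line with the indexing of differences along the
  filtration.\<close>

definition Y :: "nat \<Rightarrow> 'w \<Rightarrow> real" where "Y i \<omega> = g (X (int i + 1) \<omega>)"

text \<open>The window sum as a function on path space, where equality of path laws can be applied
  to it.\<close>

definition path_sum :: "nat \<Rightarrow> (int \<Rightarrow> 's) \<Rightarrow> real" where
  "path_sum l x = (\<Sum>i<l. g (x (int i + 1)))"

lemma path_sum_measurable [measurable]: "path_sum l \<in> borel_measurable paths"
  unfolding path_sum_def[abs_def] by measurable

lemma path_sum_shifted: "path_sum l (shifted (int s) \<omega>) = (\<Sum>i<l. Y (s + i) \<omega>)"
  unfolding path_sum_def shifted_def Y_def by (intro sum.cong refl) (simp add: algebra_simps)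

lemma partial_sum_eq: "partial_sum g X l \<omega> = (\<Sum>i<l. Y i \<omega>)"
  unfolding partial_sum_def Y_def by (simp add: sum.atLeast1_atMost_eq add.commute)

lemma Y_in_L2: "in_L2 P (Y i)"
  unfolding in_L2_def
proof
  show "Y i \<in> borel_measurable P" unfolding Y_def[abs_def] by measurable
  have m: "(\<lambda>x. (g (x 0))\<^sup>2) \<in> borel_measurable paths" by measurable
  have "integrable P (\<lambda>\<omega>. (g (shifted 0 \<omega> 0))\<^sup>2)" using g_sq by (simp add: shifted_def)
  then have "integrable (distr P paths (shifted 0)) (\<lambda>x. (g (x 0))\<^sup>2)"
    by (subst integrable_distr_eq[OF shifted_measurable m])
  then have "integrable (distr P paths (shifted (int (Suc i)))) (\<lambda>x. (g (x 0))\<^sup>2)"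
    by (simp only: shifted_law)
  then have "integrable P (\<lambda>\<omega>. (g (shifted (int (Suc i)) \<omega> 0))\<^sup>2)"
    by (subst (asm) integrable_distr_eq[OF shifted_measurable m])
  then show "integrable P (\<lambda>\<omega>. (Y i \<omega>)\<^sup>2)" by (simp add: shifted_def Y_def add.commute)
qed

sublocale filtered_prob_space P "\<lambda>k. past (int k)"
  by (rule past_filtered)

sublocale partial_sums P "\<lambda>k. past (int k)" Y v
proof
  show "Y i \<in> borel_measurable (past (int (Suc i)))" for i
    unfolding Y_def[abs_def]
    by (rule measurable_compose[OF measurable_process_algebra g_meas]) auto
  show "in_L2 P (Y i)" for i by (rule Y_in_L2)
  show "expectation (\<lambda>\<omega>. (\<Sum>i<l. Y (s + i) \<omega>)\<^sup>2) = v l" for s l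
  proof -
    have "expectation (\<lambda>\<omega>. (path_sum l (shifted (int s) \<omega>))\<^sup>2) = expectation (\<lambda>\<omega>. (path_sum l (shifted 0 \<omega>))\<^sup>2)"
      by (rule shift_integral) measurable
    also have "\<dots> = v l"
      unfolding sum_variance_def partial_sum_eq path_sum_shifted[of l 0, simplified] ..
    finally show ?thesis by (simp only: path_sum_shifted)
  qed
qed

lemma W_path_sum: "W s l \<omega> = path_sum l (shifted (int s) \<omega>)"
  by (simp add: W_def path_sum_shifted)

lemma partial_sum_W: "partial_sum g X l = W 0 l"
  by (simp add: fun_eq_iff W_def partial_sum_eq)

abbreviation F :: "nat \<Rightarrow> 's \<Rightarrow> real \<Rightarrow> real" where
  "F l \<equiv> cond_cdf P Px g X l"

text \<open>Only the coordinates 1 to \<open>l\<close> enter, and this finite range is what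
  \<open>Px_future\<close> asks for.\<close>

lemma event_sets: "{\<omega> \<in> space P. partial_sum g X l \<omega> / sqrt (v l) \<le> z} \<in> sets (process_algebra P S X {1..int l})"
proof -
  let ?G = "process_algebra P S X {1..int l}"
  have m: "(\<lambda>\<omega>. g (X (int i + 1) \<omega>)) \<in> borel_measurable ?G" if "i < l" for i
    by (rule measurable_compose[OF measurable_process_algebra g_meas]) (use that in auto)
  have [measurable]: "partial_sum g X l \<in> borel_measurable ?G"
    unfolding partial_sum_eq[abs_def] Y_def[abs_def] by (rule borel_measurable_sum) (use m in auto)
  have "{\<omega> \<in> space ?G. partial_sum g X l \<omega> / sqrt (v l) \<le> z} \<in> sets ?G" by measurable
  then show ?thesis by simp
qed

lemma event_sets_UNIV: "{\<omega> \<in> space P. partial_sum g X l \<omega> / sqrt (v l) \<le> z} \<in> sets (process_algebra P S X UNIV)"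
  using event_sets sets_process_algebra_mono[of _ UNIV] by blast

lemma F_measurable [measurable]: "(\<lambda>x. F l x z) \<in> borel_measurable S"
  unfolding cond_cdf_def by (rule Px_measure_measurable[OF event_sets_UNIV])

lemma F_nonneg: "0 \<le> F l x z" by (simp add: cond_cdf_def)

lemma
  assumes x: "x \<in> space S"
  shows F_le_1: "F l x z \<le> 1" and F_mono: "mono (F l x)"
proof -
  have "Px x \<in> space (prob_algebra (process_algebra P S X UNIV))"
    by (rule measurable_space[OF Px_kernel x])
  then have p: "prob_space (Px x)" and s: "sets (Px x) = sets (process_algebra P S X UNIV)"
    by (auto simp: space_prob_algebra)
  interpret Px: prob_space "Px x" by (rule p)
  show "F l x z \<le> 1" unfolding cond_cdf_def by (rule Px.prob_le_1)
  show "mono (F l x)"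
    unfolding cond_cdf_def
    by (intro monoI Px.finite_measure_mono) (use event_sets_UNIV s in auto)
qed

text \<open>The joint event is moved to time 0 by stationarity, evaluated there by
  \<open>Px_future\<close>, and the resulting integrand is moved back to time \<open>s\<close>. This
  is the Markov property in the form in which window sums use it.\<close>

lemma conditional_cdf:
  "AE \<omega> in P. real_cond_exp P (past (int s)) (\<lambda>\<omega>. indicator {..z} (W s l \<omega> / sqrt (v l))) \<omega> = F l (X (int s) \<omega>) z"
proof -
  let ?E = "{\<omega> \<in> space P. partial_sum g X l \<omega> / sqrt (v l) \<le> z}"
  let ?B = "{x \<in> space paths. path_sum l x / sqrt (v l) \<le> z}"
  let ?Es = "{\<omega> \<in> space P. W s l \<omega> / sqrt (v l) \<le> z}"
  have Bm [measurable]: "?B \<in> sets paths" by measurable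
  have Em: "?E \<in> sets P" using event_sets_UNIV subalgebra_process_algebra[of UNIV X P S] by (auto simp: subalgebra_def)
  have Esm: "?Es \<in> sets P" by measurable
  have kernel_meas [measurable]: "(\<lambda>x. emeasure (Px x) ?E) \<in> borel_measurable S"
    by (rule Px_emeasure_measurable[OF event_sets_UNIV])
  have "AE \<omega> in P. real_cond_exp P (past (int s)) (indicator ?Es) \<omega> = F l (X (int s) \<omega>) z"
  proof (rule cond_exp_indicator_charact[OF past_subalgebra Esm])
    show "(\<lambda>\<omega>. F l (X (int s) \<omega>) z) \<in> borel_measurable (past (int s))"
      by (rule measurable_compose[OF measurable_process_algebra F_measurable]) auto
    show "0 \<le> F l (X (int s) \<omega>) z" for \<omega> by (rule F_nonneg)
    show "F l (X (int s) \<omega>) z \<le> 1" if "\<omega> \<in> space P" for \<omega> by (rule F_le_1[OF measurable_space[OF X_meas that]])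
    fix A assume A: "A \<in> sets (past (int s))"
    obtain C where C: "C \<in> sets (canonical_algebra S {..0})" "A = shifted (int s) -` C \<inter> space P"
      by (rule sets_past_shift[OF A])
    note [measurable] = shift_vimage_past(2)[OF C(1)]
    let ?A0 = "shifted 0 -` C \<inter> space P"
    have A0: "?A0 \<in> sets (past 0)" by (rule shift_vimage_past(1)[OF C(1)])
    have m1: "A \<inter> ?Es \<in> sets P" and m0: "?A0 \<inter> ?E \<in> sets P"
      using past_sets[OF A] past_sets[OF A0] Em Esm by auto
    have "emeasure P (A \<inter> ?Es) = (\<integral>\<^sup>+\<omega>. indicator (C \<inter> ?B) (shifted (int s) \<omega>) \<partial>P)"
      unfolding nn_integral_indicator[OF m1, symmetric]
      using measurable_space[OF shifted_measurable[of "int s"]]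
      by (intro nn_integral_cong) (auto simp: C(2) W_path_sum indicator_def)
    also have "\<dots> = (\<integral>\<^sup>+\<omega>. indicator (C \<inter> ?B) (shifted 0 \<omega>) \<partial>P)"
      by (rule shift_nn_integral) measurable
    also have "\<dots> = emeasure P (?A0 \<inter> ?E)"
      unfolding nn_integral_indicator[OF m0, symmetric]
      using measurable_space[OF shifted_measurable[of 0]] W_path_sum[of 0]
      by (intro nn_integral_cong) (auto simp: partial_sum_W indicator_def)
    also have "\<dots> = (\<integral>\<^sup>+\<omega>. emeasure (Px (X 0 \<omega>)) ?E * indicator ?A0 \<omega> \<partial>P)"
      by (rule Px_future[OF A0 event_sets])
    also have "\<dots> = (\<integral>\<^sup>+\<omega>. emeasure (Px (shifted 0 \<omega> 0)) ?E * indicator C (shifted 0 \<omega>) \<partial>P)"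
      by (intro nn_integral_cong) (simp add: shifted_def[of 0, simplified] indicator_def)
    also have "\<dots> = (\<integral>\<^sup>+\<omega>. emeasure (Px (shifted (int s) \<omega> 0)) ?E * indicator C (shifted (int s) \<omega>) \<partial>P)"
      by (rule shift_nn_integral[symmetric]) measurable
    also have "\<dots> = (\<integral>\<^sup>+\<omega>. ennreal (F l (X (int s) \<omega>) z) * indicator A \<omega> \<partial>P)"
    proof (rule nn_integral_cong)
      fix \<omega> assume \<omega>: "\<omega> \<in> space P"
      have "Px (X (int s) \<omega>) \<in> space (prob_algebra (process_algebra P S X UNIV))"
        by (rule measurable_space[OF Px_kernel measurable_space[OF X_meas \<omega>]])
      then interpret Px: prob_space "Px (X (int s) \<omega>)" by (simp add: space_prob_algebra)
      have "shifted (int s) \<omega> 0 = X (int s) \<omega>" by (simp add: shifted_def)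
      moreover have "indicator C (shifted (int s) \<omega>) = (indicator A \<omega> :: ennreal)" using \<omega> by (simp add: C(2) indicator_def)
      ultimately show "emeasure (Px (shifted (int s) \<omega> 0)) ?E * indicator C (shifted (int s) \<omega>) = ennreal (F l (X (int s) \<omega>) z) * indicator A \<omega>"
        by (simp only: Px.emeasure_eq_measure cond_cdf_def)
    qed
    finally show "emeasure P (A \<inter> ?Es) = (\<integral>\<^sup>+\<omega>. ennreal (F l (X (int s) \<omega>) z) * indicator A \<omega> \<partial>P)" .
  qed
  moreover have "AE \<omega> in P. real_cond_exp P (past (int s)) (\<lambda>\<omega>. indicator {..z} (W s l \<omega> / sqrt (v l))) \<omega> = real_cond_exp P (past (int s)) (indicator ?Es) \<omega>"
    by (rule F.real_cond_exp_cong) (auto simp: indicator_def intro!: AE_I2)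
  ultimately show ?thesis by eventually_elim simp
qed

text \<open>The right-hand side does not mention \<open>s\<close>: convergence of the conditional
  distribution functions given \<open>X 0\<close> is automatically uniform over starting
  times.\<close>

lemma conditional_cdf_error:
  "expectation (\<lambda>\<omega>. \<bar>real_cond_exp P (past (int s)) (\<lambda>\<omega>. indicator {..z} (W s l \<omega> / sqrt (v l))) \<omega> - c\<bar>)
    = expectation (\<lambda>\<omega>. \<bar>F l (X 0 \<omega>) z - c\<bar>)"
proof -
  have "expectation (\<lambda>\<omega>. \<bar>real_cond_exp P (past (int s)) (\<lambda>\<omega>. indicator {..z} (W s l \<omega> / sqrt (v l))) \<omega> - c\<bar>)
    = expectation (\<lambda>\<omega>. \<bar>F l (X (int s) \<omega>) z - c\<bar>)"
  proof (rule integral_cong_AE)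
    show "AE \<omega> in P. \<bar>real_cond_exp P (past (int s)) (\<lambda>\<omega>. indicator {..z} (W s l \<omega> / sqrt (v l))) \<omega> - c\<bar> = \<bar>F l (X (int s) \<omega>) z - c\<bar>"
      using conditional_cdf[of s z l] by eventually_elim simp
  qed measurable
  also have "\<dots> = expectation (\<lambda>\<omega>. \<bar>F l (shifted (int s) \<omega> 0) z - c\<bar>)" by (simp add: shifted_def)
  also have "\<dots> = expectation (\<lambda>\<omega>. \<bar>F l (shifted 0 \<omega> 0) z - c\<bar>)"
    by (rule shift_integral) measurable
  finally show ?thesis by (simp add: shifted_def)
qed

lemma F_error_integrable: "integrable P (\<lambda>\<omega>. \<bar>F l (X 0 \<omega>) z - cdf std_normal_distribution z\<bar>)"
proof (rule integrable_const_bound[where B = 1])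
  have "AE \<omega> in P. \<omega> \<in> space P" by simp
  then show "AE \<omega> in P. norm \<bar>F l (X 0 \<omega>) z - cdf std_normal_distribution z\<bar> \<le> 1"
  proof eventually_elim
    case (elim \<omega>)
    show ?case
      using F_nonneg[of l "X 0 \<omega>" z] F_le_1[OF measurable_space[OF X_meas elim, of 0], of l z] std_normal_cdf_bounds[of z]
      by (simp add: abs_le_iff)
  qed
qed measurable

abbreviation levy_error :: "nat \<Rightarrow> real" where
  "levy_error n \<equiv> (\<integral>x. levy_dist (cdf std_normal_distribution) (F n x) \<partial>(distr P S (X 0)))"

lemma levy_error_tendsto_iff:
  "levy_error \<longlonglongrightarrow> 0 \<longleftrightarrow> (\<forall>z. (\<lambda>n. expectation (\<lambda>\<omega>. \<bar>F n (X 0 \<omega>) z - cdf std_normal_distribution z\<bar>)) \<longlonglongrightarrow> 0)"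
proof -
  let ?\<Phi> = "cdf std_normal_distribution"
  have lm [measurable]: "(\<lambda>x. levy_dist ?\<Phi> (F n x)) \<in> borel_measurable S" for n
    by (rule levy_dist_measurable) (use F_mono F_nonneg F_le_1 in auto)
  have le: "levy_error n = expectation (\<lambda>\<omega>. levy_dist ?\<Phi> (F n (X 0 \<omega>)))" for n
    by (rule integral_distr) measurable
  have bounds: "0 \<le> levy_dist ?\<Phi> (F n (X 0 \<omega>))" "levy_dist ?\<Phi> (F n (X 0 \<omega>)) \<le> 1" if "\<omega> \<in> space P" for n \<omega>
    using levy_dist_bounds[of "F n (X 0 \<omega>)"] F_nonneg F_le_1[OF measurable_space[OF X_meas that]] by blast+
  have li: "integrable P (\<lambda>\<omega>. levy_dist ?\<Phi> (F n (X 0 \<omega>)))" for n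
    by (rule integrable_const_bound[where B = 1]) (use bounds in \<open>auto intro!: AE_I2\<close>)
  show ?thesis
  proof
    assume *: "levy_error \<longlonglongrightarrow> 0"
    show "\<forall>z. (\<lambda>n. expectation (\<lambda>\<omega>. \<bar>F n (X 0 \<omega>) z - ?\<Phi> z\<bar>)) \<longlonglongrightarrow> 0"
    proof
      fix z
      show "(\<lambda>n. expectation (\<lambda>\<omega>. \<bar>F n (X 0 \<omega>) z - ?\<Phi> z\<bar>)) \<longlonglongrightarrow> 0"
      proof (rule tendsto_sandwich[OF _ _ tendsto_const])
        show "(\<lambda>n. 2 * levy_error n) \<longlonglongrightarrow> 0" using tendsto_mult_right_zero[OF *, of 2] by simp
        show "\<forall>\<^sub>F n in sequentially. expectation (\<lambda>\<omega>. \<bar>F n (X 0 \<omega>) z - ?\<Phi> z\<bar>) \<le> 2 * levy_error n"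
        proof (rule always_eventually, rule allI)
          fix n
          have "expectation (\<lambda>\<omega>. \<bar>F n (X 0 \<omega>) z - ?\<Phi> z\<bar>) \<le> expectation (\<lambda>\<omega>. 2 * levy_dist ?\<Phi> (F n (X 0 \<omega>)))"
          proof (rule integral_mono[OF F_error_integrable])
            fix \<omega> assume "\<omega> \<in> space P"
            then show "\<bar>F n (X 0 \<omega>) z - ?\<Phi> z\<bar> \<le> 2 * levy_dist ?\<Phi> (F n (X 0 \<omega>))"
              using F_nonneg F_le_1[OF measurable_space[OF X_meas]] by (intro cdf_diff_le_levy_dist) auto
          qed (use li in simp)
          then show "expectation (\<lambda>\<omega>. \<bar>F n (X 0 \<omega>) z - ?\<Phi> z\<bar>) \<le> 2 * levy_error n" by (simp add: le)
        qed
      qed (simp add: always_eventually)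
    qed
  next
    assume *: "\<forall>z. (\<lambda>n. expectation (\<lambda>\<omega>. \<bar>F n (X 0 \<omega>) z - ?\<Phi> z\<bar>)) \<longlonglongrightarrow> 0"
    show "levy_error \<longlonglongrightarrow> 0"
    proof (rule tendstoI)
      fix e :: real assume e: "e > 0"
      then have "e / 2 > 0" by simp
      \<comment> \<open>The grid is chosen before \<open>n\<close> and the sample point, so
        convergence at finitely many arguments suffices.\<close>
      then obtain I where I: "finite I" "\<And>G. mono G \<Longrightarrow> (\<And>x. 0 \<le> G x) \<Longrightarrow> (\<And>x. G x \<le> 1) \<Longrightarrow>
        levy_dist ?\<Phi> G \<le> e / 2 + (\<Sum>z\<in>I. \<bar>G z - ?\<Phi> z\<bar>)"
        by (rule levy_dist_le_grid) blast
      have "(\<lambda>n. \<Sum>z\<in>I. expectation (\<lambda>\<omega>. \<bar>F n (X 0 \<omega>) z - ?\<Phi> z\<bar>)) \<longlonglongrightarrow> (\<Sum>z\<in>I. 0)"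
        using * by (intro tendsto_sum) simp
      then have "\<forall>\<^sub>F n in sequentially. (\<Sum>z\<in>I. expectation (\<lambda>\<omega>. \<bar>F n (X 0 \<omega>) z - ?\<Phi> z\<bar>)) < e / 2"
        using e by (intro order_tendstoD(2)[of _ 0]) auto
      then show "\<forall>\<^sub>F n in sequentially. dist (levy_error n) 0 < e"
      proof eventually_elim
        case (elim n)
        have "levy_error n \<le> expectation (\<lambda>\<omega>. e / 2 + (\<Sum>z\<in>I. \<bar>F n (X 0 \<omega>) z - ?\<Phi> z\<bar>))"
          unfolding le
        proof (rule integral_mono[OF li])
          show "integrable P (\<lambda>\<omega>. e / 2 + (\<Sum>z\<in>I. \<bar>F n (X 0 \<omega>) z - ?\<Phi> z\<bar>))" using F_error_integrable by simp
          fix \<omega> assume "\<omega> \<in> space P"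
          note x = measurable_space[OF X_meas this, of 0]
          show "levy_dist ?\<Phi> (F n (X 0 \<omega>)) \<le> e / 2 + (\<Sum>z\<in>I. \<bar>F n (X 0 \<omega>) z - ?\<Phi> z\<bar>)"
            by (rule I(2)[OF F_mono[OF x] F_nonneg F_le_1[OF x]])
        qed
        also have "\<dots> = e / 2 + (\<Sum>z\<in>I. expectation (\<lambda>\<omega>. \<bar>F n (X 0 \<omega>) z - ?\<Phi> z\<bar>))"
          using F_error_integrable by (simp add: prob_space)
        finally have "levy_error n < e" using elim by simp
        moreover have "0 \<le> levy_error n" unfolding le by (rule integral_nonneg_AE) (use bounds in \<open>auto intro!: AE_I2\<close>)
        ultimately show ?case by simp
      qed
    qed
  qed
qed

section \<open>Array conditions and pointwise conditional normality\<close>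

lemma past_pred: "past (int (Suc k) - 1) = past (int k)" by simp

definition lindeberg_array :: "(nat \<Rightarrow> nat \<Rightarrow> 'w \<Rightarrow> real) \<Rightarrow> bool" where
  "lindeberg_array D \<longleftrightarrow> martingale_approximation P S X g D \<and>
       conv_in_prob P
         (\<lambda>n \<omega>. 1 / v n * (\<Sum>k=1..n. real_cond_exp P (past (int k - 1)) (\<lambda>\<omega>. (D n k \<omega>)\<^sup>2) \<omega>))
         (\<lambda>_. 1) \<and>
       (\<forall>\<epsilon>>0. conv_in_prob P
         (\<lambda>n \<omega>. 1 / v n * (\<Sum>k=1..n. real_cond_exp P (past (int k - 1))
              (\<lambda>\<omega>. (D n k \<omega>)\<^sup>2 * indicator {\<omega>. \<epsilon> * sqrt (v n) \<le> \<bar>D n k \<omega>\<bar>} \<omega>) \<omega>))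
         (\<lambda>_. 0))"

lemma v_eventually_pos: "\<forall>\<^sub>F n in sequentially. v n > 0"
  using var_lim by (simp add: filterlim_at_top_dense)

lemma sum_Suc_shift: "(\<Sum>k=1..n. f k) = (\<Sum>k<n. f (Suc k))" for f :: "nat \<Rightarrow> 'b::comm_monoid_add"
  by (simp add: sum.atLeast1_atMost_eq)

lemma lindeberg_array_imp_normal:
  assumes D: "lindeberg_array D"
  shows "(\<lambda>n. expectation (\<lambda>\<omega>. \<bar>F n (X 0 \<omega>) z - cdf std_normal_distribution z\<bar>)) \<longlonglongrightarrow> 0"
proof -
  let ?\<Phi> = "cdf std_normal_distribution"
  \<comment> \<open>Renumbering from 0, so that \<open>d n k\<close> leads from the past of
    \<open>k\<close> to that of \<open>Suc k\<close>.\<close>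
  define d where "d n k = D n (Suc k)" for n k
  have appr: "martingale_approximation P S X g D" using D by (simp add: lindeberg_array_def)
  have mart: "d n k \<in> borel_measurable (past (int (Suc k))) \<and> (AE \<omega> in P. CE k (d n k) \<omega> = 0)" if "n \<ge> 1" for n k
  proof -
    have "martingale_differences P past (D n)" using appr that by (simp add: martingale_approximation_def)
    then have "Suc k \<ge> 1 \<longrightarrow> D n (Suc k) \<in> borel_measurable (past (int (Suc k))) \<and> integrable P (D n (Suc k)) \<and>
        (AE \<omega> in P. real_cond_exp P (past (int (Suc k) - 1)) (D n (Suc k)) \<omega> = 0)"
      unfolding martingale_differences_def by blast
    then show ?thesis unfolding past_pred by (simp add: d_def)
  qed
  \<comment> \<open>Finiteness of the extended error integral, known for large \<open>n\<close>, is
    what makes the error square integrable.\<close>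
  have err: "\<forall>\<^sub>F n in sequentially. \<forall>k\<le>n. in_L2 P (\<lambda>\<omega>. W 0 k \<omega> - (\<Sum>i<k. d n i \<omega>)) \<and>
     expectation (\<lambda>\<omega>. (W 0 k \<omega> - (\<Sum>i<k. d n i \<omega>))\<^sup>2) \<le> \<epsilon> * v n" if \<epsilon>: "\<epsilon> > 0" for \<epsilon>
  proof -
    have "\<forall>\<^sub>F n in sequentially. (MAX k\<in>{..n}. \<integral>\<^sup>+\<omega>. ennreal ((partial_sum g X k \<omega> - (\<Sum>j=1..k. D n j \<omega>))\<^sup>2) \<partial>P) / ennreal (v n) \<le> ennreal \<epsilon>"
      using appr \<epsilon> unfolding martingale_approximation_def tendsto_zero_ennreal_iff by blast
    then show ?thesis
      using v_eventually_pos eventually_ge_at_top[of 1]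
    proof eventually_elim
      case (elim n)
      show ?case
      proof (intro allI impI)
        fix k assume k: "k \<le> n"
        let ?R = "\<lambda>\<omega>. W 0 k \<omega> - (\<Sum>i<k. d n i \<omega>)"
        have Rm [measurable]: "?R \<in> borel_measurable P"
          using measurable_F[of _ "Suc _"] mart[OF elim(3)]
          by (intro borel_measurable_diff borel_measurable_sum W_M) (blast intro: measurable_F)
        have Rd: "?R \<omega> = partial_sum g X k \<omega> - (\<Sum>j=1..k. D n j \<omega>)" for \<omega>
          unfolding partial_sum_W sum_Suc_shift d_def ..
        have "(\<integral>\<^sup>+\<omega>. ennreal ((?R \<omega>)\<^sup>2) \<partial>P) \<le> (MAX k\<in>{..n}. \<integral>\<^sup>+\<omega>. ennreal ((partial_sum g X k \<omega> - (\<Sum>j=1..k. D n j \<omega>))\<^sup>2) \<partial>P)"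
          unfolding Rd by (rule Max_ge) (use k in auto)
        also have "\<dots> = \<dots> / ennreal (v n) * ennreal (v n)"
        proof -
          have "ennreal (v n) / ennreal (v n) = 1" using elim(2) by (simp add: divide_ennreal)
          then show ?thesis by (simp only: ennreal_divide_times mult_1_right)
        qed
        also have "\<dots> \<le> ennreal \<epsilon> * ennreal (v n)" by (rule mult_right_mono[OF elim(1)]) simp
        also have "\<dots> = ennreal (\<epsilon> * v n)" using \<epsilon> elim(2) by (simp add: ennreal_mult)
        finally have nn: "(\<integral>\<^sup>+\<omega>. ennreal ((?R \<omega>)\<^sup>2) \<partial>P) \<le> ennreal (\<epsilon> * v n)" .
        then have "integrable P (\<lambda>\<omega>. (?R \<omega>)\<^sup>2)"
          by (intro integrableI_nonneg) (auto intro: le_less_trans)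
        moreover from this have "expectation (\<lambda>\<omega>. (?R \<omega>)\<^sup>2) \<le> \<epsilon> * v n"
          using nn \<epsilon> elim(2) by (subst (asm) nn_integral_eq_integral) (auto simp: ennreal_le_iff)
        ultimately show "in_L2 P ?R \<and> expectation (\<lambda>\<omega>. (?R \<omega>)\<^sup>2) \<le> \<epsilon> * v n"
          using Rm by (simp add: in_L2_def)
      qed
    qed
  qed
  \<comment> \<open>Square integrability is not part of \<open>martingale_differences\<close>. The
    martingale is a window sum minus its error, both square integrable, and each difference is the
    difference of two consecutive martingale values.\<close>
  have dL2: "\<forall>\<^sub>F n in sequentially. \<forall>k<n. in_L2 P (d n k) \<and> d n k \<in> borel_measurable (past (int (Suc k))) \<and> (AE \<omega> in P. CE k (d n k) \<omega> = 0)"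
    using err[OF zero_less_one] eventually_ge_at_top[of 1]
  proof eventually_elim
    case (elim n)
    have partial: "in_L2 P (\<lambda>\<omega>. \<Sum>i<k. d n i \<omega>)" if "k \<le> n" for k
      using in_L2_diff[OF W_L2[of 0 k], of "\<lambda>\<omega>. W 0 k \<omega> - (\<Sum>i<k. d n i \<omega>)"] elim(1) that by simp
    have "in_L2 P (d n k)" if "k < n" for k
      using in_L2_diff[OF partial[of "Suc k"] partial[of k]] that by simp
    then show ?case using mart[OF elim(2)] by simp
  qed
  have var: "conv_in_prob P (\<lambda>n \<omega>. 1 / v n * (\<Sum>k<n. CE k (\<lambda>\<omega>. (d n k \<omega>)\<^sup>2) \<omega>)) (\<lambda>_. 1)"
    using D unfolding lindeberg_array_def sum_Suc_shift past_pred d_def by blast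
  have lind: "conv_in_prob P (\<lambda>n \<omega>. 1 / v n * (\<Sum>k<n. CE k
      (\<lambda>\<omega>. (d n k \<omega>)\<^sup>2 * indicator {\<omega>. \<epsilon> * sqrt (v n) \<le> \<bar>d n k \<omega>\<bar>} \<omega>) \<omega>)) (\<lambda>_. 0)" if "\<epsilon> > 0" for \<epsilon>
    using D that unfolding lindeberg_array_def sum_Suc_shift past_pred d_def by blast
  define Z where "Z n \<omega> = W 0 n \<omega> / sqrt (v n)" for n \<omega>
  have Zm [measurable]: "Z n \<in> borel_measurable P" for n unfolding Z_def[abs_def] by measurable
  have clt: "(\<lambda>n. \<integral>\<omega>. of_real (h n \<omega>) * (iexp (t * Z n \<omega>) - of_real (exp (- (t\<^sup>2 / 2)))) \<partial>P) \<longlonglongrightarrow> 0"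
    if "\<And>n. h n \<in> borel_measurable (past 0)" "\<And>n \<omega>. \<bar>h n \<omega>\<bar> \<le> 1" for h :: "nat \<Rightarrow> 'w \<Rightarrow> real" and t
    unfolding Z_def
  proof (rule martingale_array_clt[OF v_eventually_pos W_L2 W_var dL2 _ var lind])
    show "\<forall>\<^sub>F n in sequentially. expectation (\<lambda>\<omega>. (W 0 n \<omega> - (\<Sum>k<n. d n k \<omega>))\<^sup>2) \<le> \<epsilon> * v n" if "\<epsilon> > 0" for \<epsilon>
      using err[OF that] by eventually_elim simp
  qed (use that in auto)
  \<comment> \<open>A weight known at time 0 allows the indicator to be replaced by its conditional
    mean \<open>F n (X 0) z\<close>.\<close>
  have restricted: "(\<lambda>n. expectation (\<lambda>\<omega>. h n \<omega> * (F n (X 0 \<omega>) z - ?\<Phi> z))) \<longlonglongrightarrow> 0"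
    if h: "\<And>n. h n \<in> borel_measurable (past 0)" "\<And>n \<omega>. 0 \<le> h n \<omega>" "\<And>n \<omega>. h n \<omega> \<le> 1" for h :: "nat \<Rightarrow> 'w \<Rightarrow> real"
  proof -
    have hm: "h n \<in> borel_measurable P" for n using h(1) measurable_from_subalg[OF past_subalgebra] by blast
    have "(\<lambda>n. \<integral>\<omega>. h n \<omega> * (indicator {..z} (Z n \<omega>) - ?\<Phi> z) \<partial>P) \<longlonglongrightarrow> 0"
    proof (rule restricted_clt[OF Zm hm h(2,3)])
      show "(\<lambda>n. \<integral>\<omega>. of_real (h n \<omega>) * (iexp (t * Z n \<omega>) - of_real (exp (- (t\<^sup>2 / 2)))) \<partial>P) \<longlonglongrightarrow> 0" for t
        by (rule clt) (use h in auto)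
      show "(\<lambda>n. \<integral>\<omega>. of_real 1 * (iexp (t * Z n \<omega>) - of_real (exp (- (t\<^sup>2 / 2)))) \<partial>P) \<longlonglongrightarrow> 0" for t
        by (rule clt[of "\<lambda>_ _. 1"]) auto
    qed
    moreover have "(\<integral>\<omega>. h n \<omega> * (indicator {..z} (Z n \<omega>) - ?\<Phi> z) \<partial>P) = expectation (\<lambda>\<omega>. h n \<omega> * (F n (X 0 \<omega>) z - ?\<Phi> z))" for n
    proof -
      note [measurable] = hm
      have i1: "integrable P (\<lambda>\<omega>. h n \<omega> * indicator {..z} (Z n \<omega>))"
        by (rule integrable_const_bound[where B = 1]) (use h in \<open>auto simp: indicator_def\<close>)
      have i2: "integrable P (h n)" by (rule integrable_const_bound[where B = 1]) (use h in auto)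
      have h0: "h n \<in> borel_measurable (past (int 0))" using h(1) by simp
      note ce = F.real_cond_exp_intg[where ?f = "h n" and ?g = "\<lambda>\<omega>. indicator {..z} (Z n \<omega>)" and k = 0, OF i1 h0]
      have "(\<integral>\<omega>. h n \<omega> * indicator {..z} (Z n \<omega>) \<partial>P) = (\<integral>\<omega>. h n \<omega> * real_cond_exp P (past (int 0)) (\<lambda>\<omega>. indicator {..z} (Z n \<omega>)) \<omega> \<partial>P)"
        by (rule ce(2)[symmetric]) measurable
      also have "\<dots> = (\<integral>\<omega>. h n \<omega> * F n (X 0 \<omega>) z \<partial>P)"
      proof (rule integral_cong_AE)
        show "AE \<omega> in P. h n \<omega> * real_cond_exp P (past (int 0)) (\<lambda>\<omega>. indicator {..z} (Z n \<omega>)) \<omega> = h n \<omega> * F n (X 0 \<omega>) z"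
          using conditional_cdf[of 0 z n] unfolding Z_def by eventually_elim simp
      qed measurable
      finally have e: "(\<integral>\<omega>. h n \<omega> * indicator {..z} (Z n \<omega>) \<partial>P) = (\<integral>\<omega>. h n \<omega> * F n (X 0 \<omega>) z \<partial>P)" .
      have i3: "integrable P (\<lambda>\<omega>. h n \<omega> * F n (X 0 \<omega>) z)"
      proof (rule integrable_const_bound[where B = 1])
        have "AE \<omega> in P. \<omega> \<in> space P" by simp
        then show "AE \<omega> in P. norm (h n \<omega> * F n (X 0 \<omega>) z) \<le> 1"
        proof eventually_elim
          case (elim \<omega>)
          show ?case using h(2,3)[of n \<omega>] F_nonneg[of n "X 0 \<omega>" z] F_le_1[OF measurable_space[OF X_meas elim, of 0], of n z]
            by (simp add: abs_mult mult_le_one)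
        qed
      qed measurable
      show ?thesis unfolding right_diff_distrib using i1 i2 i3 e by simp
    qed
    ultimately show ?thesis by simp
  qed
  have Fpast: "(\<lambda>\<omega>. F n (X 0 \<omega>) z) \<in> borel_measurable (past 0)" for n
    by (rule measurable_compose[OF measurable_process_algebra F_measurable]) auto
  \<comment> \<open>The sign of the deviation becomes the weight. It depends on \<open>n\<close>,
    which is why the limit theorem was stated for weights varying with \<open>n\<close>.\<close>
  define p where "p n \<omega> = (if F n (X 0 \<omega>) z > ?\<Phi> z then 1 else 0 :: real)" for n \<omega>
  define m where "m n \<omega> = (if F n (X 0 \<omega>) z > ?\<Phi> z then 0 else 1 :: real)" for n \<omega>
  have pm: "p n \<in> borel_measurable (past 0)" "m n \<in> borel_measurable (past 0)" for n
    unfolding p_def[abs_def] m_def[abs_def] using Fpast by measurable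
  have "(\<lambda>n. expectation (\<lambda>\<omega>. p n \<omega> * (F n (X 0 \<omega>) z - ?\<Phi> z)) - expectation (\<lambda>\<omega>. m n \<omega> * (F n (X 0 \<omega>) z - ?\<Phi> z))) \<longlonglongrightarrow> 0 - 0"
    by (intro tendsto_diff restricted pm) (auto simp: p_def m_def)
  moreover have "expectation (\<lambda>\<omega>. p n \<omega> * (F n (X 0 \<omega>) z - ?\<Phi> z)) - expectation (\<lambda>\<omega>. m n \<omega> * (F n (X 0 \<omega>) z - ?\<Phi> z)) =
    expectation (\<lambda>\<omega>. \<bar>F n (X 0 \<omega>) z - ?\<Phi> z\<bar>)" for n
  proof -
    note [measurable] = measurable_from_subalg[OF past_subalgebra pm(1)[of n]] measurable_from_subalg[OF past_subalgebra pm(2)[of n]]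
    have j1: "integrable P (\<lambda>\<omega>. p n \<omega> * (F n (X 0 \<omega>) z - ?\<Phi> z))"
      by (rule Bochner_Integration.integrable_bound[OF F_error_integrable[of n z]]) (auto simp: p_def)
    have j2: "integrable P (\<lambda>\<omega>. m n \<omega> * (F n (X 0 \<omega>) z - ?\<Phi> z))"
      by (rule Bochner_Integration.integrable_bound[OF F_error_integrable[of n z]]) (auto simp: m_def)
    show ?thesis
      unfolding Bochner_Integration.integral_diff[OF j1 j2, symmetric]
      by (intro Bochner_Integration.integral_cong) (auto simp: p_def m_def)
  qed
  ultimately show ?thesis by simp
qed

lemma normal_imp_lindeberg_array:
  assumes N: "\<And>z. (\<lambda>n. expectation (\<lambda>\<omega>. \<bar>F n (X 0 \<omega>) z - cdf std_normal_distribution z\<bar>)) \<longlonglongrightarrow> 0"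
  obtains D where "lindeberg_array D"
proof -
  interpret normal_partial_sums P "\<lambda>k. past (int k)" Y v
  proof
    show "filterlim v at_top sequentially" by (rule var_lim)
    fix z \<epsilon> :: real assume "\<epsilon> > 0"
    then have "\<forall>\<^sub>F l in sequentially. expectation (\<lambda>\<omega>. \<bar>F l (X 0 \<omega>) z - cdf std_normal_distribution z\<bar>) < \<epsilon>"
      using N by (intro order_tendstoD(2)[of _ 0]) auto
    then show "\<forall>\<^sub>F l in sequentially. \<forall>s. expectation (\<lambda>\<omega>. \<bar>CE s (\<lambda>\<omega>. indicator {..z} (W s l \<omega> / sqrt (v l))) \<omega> - cdf std_normal_distribution z\<bar>) \<le> \<epsilon>"
      by eventually_elim (simp add: conditional_cdf_error)
  qed
  define mart where "mart d \<longleftrightarrow> (\<forall>k. d k \<in> borel_measurable (past (int (Suc k))) \<and> in_L2 P (d k) \<and> (AE \<omega> in P. CE k (d k) \<omega> = 0))"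
    for d :: "nat \<Rightarrow> 'w \<Rightarrow> real"
  \<comment> \<open>Positivity of \<open>v n\<close> is recorded so that dividing by it is
    legitimate wherever \<open>G\<close> holds.\<close>
  define G where "G \<epsilon> n d \<longleftrightarrow> v n > 0 \<and> mart d \<and> (\<forall>k. AE \<omega> in P. \<bar>d k \<omega>\<bar> \<le> \<epsilon> * sqrt (v n)) \<and>
    (\<forall>k\<le>n. expectation (\<lambda>\<omega>. (W 0 k \<omega> - (\<Sum>i<k. d i \<omega>))\<^sup>2) \<le> \<epsilon> * v n) \<and>
    expectation (\<lambda>\<omega>. \<bar>(\<Sum>k<n. CE k (\<lambda>\<omega>. (d k \<omega>)\<^sup>2) \<omega>) - v n\<bar>) \<le> \<epsilon> * v n" for \<epsilon> n d
  have "\<forall>\<^sub>F n in sequentially. \<exists>d. G \<epsilon> n d" if "\<epsilon> > 0" for \<epsilon>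
    using martingale_approximation_exists[OF that] v_eventually_pos
  proof eventually_elim
    case (elim n)
    then obtain d where "(\<forall>k. d k \<in> borel_measurable (past (int (Suc k))) \<and> in_L2 P (d k) \<and> (AE \<omega> in P. CE k (d k) \<omega> = 0) \<and>
      (AE \<omega> in P. \<bar>d k \<omega>\<bar> \<le> \<epsilon> * sqrt (v n))) \<and>
      (\<forall>k\<le>n. expectation (\<lambda>\<omega>. (W 0 k \<omega> - (\<Sum>i<k. d i \<omega>))\<^sup>2) \<le> \<epsilon> * v n) \<and>
      expectation (\<lambda>\<omega>. \<bar>(\<Sum>k<n. CE k (\<lambda>\<omega>. (d k \<omega>)\<^sup>2) \<omega>) - v n\<bar>) \<le> \<epsilon> * v n" by blast
    then have "G \<epsilon> n d" using elim(2) unfolding G_def mart_def by simp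
    then show ?case by blast
  qed
  moreover have "G \<delta> n d" if "0 < \<epsilon>" "\<epsilon> \<le> \<delta>" "G \<epsilon> n d" for \<epsilon> \<delta> n d
  proof -
    have vn: "v n > 0" using that by (simp add: G_def)
    then have le: "\<epsilon> * v n \<le> \<delta> * v n" "\<epsilon> * sqrt (v n) \<le> \<delta> * sqrt (v n)" using that by (auto intro!: mult_right_mono)
    have "AE \<omega> in P. \<bar>d k \<omega>\<bar> \<le> \<delta> * sqrt (v n)" for k
    proof -
      have "AE \<omega> in P. \<bar>d k \<omega>\<bar> \<le> \<epsilon> * sqrt (v n)" using that(3) by (simp add: G_def)
      then show ?thesis by eventually_elim (use le in linarith)
    qed
    moreover have "expectation (\<lambda>\<omega>. (W 0 k \<omega> - (\<Sum>i<k. d i \<omega>))\<^sup>2) \<le> \<delta> * v n" if k: "k \<le> n" for k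
      by (rule order_trans[OF _ le(1)]) (use \<open>G \<epsilon> n d\<close> k in \<open>simp add: G_def\<close>)
    moreover have "expectation (\<lambda>\<omega>. \<bar>(\<Sum>k<n. CE k (\<lambda>\<omega>. (d k \<omega>)\<^sup>2) \<omega>) - v n\<bar>) \<le> \<delta> * v n"
      by (rule order_trans[OF _ le(1)]) (use that(3) in \<open>simp add: G_def\<close>)
    ultimately show ?thesis using that(3) unfolding G_def by simp
  qed
  ultimately obtain D0 where D0: "\<And>\<epsilon>. \<epsilon> > 0 \<Longrightarrow> \<forall>\<^sub>F n in sequentially. G \<epsilon> n (D0 n)"
  proof (rule diagonal_selection)
    fix D assume "\<And>\<epsilon>. \<epsilon> > 0 \<Longrightarrow> \<forall>\<^sub>F n in sequentially. G \<epsilon> n (D n)"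
    then show thesis by (rule that)
  qed
  \<comment> \<open>Martingale differences are demanded for every \<open>n \<ge> 1\<close>, whereas
    the selection is good only for large \<open>n\<close>; the rows that fail are replaced by
    0.\<close>
  define d where "d n k = (if mart (D0 n) then D0 n k else (\<lambda>_. 0))" for n k
  have d_mart: "mart (d n)" for n
  proof (cases "mart (D0 n)")
    case True
    then show ?thesis by (simp add: d_def mart_def)
  next
    case False
    have "AE \<omega> in P. CE k (\<lambda>_. 0) \<omega> = 0" for k by (rule F.real_cond_exp_F_meas) auto
    then show ?thesis using False in_L2_const[of 0] by (simp add: d_def mart_def)
  qed
  have dG: "\<forall>\<^sub>F n in sequentially. G \<epsilon> n (d n)" if "\<epsilon> > 0" for \<epsilon>
    using D0[OF that]
  proof eventually_elim
    case (elim n)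
    then have "mart (D0 n)" by (simp add: G_def)
    then have "d n = D0 n" by (simp add: d_def fun_eq_iff)
    then show ?case using elim by simp
  qed
  have dm [measurable]: "d n k \<in> borel_measurable P" for n k using d_mart[of n] by (simp add: mart_def in_L2_def)
  have d2: "integrable P (\<lambda>\<omega>. (d n k \<omega>)\<^sup>2)" for n k using d_mart[of n] by (simp add: mart_def in_L2_def)
  \<comment> \<open>Renumbering back to start at 1. At \<open>j = 0\<close> truncated subtraction
    repeats \<open>d n 0\<close>, outside the range of all sums.\<close>
  define D where "D n j = d n (j - 1)" for n j
  have DS: "D n (Suc k) = d n k" for n k by (simp add: D_def)
  have "martingale_approximation P S X g D"
    unfolding martingale_approximation_def
  proof (intro conjI allI impI)
    fix n :: nat
    show "martingale_differences P past (D n)"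
      unfolding martingale_differences_def
    proof (intro allI impI)
      fix j :: nat assume "j \<ge> 1"
      then obtain k where j: "j = Suc k" by (cases j) auto
      have "in_L2 P (d n k)" using d_mart[of n] by (simp add: mart_def)
      then show "D n j \<in> borel_measurable (past (int j)) \<and> integrable P (D n j) \<and> (AE \<omega> in P. real_cond_exp P (past (int j - 1)) (D n j) \<omega> = 0)"
        unfolding j past_pred DS using d_mart[of n] in_L2_integrable by (simp add: mart_def)
    qed
  next
    show "(\<lambda>n. (MAX k\<in>{..n}. \<integral>\<^sup>+\<omega>. ennreal ((partial_sum g X k \<omega> - (\<Sum>j=1..k. D n j \<omega>))\<^sup>2) \<partial>P) / ennreal (v n)) \<longlonglongrightarrow> 0"
      unfolding tendsto_zero_ennreal_iff
    proof (intro allI impI)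
      fix \<epsilon> :: real assume \<epsilon>: "\<epsilon> > 0"
      show "\<forall>\<^sub>F n in sequentially. (MAX k\<in>{..n}. \<integral>\<^sup>+\<omega>. ennreal ((partial_sum g X k \<omega> - (\<Sum>j=1..k. D n j \<omega>))\<^sup>2) \<partial>P) / ennreal (v n) \<le> ennreal \<epsilon>"
        using dG[OF \<epsilon>]
      proof eventually_elim
        case (elim n)
        have vn: "v n > 0" using elim by (simp add: G_def)
        have "(MAX k\<in>{..n}. \<integral>\<^sup>+\<omega>. ennreal ((partial_sum g X k \<omega> - (\<Sum>j=1..k. D n j \<omega>))\<^sup>2) \<partial>P) \<le> ennreal (\<epsilon> * v n)"
        proof (rule Max.boundedI)
          fix a assume "a \<in> (\<lambda>k. \<integral>\<^sup>+\<omega>. ennreal ((partial_sum g X k \<omega> - (\<Sum>j=1..k. D n j \<omega>))\<^sup>2) \<partial>P) ` {..n}"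
          then obtain k where k: "k \<le> n" "a = (\<integral>\<^sup>+\<omega>. ennreal ((partial_sum g X k \<omega> - (\<Sum>j=1..k. D n j \<omega>))\<^sup>2) \<partial>P)" by auto
          have "in_L2 P (\<lambda>\<omega>. W 0 k \<omega> - (\<Sum>i<k. d n i \<omega>))"
            by (rule in_L2_diff[OF W_L2 in_L2_sum]) (use d_mart[of n] in \<open>simp add: mart_def\<close>)
          then have "a = ennreal (expectation (\<lambda>\<omega>. (W 0 k \<omega> - (\<Sum>i<k. d n i \<omega>))\<^sup>2))"
            unfolding k partial_sum_W sum_Suc_shift DS by (intro nn_integral_eq_integral) (auto simp: in_L2_def)
          then show "a \<le> ennreal (\<epsilon> * v n)" using elim k(1) by (simp add: G_def ennreal_leI)
        qed auto
        then have "(MAX k\<in>{..n}. \<integral>\<^sup>+\<omega>. ennreal ((partial_sum g X k \<omega> - (\<Sum>j=1..k. D n j \<omega>))\<^sup>2) \<partial>P) / ennreal (v n) \<le> ennreal (\<epsilon> * v n) / ennreal (v n)"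
          by (rule divide_right_mono_ennreal)
        also have "\<dots> = ennreal \<epsilon>" using vn \<epsilon> by (simp add: divide_ennreal)
        finally show ?case .
      qed
    qed
  qed
  moreover have "conv_in_prob P (\<lambda>n \<omega>. 1 / v n * (\<Sum>k=1..n. real_cond_exp P (past (int k - 1)) (\<lambda>\<omega>. (D n k \<omega>)\<^sup>2) \<omega>)) (\<lambda>_. 1)"
    unfolding conv_in_prob_def sum_Suc_shift past_pred DS
  proof (intro allI impI)
    fix \<epsilon> :: real assume \<epsilon>: "\<epsilon> > 0"
    let ?V = "\<lambda>n \<omega>. \<Sum>k<n. CE k (\<lambda>\<omega>. (d n k \<omega>)\<^sup>2) \<omega>"
    show "(\<lambda>n. prob {\<omega> \<in> space P. \<epsilon> \<le> \<bar>1 / v n * ?V n \<omega> - 1\<bar>}) \<longlonglongrightarrow> 0"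
    proof (rule tendstoI)
      fix \<delta> :: real assume \<delta>: "\<delta> > 0"
      \<comment> \<open>Markov's inequality divides by \<epsilon>, so the accuracy
        \<open>\<epsilon> * \<delta> / 2\<close> leaves \<open>\<delta> / 2\<close>.\<close>
      then have "\<epsilon> * \<delta> / 2 > 0" using \<epsilon> by simp
      from dG[OF this] show "\<forall>\<^sub>F n in sequentially. dist (prob {\<omega> \<in> space P. \<epsilon> \<le> \<bar>1 / v n * ?V n \<omega> - 1\<bar>}) 0 < \<delta>"
      proof eventually_elim
        case (elim n)
        have vn: "v n > 0" using elim by (simp add: G_def)
        have i: "integrable P (\<lambda>\<omega>. \<bar>?V n \<omega> - v n\<bar>)" using F.real_cond_exp_int(1)[OF d2] by simp
        have "{\<omega> \<in> space P. \<epsilon> \<le> \<bar>1 / v n * ?V n \<omega> - 1\<bar>} = {\<omega> \<in> space P. \<epsilon> * v n \<le> \<bar>?V n \<omega> - v n\<bar>}"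
        proof -
          have "\<bar>1 / v n * y - 1\<bar> = \<bar>y - v n\<bar> / v n" for y
          proof -
            have "1 / v n * y - 1 = (y - v n) / v n" using vn by (simp add: field_simps)
            then show ?thesis using vn by (simp add: abs_divide)
          qed
          then show ?thesis using vn by (simp add: le_divide_eq)
        qed
        also have "prob \<dots> \<le> expectation (\<lambda>\<omega>. \<bar>?V n \<omega> - v n\<bar>) / (\<epsilon> * v n)"
          by (rule integral_Markov_inequality_measure[OF i, where A = "{}"]) (use \<epsilon> vn in auto)
        also have "\<dots> \<le> (\<epsilon> * \<delta> / 2 * v n) / (\<epsilon> * v n)"
          using elim \<epsilon> vn by (intro divide_right_mono) (auto simp: G_def)
        also have "\<dots> < \<delta>" using \<epsilon> \<delta> vn by simp
        finally show ?case by simp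
      qed
    qed
  qed
  moreover have "conv_in_prob P (\<lambda>n \<omega>. 1 / v n * (\<Sum>k=1..n. real_cond_exp P (past (int k - 1))
      (\<lambda>\<omega>. (D n k \<omega>)\<^sup>2 * indicator {\<omega>. \<epsilon> * sqrt (v n) \<le> \<bar>D n k \<omega>\<bar>} \<omega>) \<omega>)) (\<lambda>_. 0)" if \<epsilon>: "\<epsilon> > 0" for \<epsilon>
    unfolding conv_in_prob_def sum_Suc_shift past_pred DS
  proof (intro allI impI)
    fix \<delta> :: real assume \<delta>: "\<delta> > 0"
    let ?l = "\<lambda>n k \<omega>. (d n k \<omega>)\<^sup>2 * indicator {\<omega>. \<epsilon> * sqrt (v n) \<le> \<bar>d n k \<omega>\<bar>} \<omega>"
    \<comment> \<open>Increments bounded by half the threshold never reach it, so for large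
      \<open>n\<close> the Lindeberg sums vanish almost surely and the probabilities are exactly
      0.\<close>
    have "\<epsilon> / 2 > 0" using \<epsilon> by simp
    from dG[OF this] have "\<forall>\<^sub>F n in sequentially. prob {\<omega> \<in> space P. \<delta> \<le> \<bar>1 / v n * (\<Sum>k<n. CE k (?l n k) \<omega>) - 0\<bar>} = 0"
    proof eventually_elim
      case (elim n)
      have vn: "v n > 0" using elim by (simp add: G_def)
      have "AE \<omega> in P. CE k (?l n k) \<omega> = 0" for k
      proof -
        have lm: "?l n k \<in> borel_measurable P"
        proof -
          have "?l n k = (\<lambda>\<omega>. (d n k \<omega>)\<^sup>2 * indicator {y. \<epsilon> * sqrt (v n) \<le> \<bar>y\<bar>} (d n k \<omega>))"
            by (simp add: indicator_def fun_eq_iff)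
          also have "\<dots> \<in> borel_measurable P" by measurable
          finally show ?thesis .
        qed
        have small: "\<epsilon> / 2 * sqrt (v n) < \<epsilon> * sqrt (v n)" using \<epsilon> vn by simp
        have "AE \<omega> in P. \<bar>d n k \<omega>\<bar> \<le> \<epsilon> / 2 * sqrt (v n)" using elim by (simp add: G_def)
        then have "AE \<omega> in P. ?l n k \<omega> = 0"
          by eventually_elim (use small in \<open>simp add: indicator_def\<close>)
        then have "AE \<omega> in P. CE k (?l n k) \<omega> = CE k (\<lambda>_. 0) \<omega>"
          by (rule F.real_cond_exp_cong) (use lm in auto)
        moreover have "AE \<omega> in P. CE k (\<lambda>_. 0) \<omega> = 0" by (rule F.real_cond_exp_F_meas) auto
        ultimately show ?thesis by eventually_elim simp
      qed
      then have "AE \<omega> in P. \<forall>k. CE k (?l n k) \<omega> = 0" by (simp add: AE_all_countable)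
      then have "AE \<omega> in P. \<not> \<delta> \<le> \<bar>1 / v n * (\<Sum>k<n. CE k (?l n k) \<omega>) - 0\<bar>"
        by eventually_elim (use \<delta> in simp)
      then show ?case by (rule prob_eq_0_AE)
    qed
    then show "(\<lambda>n. prob {\<omega> \<in> space P. \<delta> \<le> \<bar>1 / v n * (\<Sum>k<n. CE k (?l n k) \<omega>) - 0\<bar>}) \<longlonglongrightarrow> 0"
      by (rule tendsto_eventually)
  qed
  ultimately have "lindeberg_array D" unfolding lindeberg_array_def by blast
  then show thesis by (rule that)
qed

end

theorem theorem2:
  fixes P :: "'w measure" and S :: "'s measure" and X :: "int \<Rightarrow> 'w \<Rightarrow> 's"
    and Q :: "'s \<Rightarrow> 's measure" and Px :: "'s \<Rightarrow> 'w measure" and g :: "'s \<Rightarrow> real"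
  assumes "prob_space P"
    and "\<And>n. X n \<in> P \<rightarrow>\<^sub>M S"
    and "stationary_process P S X"
    and "ergodic_process P S X"
    and "markov_process P S X"
    and "regular_cond_distr P (X 0) S (X 1) S Q"
    and "regular_cond_distr P (X 0) S (\<lambda>\<omega>. \<omega>) (process_algebra P S X UNIV) Px"
    and "g \<in> borel_measurable S"
    and "integrable P (\<lambda>\<omega>. (g (X 0 \<omega>))\<^sup>2)"
    and "(\<integral>\<omega>. g (X 0 \<omega>) \<partial>P) = 0"
    and "filterlim (sum_variance P g X) at_top sequentially"
  shows "((\<lambda>n. \<integral>x. levy_dist (cdf std_normal_distribution) (cond_cdf P Px g X n x)
                 \<partial>(distr P S (X 0))) \<longlonglongrightarrow> 0)
    \<longleftrightarrow>
    (\<exists>D. martingale_approximation P S X g D \<and>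
       conv_in_prob P
         (\<lambda>n \<omega>. 1 / sum_variance P g X n *
           (\<Sum>k=1..n. real_cond_exp P (past_algebra P S X (int k - 1)) (\<lambda>\<omega>. (D n k \<omega>)\<^sup>2) \<omega>))
         (\<lambda>_. 1) \<and>
       (\<forall>\<epsilon>>0. conv_in_prob P
         (\<lambda>n \<omega>. 1 / sum_variance P g X n *
           (\<Sum>k=1..n. real_cond_exp P (past_algebra P S X (int k - 1))
              (\<lambda>\<omega>. (D n k \<omega>)\<^sup>2 * indicator {\<omega>. \<epsilon> * sum_sd P g X n \<le> \<bar>D n k \<omega>\<bar>} \<omega>) \<omega>))
         (\<lambda>_. 0)))"
proof -
  interpret P: prob_space P by fact
  interpret stationary_functional P S X Q Px g
    by unfold_locales (use assms in auto)
  show ?thesis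
    using levy_error_tendsto_iff lindeberg_array_imp_normal normal_imp_lindeberg_array
    unfolding lindeberg_array_def by blast
qed

end
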